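(* Let $H$ be an internal set and $\mathsf E$ a $\Delta^{\rm ss}_2$ equivalence relation on $H$ all of whose equivalence classes are sets of standard size. Then $\mathsf E$ has a $\Delta^{\rm ss}_2$ transversal (a $\Delta^{\rm ss}_2$ set meeting every $\mathsf E$-class in exactly one element), and hence $\mathsf E$ is $\Delta^{\rm ss}_2$-smooth.
   Context: Work in Hrbacek set theory HST, in the language with $\in$ and a standardness predicate $\mathrm{st}$; its universe contains the standard sets $\mathbb S$, the internal sets $\mathbb I=\{y:\exists^{\mathrm{st}}x\,(y\in x)\}$ (transitive, satisfying ZFC, elementary extension of $\mathbb S$) and the well-founded sets $\mathbb V$, isomorphic to $\mathbb S$; the universe is the von Neumann superstructure over $\mathbb I$. A set is of standard size if in bijection with a set in $\mathbb V$. $\Delta^{\rm ss}_2$ sets are subsets of $\mathbb I$ representable both as $\bigcup_{a\in A}\bigcap_{b\in B}X_{ab}$ and as $\bigcap_{a\in A}\bigcup_{b\in B}X_{ab}$ with $A,B\in\mathbb V$ and $X_{ab}$ internal. For equivalence relations $\mathsf E,\mathsf F$ on $X,Y$, an $\mathsf E$-$\mathsf F$ invariant pre-injection is $R\subseteq X\times Y$ with $\mathrm{dom}\,R=X$ and $x\,\mathsf E\,x'\iff y\,\mathsf F\,y'$ for all $\langle x,y\rangle,\langle x',y'\rangle\in R$. $\mathsf E$ on $X$ is $\Delta^{\rm ss}_2$-smooth if there is a $\Delta^{\rm ss}_2$ set $Y$ and a $\Delta^{\rm ss}_2$ $\mathsf E$-$(=_Y)$ invariant pre-injection of $X$ into $Y$,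 where $=_Y$ is equality on $Y$. *)

theory Defs
  imports Main
begin

(* First-order formulas of the language with membership and the standardness predicate St.
   Variables are named by natural numbers. *)

datatype fm =
    Mem nat nat
  | Equ nat nat
  | St nat
  | Neg fm
  | Conj fm fm
  | Exi nat fm

primrec st_free :: "fm \<Rightarrow> bool" where
  "st_free (Mem i j) \<longleftrightarrow> True"
| "st_free (Equ i j) \<longleftrightarrow> True"
| "st_free (St i) \<longleftrightarrow> False"
| "st_free (Neg \<phi>) \<longleftrightarrow> st_free \<phi>"
| "st_free (Conj \<phi> \<psi>) \<longleftrightarrow> st_free \<phi> \<and> st_free \<psi>"
| "st_free (Exi i \<phi>) \<longleftrightarrow> st_free \<phi>"

(* The type 'u is the universe of a first-order structure for this language, and its elements
   are the sets of that structure.  HOL sets of type 'u set play the role of classes. *)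

locale st_structure =
  fixes mem :: "'u \<Rightarrow> 'u \<Rightarrow> bool"  (infix "\<epsilon>" 50)
    and st :: "'u \<Rightarrow> bool"
begin

(* Satisfaction of the formula relativised to the class M: quantifiers range over M. *)

primrec sat :: "'u set \<Rightarrow> fm \<Rightarrow> (nat \<Rightarrow> 'u) \<Rightarrow> bool" where
  "sat M (Mem i j) \<rho> \<longleftrightarrow> \<rho> i \<epsilon> \<rho> j"
| "sat M (Equ i j) \<rho> \<longleftrightarrow> \<rho> i = \<rho> j"
| "sat M (St i) \<rho> \<longleftrightarrow> st (\<rho> i)"
| "sat M (Neg \<phi>) \<rho> \<longleftrightarrow> \<not> sat M \<phi> \<rho>"
| "sat M (Conj \<phi> \<psi>) \<rho> \<longleftrightarrow> sat M \<phi> \<rho> \<and> sat M \<psi> \<rho>"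
| "sat M (Exi i \<phi>) \<rho> \<longleftrightarrow> (\<exists>x\<in>M. sat M \<phi> (\<rho>(i := x)))"

definition standard :: "'u set" where
  "standard = {x. st x}"

definition internal :: "'u set" where
  "internal = {x. \<exists>y. st y \<and> x \<epsilon> y}"

definition subset :: "'u \<Rightarrow> 'u \<Rightarrow> bool" where
  "subset x y \<longleftrightarrow> (\<forall>z. z \<epsilon> x \<longrightarrow> z \<epsilon> y)"

definition nonempty :: "'u \<Rightarrow> bool" where
  "nonempty x \<longleftrightarrow> (\<exists>z. z \<epsilon> x)"

definition transitive :: "'u \<Rightarrow> bool" where
  "transitive x \<longleftrightarrow> (\<forall>y. y \<epsilon> x \<longrightarrow> subset y x)"

definition wellfounded :: "'u set" where
  "wellfounded = {x. \<exists>t. transitive t \<and> x \<epsilon> t \<and>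
     (\<forall>y. subset y t \<and> nonempty y \<longrightarrow> (\<exists>m. m \<epsilon> y \<and> \<not> (\<exists>z. z \<epsilon> y \<and> z \<epsilon> m)))}"

(* Kuratowski pairs: is_upair p x y says p = {x, y}, is_opair p x y says p = {{x}, {x, y}}. *)

definition is_upair :: "'u \<Rightarrow> 'u \<Rightarrow> 'u \<Rightarrow> bool" where
  "is_upair p x y \<longleftrightarrow> (\<forall>z. z \<epsilon> p \<longleftrightarrow> z = x \<or> z = y)"

definition is_opair :: "'u \<Rightarrow> 'u \<Rightarrow> 'u \<Rightarrow> bool" where
  "is_opair p x y \<longleftrightarrow> (\<forall>z. z \<epsilon> p \<longleftrightarrow> is_upair z x x \<or> is_upair z x y)"

definition is_prod :: "'u \<Rightarrow> 'u \<Rightarrow> 'u \<Rightarrow> bool" where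
  "is_prod D X Y \<longleftrightarrow> (\<forall>p. p \<epsilon> D \<longleftrightarrow> (\<exists>x y. x \<epsilon> X \<and> y \<epsilon> Y \<and> is_opair p x y))"

definition related :: "'u \<Rightarrow> 'u \<Rightarrow> 'u \<Rightarrow> bool" where
  "related R x y \<longleftrightarrow> (\<exists>p. p \<epsilon> R \<and> is_opair p x y)"

definition relation_between :: "'u \<Rightarrow> 'u \<Rightarrow> 'u \<Rightarrow> bool" where
  "relation_between R X Y \<longleftrightarrow> (\<forall>p. p \<epsilon> R \<longrightarrow> (\<exists>x y. x \<epsilon> X \<and> y \<epsilon> Y \<and> is_opair p x y))"

definition function_on :: "'u \<Rightarrow> 'u \<Rightarrow> bool" where
  "function_on f X \<longleftrightarrow>
     (\<forall>p. p \<epsilon> f \<longrightarrow> (\<exists>x y. x \<epsilon> X \<and> is_opair p x y)) \<and>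
     (\<forall>x. x \<epsilon> X \<longrightarrow> (\<exists>!y. related f x y))"

definition bijection :: "'u \<Rightarrow> 'u \<Rightarrow> 'u \<Rightarrow> bool" where
  "bijection f X Y \<longleftrightarrow> relation_between f X Y \<and>
     (\<forall>x. x \<epsilon> X \<longrightarrow> (\<exists>!y. related f x y)) \<and>
     (\<forall>y. y \<epsilon> Y \<longrightarrow> (\<exists>!x. related f x y))"

definition standard_size :: "'u \<Rightarrow> bool" where
  "standard_size X \<longleftrightarrow> (\<exists>v f. v \<in> wellfounded \<and> bijection f v X)"

(* The axioms of ZFC relativised to a class M. The schemata take the class of admissible
   formulas as an argument; the assignment supplies the parameters. *)

definition extensionality_ax :: "'u set \<Rightarrow> bool" where
  "extensionality_ax M \<longleftrightarrow> (\<forall>x\<in>M. \<forall>y\<in>M. (\<forall>z\<in>M. z \<epsilon> x \<longleftrightarrow> z \<epsilon> y) \<longrightarrow> x = y)"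

definition pairing_ax :: "'u set \<Rightarrow> bool" where
  "pairing_ax M \<longleftrightarrow> (\<forall>x\<in>M. \<forall>y\<in>M. \<exists>p\<in>M. \<forall>z\<in>M. z \<epsilon> p \<longleftrightarrow> z = x \<or> z = y)"

definition union_ax :: "'u set \<Rightarrow> bool" where
  "union_ax M \<longleftrightarrow> (\<forall>x\<in>M. \<exists>u\<in>M. \<forall>z\<in>M. z \<epsilon> u \<longleftrightarrow> (\<exists>y\<in>M. y \<epsilon> x \<and> z \<epsilon> y))"

definition inductive_in :: "'u set \<Rightarrow> 'u \<Rightarrow> bool" where
  "inductive_in M w \<longleftrightarrow>
     (\<exists>e\<in>M. e \<epsilon> w \<and> (\<forall>z\<in>M. \<not> z \<epsilon> e)) \<and>
     (\<forall>x\<in>M. x \<epsilon> w \<longrightarrow> (\<exists>y\<in>M. y \<epsilon> w \<and> (\<forall>z\<in>M. z \<epsilon> y \<longleftrightarrow> z \<epsilon> x \<or> z = x)))"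

definition infinity_ax :: "'u set \<Rightarrow> bool" where
  "infinity_ax M \<longleftrightarrow> (\<exists>w\<in>M. inductive_in M w)"

definition powerset_ax :: "'u set \<Rightarrow> bool" where
  "powerset_ax M \<longleftrightarrow> (\<forall>x\<in>M. \<exists>p\<in>M. \<forall>y\<in>M. y \<epsilon> p \<longleftrightarrow> (\<forall>z\<in>M. z \<epsilon> y \<longrightarrow> z \<epsilon> x))"

definition regularity_ax :: "'u set \<Rightarrow> bool" where
  "regularity_ax M \<longleftrightarrow> (\<forall>x\<in>M. (\<exists>y\<in>M. y \<epsilon> x) \<longrightarrow>
     (\<exists>y\<in>M. y \<epsilon> x \<and> \<not> (\<exists>z\<in>M. z \<epsilon> x \<and> z \<epsilon> y)))"

definition choice_ax :: "'u set \<Rightarrow> bool" where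
  "choice_ax M \<longleftrightarrow> (\<forall>x\<in>M.
     (\<forall>y\<in>M. y \<epsilon> x \<longrightarrow> (\<exists>z\<in>M. z \<epsilon> y)) \<and>
     (\<forall>y\<in>M. \<forall>y'\<in>M. y \<epsilon> x \<and> y' \<epsilon> x \<and> (\<exists>z\<in>M. z \<epsilon> y \<and> z \<epsilon> y') \<longrightarrow> y = y') \<longrightarrow>
     (\<exists>c\<in>M. \<forall>y\<in>M. y \<epsilon> x \<longrightarrow> (\<exists>!z. z \<in> M \<and> z \<epsilon> y \<and> z \<epsilon> c)))"

definition separation_ax :: "'u set \<Rightarrow> fm set \<Rightarrow> bool" where
  "separation_ax M \<Phi> \<longleftrightarrow> (\<forall>\<phi>\<in>\<Phi>. \<forall>\<rho>. range \<rho> \<subseteq> M \<longrightarrow>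
     (\<forall>x\<in>M. \<exists>y\<in>M. \<forall>z\<in>M. z \<epsilon> y \<longleftrightarrow> z \<epsilon> x \<and> sat M \<phi> (\<rho>(0 := z))))"

definition collection_ax :: "'u set \<Rightarrow> fm set \<Rightarrow> bool" where
  "collection_ax M \<Phi> \<longleftrightarrow> (\<forall>\<phi>\<in>\<Phi>. \<forall>\<rho>. range \<rho> \<subseteq> M \<longrightarrow>
     (\<forall>x\<in>M. \<exists>y\<in>M. \<forall>u\<in>M. u \<epsilon> x \<longrightarrow>
       (\<exists>v\<in>M. sat M \<phi> (\<rho>(0 := u, 1 := v))) \<longrightarrow>
       (\<exists>v\<in>M. v \<epsilon> y \<and> sat M \<phi> (\<rho>(0 := u, 1 := v)))))"

definition ZFC_in :: "'u set \<Rightarrow> bool" where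
  "ZFC_in M \<longleftrightarrow> extensionality_ax M \<and> pairing_ax M \<and> union_ax M \<and> infinity_ax M \<and>
     powerset_ax M \<and> regularity_ax M \<and> choice_ax M \<and>
     separation_ax M {\<phi>. st_free \<phi>} \<and> collection_ax M {\<phi>. st_free \<phi>}"

definition is_omega :: "'u \<Rightarrow> bool" where
  "is_omega w \<longleftrightarrow> inductive_in UNIV w \<and> (\<forall>v. inductive_in UNIV v \<longrightarrow> subset w v)"

end

(* Hrbacek set theory: the structure (mem, st) is a model of HST. *)

locale HST = st_structure mem st
  for mem :: "'u \<Rightarrow> 'u \<Rightarrow> bool"  (infix "\<epsilon>" 50)
    and st :: "'u \<Rightarrow> bool" +
  assumes extensionality: "extensionality_ax UNIV"
    and pairing: "pairing_ax UNIV"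
    and union: "union_ax UNIV"
    and infinity: "infinity_ax UNIV"
    and separation: "separation_ax UNIV UNIV"
    and collection: "collection_ax UNIV UNIV"
    and ZFC_standard: "ZFC_in standard"
    and transfer: "\<And>\<phi> \<rho>. st_free \<phi> \<Longrightarrow> range \<rho> \<subseteq> standard \<Longrightarrow>
      sat internal \<phi> \<rho> \<longleftrightarrow> sat standard \<phi> \<rho>"
    and internal_transitive: "\<And>x y. x \<in> internal \<Longrightarrow> y \<epsilon> x \<Longrightarrow> y \<in> internal"
    and regularity_over_internal: "\<And>X. nonempty X \<Longrightarrow>
      \<exists>x. x \<epsilon> X \<and> (\<forall>z. z \<epsilon> x \<and> z \<epsilon> X \<longrightarrow> z \<in> internal)"
    and standardization: "\<And>X. \<exists>Y\<in>standard. \<forall>x\<in>standard. x \<epsilon> Y \<longleftrightarrow> x \<epsilon> X"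
    and saturation: "\<And>\<X>. standard_size \<X> \<Longrightarrow>
      (\<And>X. X \<epsilon> \<X> \<Longrightarrow> X \<in> internal \<and> nonempty X) \<Longrightarrow>
      (\<And>X Y. X \<epsilon> \<X> \<Longrightarrow> Y \<epsilon> \<X> \<Longrightarrow> \<exists>Z. Z \<epsilon> \<X> \<and> (\<forall>z. z \<epsilon> Z \<longleftrightarrow> z \<epsilon> X \<and> z \<epsilon> Y)) \<Longrightarrow>
      \<exists>z. \<forall>X. X \<epsilon> \<X> \<longrightarrow> z \<epsilon> X"
    and standard_size_choice: "\<And>X F. standard_size X \<Longrightarrow> function_on F X \<Longrightarrow>
      (\<And>x Y. related F x Y \<Longrightarrow> nonempty Y) \<Longrightarrow>
      \<exists>f. function_on f X \<and> (\<forall>x y Y. related f x y \<and> related F x Y \<longrightarrow> y \<epsilon> Y)"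
    and dependent_choice: "\<And>X R. nonempty X \<Longrightarrow>
      (\<And>x. x \<epsilon> X \<Longrightarrow> \<exists>y. y \<epsilon> X \<and> related R x y) \<Longrightarrow>
      \<exists>w f. is_omega w \<and> function_on f w \<and> relation_between f w X \<and>
        (\<forall>n m x y. n \<epsilon> w \<and> m \<epsilon> w \<and> (\<forall>z. z \<epsilon> m \<longleftrightarrow> z \<epsilon> n \<or> z = n) \<and>
          related f n x \<and> related f m y \<longrightarrow> related R x y)"

context st_structure
begin

(* F is a family of internal sets X_ab indexed by (a, b) in A x B, with A and B well-founded. *)

definition index_value :: "'u \<Rightarrow> 'u \<Rightarrow> 'u \<Rightarrow> 'u \<Rightarrow> bool" where
  "index_value F a b X \<longleftrightarrow> (\<exists>p. is_opair p a b \<and> related F p X)"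

definition internal_family :: "'u \<Rightarrow> 'u \<Rightarrow> 'u \<Rightarrow> bool" where
  "internal_family F A B \<longleftrightarrow> A \<in> wellfounded \<and> B \<in> wellfounded \<and>
     (\<exists>D. is_prod D A B \<and> function_on F D) \<and>
     (\<forall>a b X. index_value F a b X \<longrightarrow> X \<in> internal)"

definition sigma2ss :: "'u \<Rightarrow> bool" where
  "sigma2ss X \<longleftrightarrow> (\<exists>A B F. internal_family F A B \<and>
     (\<forall>x. x \<epsilon> X \<longleftrightarrow>
       (\<exists>a. a \<epsilon> A \<and> (\<forall>b. b \<epsilon> B \<longrightarrow> (\<exists>Z. index_value F a b Z \<and> x \<epsilon> Z)))))"

definition pi2ss :: "'u \<Rightarrow> bool" where
  "pi2ss X \<longleftrightarrow> (\<exists>A B F. internal_family F A B \<and>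
     (\<forall>x. x \<epsilon> X \<longleftrightarrow>
       (\<forall>a. a \<epsilon> A \<longrightarrow> (\<exists>b. b \<epsilon> B \<and> (\<exists>Z. index_value F a b Z \<and> x \<epsilon> Z)))))"

(* The two representations may use different index sets and different families. *)

definition delta2ss :: "'u \<Rightarrow> bool" where
  "delta2ss X \<longleftrightarrow> (\<forall>x. x \<epsilon> X \<longrightarrow> x \<in> internal) \<and> sigma2ss X \<and> pi2ss X"

definition equivalence_on :: "'u \<Rightarrow> 'u \<Rightarrow> bool" where
  "equivalence_on E X \<longleftrightarrow> relation_between E X X \<and>
     (\<forall>x. x \<epsilon> X \<longrightarrow> related E x x) \<and>
     (\<forall>x y. related E x y \<longrightarrow> related E y x) \<and>
     (\<forall>x y z. related E x y \<and> related E y z \<longrightarrow> related E x z)"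

definition is_class_of :: "'u \<Rightarrow> 'u \<Rightarrow> 'u \<Rightarrow> bool" where
  "is_class_of C E X \<longleftrightarrow> (\<exists>x. x \<epsilon> X \<and> (\<forall>y. y \<epsilon> C \<longleftrightarrow> related E x y))"

definition is_transversal :: "'u \<Rightarrow> 'u \<Rightarrow> 'u \<Rightarrow> bool" where
  "is_transversal T E X \<longleftrightarrow> subset T X \<and>
     (\<forall>C. is_class_of C E X \<longrightarrow> (\<exists>!y. y \<epsilon> T \<and> y \<epsilon> C))"

definition invariant_preinjection :: "'u \<Rightarrow> 'u \<Rightarrow> 'u \<Rightarrow> 'u \<Rightarrow> 'u \<Rightarrow> bool" where
  "invariant_preinjection R E X F Y \<longleftrightarrow> relation_between R X Y \<and>
     (\<forall>x. x \<epsilon> X \<longrightarrow> (\<exists>y. related R x y)) \<and>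
     (\<forall>x y x' y'. related R x y \<and> related R x' y' \<longrightarrow> (related E x x' \<longleftrightarrow> related F y y'))"

definition is_equality_on :: "'u \<Rightarrow> 'u \<Rightarrow> bool" where
  "is_equality_on D Y \<longleftrightarrow> (\<forall>p. p \<epsilon> D \<longleftrightarrow> (\<exists>y. y \<epsilon> Y \<and> is_opair p y y))"

definition delta2ss_smooth :: "'u \<Rightarrow> 'u \<Rightarrow> bool" where
  "delta2ss_smooth E X \<longleftrightarrow> (\<exists>Y D R. delta2ss Y \<and> is_equality_on D Y \<and>
     delta2ss R \<and> invariant_preinjection R E X D Y)"

end

end

theory Submission
  imports Defs
begin

text \<open>Write \<open>E = (\<Union>a\<in>A. \<Inter>b\<in>B. X a b)\<close>. Since the classes have standard size, saturation yields
  for all \<open>a\<close> and \<open>a'\<close> in \<open>A\<close> a finite \<open>\<beta> \<subseteq> B\<close> such that the symmetric internal graph, consisting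
  of the pairs in \<open>\<Inter>b\<in>\<beta>. X a b\<close> whose converse is in \<open>\<Inter>b\<in>\<beta>. X a' b\<close>, has degrees bounded by a
  finite number. An internal application of Zorn's lemma colours this graph with finitely
  many colours. The colour classes of all these graphs form a family \<open>(U j)\<close> of internal sets,
  indexed by a well-founded set \<open>J\<close>, which separates any two distinct equivalent points, that is,
  \<open>r x = {j \<in> J. x \<in> U j}\<close> is injective on every class. As the power set of \<open>J\<close> is well-founded, a
  choice function \<open>c\<close> selects one point from each image \<open>r ` [x]\<close>, and \<open>{x. r x = c (r ` [x])}\<close> is
  a transversal. By saturation, membership in it depends only on which members of a suitable
  standard size family of internal sets contain \<open>x\<close>; a set with this property is
  \<open>\<Delta>\<^sup>s\<^sup>s\<^sub>2\<close>, the types of points serving as indices of both representations.\<close>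

subsection \<open>Definability with parameters\<close>

text \<open>HST has no power set axiom and grants choice only over sets of standard size, so
  representatives cannot be chosen directly: there may be too many classes. The codes
  \<open>r x\<close> remedy this. They are subsets of a well-founded set, a class leaves only the
  trace \<open>Q x\<close> of its codes, and all possible traces lie in one well-founded set, over
  which choice is available. The power sets used here are themselves imported from the standard
  universe. Finiteness and degree bounds are phrased without numbers. Finite sets are generated from
  \<open>emp\<close> by inserting points, and a section counts as smaller than a finite
  \<open>K\<close> if no internal partial function maps it onto \<open>K\<close>. For a given
  \<open>K\<close> this is an st-free condition, so that both saturation and the internal form of
  Zorn's lemma can work with it. Separation and collection are schemes over formulas. Hence each set
  formed below owes a proof that its defining property is definable, and definable without
  \<open>st\<close> and with internal parameters if the set is to be internal. The predicates
  \<open>dfn\<close> and \<open>trm\<close> make these proofs a matter of resolution.\<close>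

primrec ren :: "(nat \<Rightarrow> nat) \<Rightarrow> fm \<Rightarrow> fm" where
  "ren f (Mem i j) = Mem (f i) (f j)"
| "ren f (Equ i j) = Equ (f i) (f j)"
| "ren f (St i) = St (f i)"
| "ren f (Neg \<phi>) = Neg (ren f \<phi>)"
| "ren f (Conj \<phi> \<psi>) = Conj (ren f \<phi>) (ren f \<psi>)"
| "ren f (Exi i \<phi>) = Exi (f i) (ren f \<phi>)"

lemma st_free_ren [simp]: "st_free (ren f \<phi>) = st_free \<phi>"
  by (induction \<phi>) auto

primrec var_bound :: "fm \<Rightarrow> nat" where
  "var_bound (Mem i j) = Suc (max i j)"
| "var_bound (Equ i j) = Suc (max i j)"
| "var_bound (St i) = Suc i"
| "var_bound (Neg \<phi>) = var_bound \<phi>"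
| "var_bound (Conj \<phi> \<psi>) = max (var_bound \<phi>) (var_bound \<psi>)"
| "var_bound (Exi i \<phi>) = max (Suc i) (var_bound \<phi>)"

definition All :: "nat \<Rightarrow> fm \<Rightarrow> fm" where
  "All i \<phi> = Neg (Exi i (Neg \<phi>))"

definition Imp :: "fm \<Rightarrow> fm \<Rightarrow> fm" where
  "Imp \<phi> \<psi> = Neg (Conj \<phi> (Neg \<psi>))"

definition Iff :: "fm \<Rightarrow> fm \<Rightarrow> fm" where
  "Iff \<phi> \<psi> = Conj (Imp \<phi> \<psi>) (Imp \<psi> \<phi>)"

primrec closure :: "nat \<Rightarrow> fm \<Rightarrow> fm" where
  "closure 0 \<phi> = \<phi>"
| "closure (Suc n) \<phi> = All n (closure n \<phi>)"

lemma st_free_All [simp]: "st_free (All i \<phi>) = st_free \<phi>"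
  and st_free_Imp [simp]: "st_free (Imp \<phi> \<psi>) = (st_free \<phi> \<and> st_free \<psi>)"
  and st_free_Iff [simp]: "st_free (Iff \<phi> \<psi>) = (st_free \<phi> \<and> st_free \<psi>)"
  by (auto simp: All_def Imp_def Iff_def)

lemma st_free_closure [simp]: "st_free (closure n \<phi>) = st_free \<phi>"
  by (induction n) auto

text \<open>Even positions carry the variables and odd positions the parameters, so that neither
  supply ever runs out.\<close>

definition merge :: "(nat \<Rightarrow> 'u) \<Rightarrow> (nat \<Rightarrow> 'u) \<Rightarrow> nat \<Rightarrow> 'u" where
  "merge \<rho> \<pi> n = (if even n then \<rho> (n div 2) else \<pi> (n div 2))"

lemma merge_simps [simp]:
  "merge \<rho> \<pi> (2 * n) = \<rho> n" "merge \<rho> \<pi> (Suc (2 * n)) = \<pi> n"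
  by (auto simp: merge_def)

lemma range_merge: "range \<rho> \<subseteq> M \<Longrightarrow> range \<pi> \<subseteq> M \<Longrightarrow> range (merge \<rho> \<pi>) \<subseteq> M"
  by (auto simp: merge_def)

lemma range_case_nat: "x \<in> M \<Longrightarrow> range \<rho> \<subseteq> M \<Longrightarrow> range (case_nat x \<rho>) \<subseteq> M"
  by (auto simp: image_subset_iff split: nat.split)

context st_structure
begin

lemma sat_All [simp]: "sat M (All i \<phi>) \<rho> \<longleftrightarrow> (\<forall>x\<in>M. sat M \<phi> (\<rho>(i := x)))"
  and sat_Imp [simp]: "sat M (Imp \<phi> \<psi>) \<rho> \<longleftrightarrow> (sat M \<phi> \<rho> \<longrightarrow> sat M \<psi> \<rho>)"
  and sat_Iff [simp]: "sat M (Iff \<phi> \<psi>) \<rho> \<longleftrightarrow> (sat M \<phi> \<rho> \<longleftrightarrow> sat M \<psi> \<rho>)"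
  by (auto simp: All_def Imp_def Iff_def)

text \<open>\<open>ren\<close> renames bound variables too; injectivity of \<open>f\<close> is what
  prevents capture.\<close>

lemma sat_ren: "inj f \<Longrightarrow> sat M (ren f \<phi>) \<rho> = sat M \<phi> (\<rho> \<circ> f)"
proof (induction \<phi> arbitrary: \<rho>)
  case (Exi i \<phi>)
  have *: "(\<rho>(f i := x)) \<circ> f = (\<rho> \<circ> f)(i := x)" for x
    using Exi.prems by (auto simp: fun_eq_iff inj_eq)
  show ?case by (simp only: ren.simps sat.simps Exi.IH[OF Exi.prems] *)
qed (auto simp: comp_def)

lemma sat_agree: "\<forall>n < var_bound \<phi>. \<rho> n = \<sigma> n \<Longrightarrow> sat M \<phi> \<rho> = sat M \<phi> \<sigma>"
proof (induction \<phi> arbitrary: \<rho> \<sigma>)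
  case (Exi i \<phi>)
  have "sat M \<phi> (\<rho>(i := x)) = sat M \<phi> (\<sigma>(i := x))" for x
    by (rule Exi.IH) (simp add: Exi.prems)
  then show ?case by simp
next
  case (Conj \<phi> \<psi>)
  have "sat M \<phi> \<rho> = sat M \<phi> \<sigma>"
    by (rule Conj.IH) (simp add: Conj.prems)
  moreover have "sat M \<psi> \<rho> = sat M \<psi> \<sigma>"
    by (rule Conj.IH) (simp add: Conj.prems)
  ultimately show ?case by simp
next
  case (Neg \<phi>)
  then show ?case by simp
qed (simp_all add: less_Suc_eq_le)

lemma sat_closure:
  "sat M (closure n \<phi>) \<rho> \<longleftrightarrow>
    (\<forall>\<sigma>. (\<forall>k<n. \<sigma> k \<in> M) \<and> (\<forall>k\<ge>n. \<sigma> k = \<rho> k) \<longrightarrow> sat M \<phi> \<sigma>)"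
proof (induction n arbitrary: \<rho>)
  case 0
  have "\<sigma> = \<rho>" if "\<forall>k\<ge>0. \<sigma> k = \<rho> k" for \<sigma>
    using that by (auto simp: fun_eq_iff)
  then show ?case by auto
next
  case (Suc n)
  show ?case
  proof (intro iffI allI impI)
    fix \<sigma>
    assume *: "sat M (closure (Suc n) \<phi>) \<rho>"
      and \<sigma>: "(\<forall>k<Suc n. \<sigma> k \<in> M) \<and> (\<forall>k\<ge>Suc n. \<sigma> k = \<rho> k)"
    have "sat M (closure n \<phi>) (\<rho>(n := \<sigma> n))"
      using * \<sigma> by simp
    then show "sat M \<phi> \<sigma>"
      unfolding Suc.IH using \<sigma> by (auto simp: le_Suc_eq Suc_le_eq)
  next
    assume *: "\<forall>\<sigma>. (\<forall>k<Suc n. \<sigma> k \<in> M) \<and> (\<forall>k\<ge>Suc n. \<sigma> k = \<rho> k) \<longrightarrow> sat M \<phi> \<sigma>"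
    have "sat M (closure n \<phi>) (\<rho>(n := x))" if "x \<in> M" for x
      unfolding Suc.IH
    proof (intro allI impI)
      fix \<sigma> assume "(\<forall>k<n. \<sigma> k \<in> M) \<and> (\<forall>k\<ge>n. \<sigma> k = (\<rho>(n := x)) k)"
      then show "sat M \<phi> \<sigma>" using * that by (auto simp: less_Suc_eq)
    qed
    then show "sat M (closure (Suc n) \<phi>) \<rho>" by simp
  qed
qed

text \<open>Validity under all assignments becomes the truth of one formula without free variables.
  In this form it can pass through \<open>transfer\<close>, which admits standard parameters
  only.\<close>

lemma sat_closure_valid:
  assumes "M \<noteq> {}" "range \<rho> \<subseteq> M"
  shows "sat M (closure (var_bound \<phi>) \<phi>) \<rho> \<longleftrightarrow> (\<forall>\<sigma>. range \<sigma> \<subseteq> M \<longrightarrow> sat M \<phi> \<sigma>)"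
proof
  assume *: "sat M (closure (var_bound \<phi>) \<phi>) \<rho>"
  show "\<forall>\<sigma>. range \<sigma> \<subseteq> M \<longrightarrow> sat M \<phi> \<sigma>"
  proof (intro allI impI)
    fix \<sigma> :: "nat \<Rightarrow> 'u" assume \<sigma>: "range \<sigma> \<subseteq> M"
    define \<tau> where "\<tau> = (\<lambda>k. if k < var_bound \<phi> then \<sigma> k else \<rho> k)"
    have "sat M \<phi> \<tau>"
      using *[unfolded sat_closure, rule_format, of \<tau>] \<sigma> by (auto simp: \<tau>_def)
    then show "sat M \<phi> \<sigma>"
      using sat_agree[of \<phi> \<tau> \<sigma> M] by (simp add: \<tau>_def)
  qed
next
  assume *: "\<forall>\<sigma>. range \<sigma> \<subseteq> M \<longrightarrow> sat M \<phi> \<sigma>"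
  have "range \<sigma> \<subseteq> M" if "(\<forall>k<n. \<sigma> k \<in> M) \<and> (\<forall>k\<ge>n. \<sigma> k = \<rho> k)" for \<sigma> n
  proof -
    have "\<sigma> k \<in> M" for k
      using that assms(2) by (cases "k < n") auto
    then show ?thesis by blast
  qed
  then show "sat M (closure (var_bound \<phi>) \<phi>) \<rho>"
    unfolding sat_closure by (intro allI impI *[rule_format])
qed

text \<open>The flag selects the language and the range of the quantifiers: \<^term>\<open>True\<close> stands for
  the st-free language over the internal sets, \<^term>\<open>False\<close> for the full language over the
  whole universe.\<close>

definition cls :: "bool \<Rightarrow> 'u set" where
  "cls i = (if i then internal else UNIV)"

section \<open>Definable predicates as a shallow embedding of formulas with parameters\<close>

definition basic :: "bool \<Rightarrow> ((nat \<Rightarrow> 'u) \<Rightarrow> 'u) \<Rightarrow> bool" where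
  "basic i t \<longleftrightarrow> (\<exists>k. t = (\<lambda>\<rho>. \<rho> k)) \<or> (\<exists>c\<in>cls i. t = (\<lambda>\<rho>. c))"

text \<open>These are HOL predicates on assignments rather than formulas, so that definability can
  be proved by introduction rules. The quantifier binds variable 0 and shifts the others, as with de
  Bruijn indices. Only the full language has the clause for \<open>st\<close>.\<close>

inductive dfn0 :: "bool \<Rightarrow> ((nat \<Rightarrow> 'u) \<Rightarrow> bool) \<Rightarrow> bool" for i where
  basic_mem: "basic i s \<Longrightarrow> basic i t \<Longrightarrow> dfn0 i (\<lambda>\<rho>. s \<rho> \<epsilon> t \<rho>)"
| basic_eq: "basic i s \<Longrightarrow> basic i t \<Longrightarrow> dfn0 i (\<lambda>\<rho>. s \<rho> = t \<rho>)"
| basic_st: "\<not> i \<Longrightarrow> basic i t \<Longrightarrow> dfn0 i (\<lambda>\<rho>. st (t \<rho>))"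
| neg: "dfn0 i P \<Longrightarrow> dfn0 i (\<lambda>\<rho>. \<not> P \<rho>)"
| conj: "dfn0 i P \<Longrightarrow> dfn0 i Q \<Longrightarrow> dfn0 i (\<lambda>\<rho>. P \<rho> \<and> Q \<rho>)"
| ex: "dfn0 i P \<Longrightarrow> dfn0 i (\<lambda>\<rho>. \<exists>x\<in>cls i. P (case_nat x \<rho>))"

lemma basic_closed: "basic i t \<Longrightarrow> range \<rho> \<subseteq> cls i \<Longrightarrow> t \<rho> \<in> cls i"
  by (auto simp: basic_def)

lemma basic_var [simp]: "basic i (\<lambda>\<rho>. \<rho> k)"
  and basic_const [simp]: "c \<in> cls i \<Longrightarrow> basic i (\<lambda>\<rho>. c)"
  by (auto simp: basic_def)

lemma basic_subst: "basic i t \<Longrightarrow> (\<And>n. basic i (s n)) \<Longrightarrow> basic i (\<lambda>\<rho>. t (\<lambda>n. s n \<rho>))"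
  by (auto simp: basic_def)

lemma dfn0_subst:
  "dfn0 i P \<Longrightarrow> (\<And>n. basic i (s n)) \<Longrightarrow> dfn0 i (\<lambda>\<rho>. P (\<lambda>n. s n \<rho>))"
proof (induction arbitrary: s rule: dfn0.induct)
  case (basic_mem t u)
  show ?case
    by (rule dfn0.basic_mem; rule basic_subst[where s = s]) (fact basic_mem)+
next
  case (basic_eq t u)
  show ?case
    by (rule dfn0.basic_eq; rule basic_subst[where s = s]) (fact basic_eq)+
next
  case (basic_st t)
  show ?case
    by (rule dfn0.basic_st, fact, rule basic_subst[where s = s]) (fact basic_st)+
next
  case (neg P)
  show ?case by (rule dfn0.neg, rule neg.IH) (fact neg.prems)
next
  case (conj P Q)
  show ?case by (rule dfn0.conj; rule conj.IH) (fact conj.prems)+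
next
  case (ex P)
  \<comment> \<open>The substitution under the quantifier: the bound variable 0 stays, everything
    else is shifted by one.\<close>
  define s' where "s' n = (case n of 0 \<Rightarrow> (\<lambda>\<rho>. \<rho> 0) | Suc m \<Rightarrow> (\<lambda>\<rho>. s m (\<lambda>k. \<rho> (Suc k))))" for n
  have "basic i (s' n)" for n
  proof (cases n)
    case (Suc m)
    show ?thesis
      using basic_subst[OF ex.prems[of m] basic_var, of Suc] by (simp add: s'_def Suc)
  qed (simp add: s'_def)
  then have "dfn0 i (\<lambda>\<rho>. \<exists>x\<in>cls i. P (\<lambda>n. s' n (case_nat x \<rho>)))"
    by (intro dfn0.ex ex.IH)
  moreover have "(\<lambda>n. s' n (case_nat x \<rho>)) = case_nat x (\<lambda>n. s n \<rho>)" for x \<rho>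
    by (auto simp: fun_eq_iff s'_def split: nat.split)
  ultimately show ?case by simp
qed

text \<open>A variable \<open>k\<close> is found at position \<open>2 * k\<close>; a constant is
  stored in parameter slot \<open>j\<close>, at position \<open>Suc (2 * j)\<close>. If the term is
  a variable, the slot receives an arbitrary member of the class.\<close>

lemma basic_merge:
  assumes "basic i t" "cls i \<noteq> {}"
  shows "\<exists>c\<in>cls i. \<exists>k. \<forall>\<rho> \<pi>. \<pi> j = c \<longrightarrow> t \<rho> = merge \<rho> \<pi> k"
  using assms(1) unfolding basic_def
proof
  assume "\<exists>k. t = (\<lambda>\<rho>. \<rho> k)"
  then obtain k where "t = (\<lambda>\<rho>. \<rho> k)" ..
  moreover obtain e where "e \<in> cls i" using assms(2) by blast
  ultimately show ?thesis by (intro bexI[of _ e] exI[of _ "2 * k"]) auto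
next
  assume "\<exists>a\<in>cls i. t = (\<lambda>\<rho>. a)"
  then obtain a where "a \<in> cls i" "t = (\<lambda>\<rho>. a)" ..
  then show ?thesis by (intro bexI[of _ a] exI[of _ "Suc (2 * j)"]) auto
qed

lemma basic_merge2:
  assumes s: "basic i s" and t: "basic i t" and ne: "cls i \<noteq> {}"
  shows "\<exists>\<pi> k l. range \<pi> \<subseteq> cls i \<and> (\<forall>\<rho>. s \<rho> = merge \<rho> \<pi> k \<and> t \<rho> = merge \<rho> \<pi> l)"
proof -
  from basic_merge[OF s ne, of 0] obtain c k where
    c: "c \<in> cls i" "\<forall>\<rho> \<pi>. \<pi> 0 = c \<longrightarrow> s \<rho> = merge \<rho> \<pi> k" by (elim bexE exE)
  from basic_merge[OF t ne, of "Suc 0"] obtain d l where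
    d: "d \<in> cls i" "\<forall>\<rho> \<pi>. \<pi> (Suc 0) = d \<longrightarrow> t \<rho> = merge \<rho> \<pi> l" by (elim bexE exE)
  have "range (case_nat c (\<lambda>_. d)) \<subseteq> cls i"
    using c(1) d(1) by (auto simp: image_subset_iff split: nat.split)
  moreover have "s \<rho> = merge \<rho> (case_nat c (\<lambda>_. d)) k" for \<rho>
    by (rule c(2)[rule_format]) (rule nat.case(1))
  moreover have "t \<rho> = merge \<rho> (case_nat c (\<lambda>_. d)) l" for \<rho>
    by (rule d(2)[rule_format]) (rule nat.case(2))
  ultimately show ?thesis by (intro exI conjI allI)
qed

text \<open>This leads back from the embedding to actual formulas, to which the axiom schemes apply.
  All the work lies in rearranging parameters so that one tuple serves the whole formula.\<close>

lemma dfn0_formula: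
  assumes "dfn0 i P" "cls i \<noteq> {}"
  shows "\<exists>\<phi> \<pi>. (i \<longrightarrow> st_free \<phi>) \<and> range \<pi> \<subseteq> cls i \<and>
    (\<forall>\<rho>. range \<rho> \<subseteq> cls i \<longrightarrow> P \<rho> = sat (cls i) \<phi> (merge \<rho> \<pi>))"
  using assms(1)
proof induction
  case (basic_mem s t)
  from basic_merge2[OF basic_mem assms(2)] obtain \<pi> k l where "range \<pi> \<subseteq> cls i" "\<forall>\<rho>. s \<rho> = merge \<rho> \<pi> k \<and> t \<rho> = merge \<rho> \<pi> l"
    by (elim exE conjE)
  then show ?case by (intro exI[of _ "Mem k l"] exI[of _ \<pi>]) simp
next
  case (basic_eq s t)
  from basic_merge2[OF basic_eq assms(2)] obtain \<pi> k l where "range \<pi> \<subseteq> cls i" "\<forall>\<rho>. s \<rho> = merge \<rho> \<pi> k \<and> t \<rho> = merge \<rho> \<pi> l"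
    by (elim exE conjE)
  then show ?case by (intro exI[of _ "Equ k l"] exI[of _ \<pi>]) simp
next
  case (basic_st t)
  from basic_merge2[OF basic_st(2,2) assms(2)] obtain \<pi> k l where
    "range \<pi> \<subseteq> cls i" "\<forall>\<rho>. t \<rho> = merge \<rho> \<pi> k \<and> t \<rho> = merge \<rho> \<pi> l"
    by (elim exE conjE)
  then show ?case using basic_st by (intro exI[of _ "St k"] exI[of _ \<pi>]) simp
next
  case (neg P)
  then obtain \<phi> \<pi> where "i \<longrightarrow> st_free \<phi>" "range \<pi> \<subseteq> cls i"
    "\<forall>\<rho>. range \<rho> \<subseteq> cls i \<longrightarrow> P \<rho> = sat (cls i) \<phi> (merge \<rho> \<pi>)" by (elim exE conjE)
  then show ?case by (intro exI[of _ "Neg \<phi>"] exI[of _ \<pi>]) simp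
next
  case (conj P Q)
  obtain \<phi> \<pi> where 1: "i \<longrightarrow> st_free \<phi>" "range \<pi> \<subseteq> cls i"
    "\<forall>\<rho>. range \<rho> \<subseteq> cls i \<longrightarrow> P \<rho> = sat (cls i) \<phi> (merge \<rho> \<pi>)" using conj.IH(1) by (elim exE conjE)
  obtain \<psi> \<pi>' where 2: "i \<longrightarrow> st_free \<psi>" "range \<pi>' \<subseteq> cls i"
    "\<forall>\<rho>. range \<rho> \<subseteq> cls i \<longrightarrow> Q \<rho> = sat (cls i) \<psi> (merge \<rho> \<pi>')" using conj.IH(2) by (elim exE conjE)
  \<comment> \<open>\<open>\<pi>\<close> and \<open>\<pi>'\<close> are interleaved on the odd
    positions. \<open>f\<close> and \<open>g\<close> fix the variables and send slot
    \<open>m\<close> of \<open>\<pi>\<close> and of \<open>\<pi>'\<close> to slots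
    \<open>2 * m\<close> and \<open>Suc (2 * m)\<close> of the common tuple.\<close>
  define f where "f n = (if even n then n else Suc (2 * (2 * (n div 2))))" for n :: nat
  define g where "g n = (if even n then n else Suc (2 * Suc (2 * (n div 2))))" for n :: nat
  have f: "inj f" and g: "inj g"
    by (rule injI; simp add: f_def g_def split: if_splits; presburger)+
  have "merge \<rho> (merge \<pi> \<pi>') \<circ> f = merge \<rho> \<pi>" "merge \<rho> (merge \<pi> \<pi>') \<circ> g = merge \<rho> \<pi>'" for \<rho>
    by (auto simp: fun_eq_iff f_def g_def merge_def elim: oddE)
  then have "\<forall>\<rho>. range \<rho> \<subseteq> cls i \<longrightarrow>
      (P \<rho> \<and> Q \<rho>) = sat (cls i) (Conj (ren f \<phi>) (ren g \<psi>)) (merge \<rho> (merge \<pi> \<pi>'))"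
    using 1(3) 2(3) by (simp add: sat_ren f g)
  moreover have "i \<longrightarrow> st_free (Conj (ren f \<phi>) (ren g \<psi>))"
    using 1(1) 2(1) by simp
  ultimately show ?case
    using range_merge[OF 1(2) 2(2)] by (intro exI conjI)
next
  case (ex P)
  then obtain \<phi> \<pi> where \<phi>: "i \<longrightarrow> st_free \<phi>" "range \<pi> \<subseteq> cls i"
    "\<forall>\<rho>. range \<rho> \<subseteq> cls i \<longrightarrow> P \<rho> = sat (cls i) \<phi> (merge \<rho> \<pi>)" by (elim exE conjE)
  obtain e where e: "e \<in> cls i" using assms(2) by blast
  \<comment> \<open>The bound variable 0 moves to position 1, which is set free by putting the dummy
    \<open>e\<close> in front of the parameters. The other variables lose their shift (down by 2),
    and the parameters move up by 2.\<close>
  define g where "g n = (if n = 0 then 1 else if even n then n - 2 else n + 2)" for n :: nat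
  have g: "inj g"
    by (rule injI) (simp add: g_def split: if_splits; presburger)
  have "((merge \<rho> (case_nat e \<pi>))(Suc 0 := x)) (g n) = merge (case_nat x \<rho>) \<pi> n" for \<rho> x n
  proof (cases "even n")
    case True
    then obtain m where "n = 2 * m" by blast
    then show ?thesis
      using merge_simps(1)[of _ _ "m - 1"] by (cases m) (auto simp: g_def merge_def)
  next
    case False
    then obtain m where "n = 2 * m + 1" by (rule oddE)
    then have m: "n = Suc (2 * m)" by simp
    then have "g n = Suc (2 * Suc m)" by (simp add: g_def)
    then have "((merge \<rho> (case_nat e \<pi>))(Suc 0 := x)) (g n) = merge \<rho> (case_nat e \<pi>) (Suc (2 * Suc m))"
      by (simp add: m)
    also have "\<dots> = \<pi> m" unfolding merge_simps by simp
    finally show ?thesis by (simp add: m)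
  qed
  then have *: "((merge \<rho> (case_nat e \<pi>))(Suc 0 := x)) \<circ> g = merge (case_nat x \<rho>) \<pi>" for \<rho> x
    unfolding comp_def by (rule ext)
  have "\<forall>\<rho>. range \<rho> \<subseteq> cls i \<longrightarrow> (\<exists>x\<in>cls i. P (case_nat x \<rho>)) =
      sat (cls i) (Exi (Suc 0) (ren g \<phi>)) (merge \<rho> (case_nat e \<pi>))"
    unfolding sat.simps sat_ren[OF g] *
    by (intro allI impI bex_cong refl \<phi>(3)[rule_format] range_case_nat)
  moreover have "i \<longrightarrow> st_free (Exi (Suc 0) (ren g \<phi>))"
    using \<phi>(1) by simp
  moreover have "range (case_nat e \<pi>) \<subseteq> cls i"
    by (intro range_case_nat e \<phi>(2))
  ultimately show ?case by (intro exI conjI)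
qed

text \<open>Only values inside \<open>cls i\<close> matter. Closing \<open>dfn0\<close> under
  agreement there allows a predicate to be replaced by an equivalent one that quantifies over
  \<open>cls i\<close>.\<close>

definition dfn :: "bool \<Rightarrow> ((nat \<Rightarrow> 'u) \<Rightarrow> bool) \<Rightarrow> bool" where
  "dfn i P \<longleftrightarrow> (\<exists>Q. dfn0 i Q \<and> (\<forall>\<rho>. range \<rho> \<subseteq> cls i \<longrightarrow> P \<rho> = Q \<rho>))"

lemma dfn0_dfn: "dfn0 i P \<Longrightarrow> dfn i P"
  unfolding dfn_def by blast

lemma dfn_equiv:
  assumes "dfn i P" "\<And>\<rho>. range \<rho> \<subseteq> cls i \<Longrightarrow> Q \<rho> = P \<rho>"
  shows "dfn i Q"
proof -
  obtain R where "dfn0 i R" "\<forall>\<rho>. range \<rho> \<subseteq> cls i \<longrightarrow> P \<rho> = R \<rho>"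
    using assms(1) unfolding dfn_def by (elim exE conjE)
  then show ?thesis
    unfolding dfn_def using assms(2) by (intro exI[of _ R]) simp
qed

lemma dfn_subst:
  assumes "dfn i P" "\<And>n. basic i (s n)"
  shows "dfn i (\<lambda>\<rho>. P (\<lambda>n. s n \<rho>))"
proof -
  obtain R where R: "dfn0 i R" "\<forall>\<rho>. range \<rho> \<subseteq> cls i \<longrightarrow> P \<rho> = R \<rho>"
    using assms(1) unfolding dfn_def by (elim exE conjE)
  have "range (\<lambda>n. s n \<rho>) \<subseteq> cls i" if "range \<rho> \<subseteq> cls i" for \<rho>
    using basic_closed[OF assms(2) that] by blast
  then show ?thesis
    unfolding dfn_def using R(2) dfn0_subst[OF R(1) assms(2)]
    by (intro exI[of _ "\<lambda>\<rho>. R (\<lambda>n. s n \<rho>)"]) simp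
qed

lemma dfn_formula:
  assumes "dfn i P" "cls i \<noteq> {}"
  obtains \<phi> \<pi> where "i \<longrightarrow> st_free \<phi>" "range \<pi> \<subseteq> cls i"
    "\<And>\<rho>. range \<rho> \<subseteq> cls i \<Longrightarrow> P \<rho> = sat (cls i) \<phi> (merge \<rho> \<pi>)"
proof -
  obtain R where R: "dfn0 i R" "\<forall>\<rho>. range \<rho> \<subseteq> cls i \<longrightarrow> P \<rho> = R \<rho>"
    using assms(1) unfolding dfn_def by (elim exE conjE)
  show ?thesis
    using dfn0_formula[OF R(1) assms(2)] R(2) that by (elim exE conjE) simp
qed

lemma dfn_neg: "dfn i P \<Longrightarrow> dfn i (\<lambda>\<rho>. \<not> P \<rho>)"
  unfolding dfn_def by (elim exE conjE, rule exI, rule conjI, erule dfn0.neg) simp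

lemma dfn_conj:
  assumes "dfn i P" "dfn i Q"
  shows "dfn i (\<lambda>\<rho>. P \<rho> \<and> Q \<rho>)"
proof -
  obtain P' where 1: "dfn0 i P'" "\<forall>\<rho>. range \<rho> \<subseteq> cls i \<longrightarrow> P \<rho> = P' \<rho>"
    using assms(1) unfolding dfn_def by (elim exE conjE)
  obtain Q' where 2: "dfn0 i Q'" "\<forall>\<rho>. range \<rho> \<subseteq> cls i \<longrightarrow> Q \<rho> = Q' \<rho>"
    using assms(2) unfolding dfn_def by (elim exE conjE)
  show ?thesis
    unfolding dfn_def using 1(2) 2(2) dfn0.conj[OF 1(1) 2(1)]
    by (intro exI[of _ "\<lambda>\<rho>. P' \<rho> \<and> Q' \<rho>"]) simp
qed

lemma dfn_Bex_cls:
  assumes "dfn i (\<lambda>\<rho>. Q (\<rho> 0) (\<lambda>n. \<rho> (Suc n)))"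
  shows "dfn i (\<lambda>\<rho>. \<exists>x\<in>cls i. Q x \<rho>)"
proof -
  obtain R where R: "dfn0 i R"
    "\<forall>\<rho>. range \<rho> \<subseteq> cls i \<longrightarrow> Q (\<rho> 0) (\<lambda>n. \<rho> (Suc n)) = R \<rho>"
    using assms unfolding dfn_def by (elim exE conjE)
  have "Q x \<rho> = R (case_nat x \<rho>)" if "x \<in> cls i" "range \<rho> \<subseteq> cls i" for x \<rho>
    using R(2)[rule_format, OF range_case_nat[OF that]] by simp
  then show ?thesis
    unfolding dfn_def by (intro exI[of _ "\<lambda>\<rho>. \<exists>x\<in>cls i. R (case_nat x \<rho>)"])
      (auto intro: dfn0.ex[OF R(1)])
qed

lemma dfn_const: "cls i \<noteq> {} \<Longrightarrow> dfn i (\<lambda>\<rho>. b)"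
proof -
  assume "cls i \<noteq> {}"
  then obtain c where c: "c \<in> cls i" by blast
  show "dfn i (\<lambda>\<rho>. b)"
  proof (cases b)
    case True
    then show ?thesis
      using dfn0_dfn[OF basic_eq[OF basic_const basic_const], OF c c] by simp
  next
    case False
    then show ?thesis
      using dfn_neg[OF dfn0_dfn[OF basic_eq[OF basic_const basic_const], OF c c]] by simp
  qed
qed

end

definition Dis :: "fm \<Rightarrow> fm \<Rightarrow> fm" where
  "Dis \<phi> \<psi> = Neg (Conj (Neg \<phi>) (Neg \<psi>))"

lemma st_free_Dis [simp]: "st_free (Dis \<phi> \<psi>) = (st_free \<phi> \<and> st_free \<psi>)"
  by (simp add: Dis_def)

lemma (in st_structure) sat_Dis [simp]: "sat M (Dis \<phi> \<psi>) \<rho> \<longleftrightarrow> sat M \<phi> \<rho> \<or> sat M \<psi> \<rho>"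
  by (simp add: Dis_def)

context HST
begin

lemma set_ext: "(\<And>z. z \<epsilon> x \<longleftrightarrow> z \<epsilon> y) \<Longrightarrow> x = y"
  using extensionality unfolding extensionality_ax_def by blast

lemma ex_internal: "\<exists>x. x \<in> internal"
  using ZFC_standard unfolding ZFC_in_def infinity_ax_def inductive_in_def internal_def standard_def
  by blast

lemma internal_nonempty: "internal \<noteq> {}"
  using ex_internal by blast

lemma standard_nonempty: "standard \<noteq> {}"
  using standardization by blast

lemma cls_False [simp]: "cls False = UNIV" and cls_True [simp]: "cls True = internal"
  by (simp_all add: cls_def)

lemma cls_nonempty: "cls i \<noteq> {}"
  using internal_nonempty by (cases i) auto

lemma cls_transitive: "x \<in> cls i \<Longrightarrow> y \<epsilon> x \<Longrightarrow> y \<in> cls i"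
  using internal_transitive by (cases i) auto

subsection \<open>Definable terms\<close>

definition trm :: "bool \<Rightarrow> ((nat \<Rightarrow> 'u) \<Rightarrow> 'u) \<Rightarrow> bool" where
  "trm i t \<longleftrightarrow> (\<forall>\<rho>. range \<rho> \<subseteq> cls i \<longrightarrow> t \<rho> \<in> cls i) \<and>
     dfn i (\<lambda>\<rho>. \<rho> 0 = t (\<lambda>n. \<rho> (Suc n)))"

lemma trm_closed: "trm i t \<Longrightarrow> range \<rho> \<subseteq> cls i \<Longrightarrow> t \<rho> \<in> cls i"
  by (simp add: trm_def)

lemma dfn_var_eq: "dfn i (\<lambda>\<rho>. \<rho> j = \<rho> k)"
  by (rule dfn0_dfn[OF dfn0.basic_eq]) simp_all

lemma dfn_var_mem: "dfn i (\<lambda>\<rho>. \<rho> j \<epsilon> \<rho> k)"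
  by (rule dfn0_dfn[OF dfn0.basic_mem]) simp_all

lemma trm_var: "trm i (\<lambda>\<rho>. \<rho> k)"
  unfolding trm_def by (auto intro: dfn_var_eq)

lemma trm_const: "c \<in> cls i \<Longrightarrow> trm i (\<lambda>\<rho>. c)"
  unfolding trm_def by (auto intro!: dfn0_dfn[OF dfn0.basic_eq])

lemma dfn_shift: "dfn i P \<Longrightarrow> dfn i (\<lambda>\<rho>. P (\<lambda>n. \<rho> (f n)))"
  by (rule dfn_subst) simp_all

lemma trm_shift:
  assumes "trm i t"
  shows "trm i (\<lambda>\<rho>. t (\<lambda>n. \<rho> (f n)))"
proof -
  have "range (\<lambda>n. \<rho> (f n)) \<subseteq> cls i" if "range \<rho> \<subseteq> cls i" for \<rho> :: "nat \<Rightarrow> 'u"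
    using that by auto
  moreover have "dfn i (\<lambda>\<rho>. \<rho> 0 = t (\<lambda>n. \<rho> (Suc (f n))))"
    using dfn_shift[of i "\<lambda>\<rho>. \<rho> 0 = t (\<lambda>n. \<rho> (Suc n))" "case_nat 0 (\<lambda>n. Suc (f n))"] assms
    unfolding trm_def by simp
  ultimately show ?thesis
    using assms unfolding trm_def by simp
qed

text \<open>Substituting a term means quantifying over its value, which lies in \<open>cls i\<close>
  because terms are closed.\<close>

lemma dfn_let:
  assumes "dfn i (\<lambda>\<rho>. Q (\<rho> 0) (\<lambda>n. \<rho> (Suc n)))" "trm i t"
  shows "dfn i (\<lambda>\<rho>. Q (t \<rho>) \<rho>)"
proof -
  have "dfn i (\<lambda>\<rho>. \<exists>x\<in>cls i. x = t \<rho> \<and> Q x \<rho>)"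
    by (rule dfn_Bex_cls, rule dfn_conj) (use assms trm_def in auto)
  then show ?thesis
    by (rule dfn_equiv) (use trm_closed[OF assms(2)] in auto)
qed

lemma dfn1:
  assumes "dfn i (\<lambda>\<rho>. R (\<rho> 0))" "trm i s"
  shows "dfn i (\<lambda>\<rho>. R (s \<rho>))"
  by (rule dfn_let[where Q = "\<lambda>x \<rho>. R x"]) fact+

lemma dfn2:
  assumes "dfn i (\<lambda>\<rho>. R (\<rho> 0) (\<rho> (Suc 0)))" "trm i s" "trm i t"
  shows "dfn i (\<lambda>\<rho>. R (s \<rho>) (t \<rho>))"
proof (rule dfn_let[where Q = "\<lambda>x \<rho>. R x (t \<rho>)"])
  show "dfn i (\<lambda>\<rho>. R (\<rho> 0) (t (\<lambda>n. \<rho> (Suc n))))"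
  proof (rule dfn_let[where Q = "\<lambda>y \<rho>. R (\<rho> 0) y"])
    show "dfn i (\<lambda>\<rho>. R (\<rho> (Suc 0)) (\<rho> 0))"
      using dfn_shift[OF assms(1), of "\<lambda>n. case n of 0 \<Rightarrow> Suc 0 | Suc _ \<Rightarrow> 0"] by simp
    show "trm i (\<lambda>\<rho>. t (\<lambda>n. \<rho> (Suc n)))" by (rule trm_shift) fact
  qed
qed fact

lemma dfn3:
  assumes "dfn i (\<lambda>\<rho>. R (\<rho> 0) (\<rho> (Suc 0)) (\<rho> (Suc (Suc 0))))" "trm i s" "trm i t" "trm i u"
  shows "dfn i (\<lambda>\<rho>. R (s \<rho>) (t \<rho>) (u \<rho>))"
proof (rule dfn_let[where Q = "\<lambda>x \<rho>. R x (t \<rho>) (u \<rho>)"])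
  show "dfn i (\<lambda>\<rho>. R (\<rho> 0) (t (\<lambda>n. \<rho> (Suc n))) (u (\<lambda>n. \<rho> (Suc n))))"
  proof (rule dfn_let[where Q = "\<lambda>y \<rho>. R (\<rho> 0) y (u (\<lambda>n. \<rho> (Suc n)))"])
    show "dfn i (\<lambda>\<rho>. R (\<rho> (Suc 0)) (\<rho> 0) (u (\<lambda>n. \<rho> (Suc (Suc n)))))"
    proof (rule dfn_let[where Q = "\<lambda>z \<rho>. R (\<rho> (Suc 0)) (\<rho> 0) z"])
      show "dfn i (\<lambda>\<rho>. R (\<rho> (Suc (Suc 0))) (\<rho> (Suc 0)) (\<rho> 0))"
        using dfn_shift[OF assms(1), of "\<lambda>n. Suc (Suc 0) - n"] by (simp add: numeral_eq_Suc)
      show "trm i (\<lambda>\<rho>. u (\<lambda>n. \<rho> (Suc (Suc n))))" by (rule trm_shift) fact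
    qed
    show "trm i (\<lambda>\<rho>. t (\<lambda>n. \<rho> (Suc n)))" by (rule trm_shift) fact
  qed
qed fact

lemma trm1:
  assumes "trm i (\<lambda>\<rho>. f (\<rho> 0))" "trm i s"
  shows "trm i (\<lambda>\<rho>. f (s \<rho>))"
  unfolding trm_def
proof (intro conjI allI impI)
  fix \<rho> :: "nat \<Rightarrow> 'u" assume \<rho>: "range \<rho> \<subseteq> cls i"
  have "s \<rho> \<in> cls i" using trm_closed[OF assms(2) \<rho>] .
  then show "f (s \<rho>) \<in> cls i" using trm_closed[OF assms(1), of "\<lambda>_. s \<rho>"] by auto
next
  have "dfn i (\<lambda>\<rho>. \<rho> 0 = f (\<rho> (Suc 0)))" using assms(1) unfolding trm_def by simp
  then show "dfn i (\<lambda>\<rho>. \<rho> 0 = f (s (\<lambda>n. \<rho> (Suc n))))"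
    by (rule dfn2[where R = "\<lambda>x y. x = f y"]) (rule trm_var, rule trm_shift, fact)
qed

lemma trm2:
  assumes "trm i (\<lambda>\<rho>. f (\<rho> 0) (\<rho> (Suc 0)))" "trm i s" "trm i t"
  shows "trm i (\<lambda>\<rho>. f (s \<rho>) (t \<rho>))"
  unfolding trm_def
proof (intro conjI allI impI)
  fix \<rho> :: "nat \<Rightarrow> 'u" assume \<rho>: "range \<rho> \<subseteq> cls i"
  have "s \<rho> \<in> cls i" "t \<rho> \<in> cls i"
    using trm_closed[OF assms(2) \<rho>] trm_closed[OF assms(3) \<rho>] by auto
  then show "f (s \<rho>) (t \<rho>) \<in> cls i"
    using trm_closed[OF assms(1) range_case_nat[OF _ range_case_nat], of "s \<rho>" "t \<rho>" \<rho>] \<rho> by simp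
next
  have "dfn i (\<lambda>\<rho>. \<rho> 0 = f (\<rho> (Suc 0)) (\<rho> (Suc (Suc 0))))"
    using assms(1) unfolding trm_def by simp
  then show "dfn i (\<lambda>\<rho>. \<rho> 0 = f (s (\<lambda>n. \<rho> (Suc n))) (t (\<lambda>n. \<rho> (Suc n))))"
    by (rule dfn3[where R = "\<lambda>x y z. x = f y z"])
      (rule trm_var, rule trm_shift, fact, rule trm_shift, fact)
qed

lemma trm1I:
  assumes "\<And>x. x \<in> cls i \<Longrightarrow> f x \<in> cls i"
    and "\<And>x y. x \<in> cls i \<Longrightarrow> y \<in> cls i \<Longrightarrow> y = f x \<longleftrightarrow> G y x"
    and "dfn i (\<lambda>\<rho>. G (\<rho> 0) (\<rho> (Suc 0)))"
  shows "trm i (\<lambda>\<rho>. f (\<rho> 0))"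
  unfolding trm_def
proof (intro conjI allI impI)
  show "f (\<rho> 0) \<in> cls i" if "range \<rho> \<subseteq> cls i" for \<rho>
    using that by (intro assms(1)) auto
  show "dfn i (\<lambda>\<rho>. \<rho> 0 = f (\<rho> (Suc 0)))"
    by (rule dfn_equiv[OF assms(3)], rule assms(2)) auto
qed

lemma trm2I:
  assumes "\<And>x y. x \<in> cls i \<Longrightarrow> y \<in> cls i \<Longrightarrow> f x y \<in> cls i"
    and "\<And>x y z. x \<in> cls i \<Longrightarrow> y \<in> cls i \<Longrightarrow> z \<in> cls i \<Longrightarrow> z = f x y \<longleftrightarrow> G z x y"
    and "dfn i (\<lambda>\<rho>. G (\<rho> 0) (\<rho> (Suc 0)) (\<rho> (Suc (Suc 0))))"
  shows "trm i (\<lambda>\<rho>. f (\<rho> 0) (\<rho> (Suc 0)))"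
  unfolding trm_def
proof (intro conjI allI impI)
  show "f (\<rho> 0) (\<rho> (Suc 0)) \<in> cls i" if "range \<rho> \<subseteq> cls i" for \<rho>
    using that by (intro assms(1)) auto
  show "dfn i (\<lambda>\<rho>. \<rho> 0 = f (\<rho> (Suc 0)) (\<rho> (Suc (Suc 0))))"
    by (rule dfn_equiv[OF assms(3)], rule assms(2)) auto
qed

named_theorems dfn_intros

lemma dfn_mem [dfn_intros]: "trm i s \<Longrightarrow> trm i t \<Longrightarrow> dfn i (\<lambda>\<rho>. s \<rho> \<epsilon> t \<rho>)"
  by (rule dfn2[where R = mem]) (rule dfn_var_mem)

lemma dfn_eq [dfn_intros]: "trm i s \<Longrightarrow> trm i t \<Longrightarrow> dfn i (\<lambda>\<rho>. s \<rho> = t \<rho>)"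
  by (rule dfn2[where R = "(=)"]) (rule dfn_var_eq)

lemma dfn_st [dfn_intros]: "trm False t \<Longrightarrow> dfn False (\<lambda>\<rho>. st (t \<rho>))"
  by (rule dfn1[where R = st], rule dfn0_dfn[OF dfn0.basic_st]) simp_all

lemma trm_const_False [dfn_intros]: "trm False (\<lambda>\<rho>. c)"
  by (rule trm_const) simp

declare trm_var [dfn_intros] trm_const [dfn_intros] dfn_neg [dfn_intros] dfn_conj [dfn_intros]

lemma dfn_closed [dfn_intros]: "dfn i (\<lambda>\<rho>. b)"
  by (rule dfn_const) (rule cls_nonempty)

lemma dfn_disj [dfn_intros]:
  assumes "dfn i P" "dfn i Q" shows "dfn i (\<lambda>\<rho>. P \<rho> \<or> Q \<rho>)"
  by (rule dfn_equiv[OF dfn_neg[OF dfn_conj[OF assms[THEN dfn_neg]]]]) simp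

lemma dfn_imp [dfn_intros]:
  assumes "dfn i P" "dfn i Q" shows "dfn i (\<lambda>\<rho>. P \<rho> \<longrightarrow> Q \<rho>)"
  by (rule dfn_equiv[OF dfn_disj[OF assms(1)[THEN dfn_neg] assms(2)]]) simp

lemma dfn_iff [dfn_intros]:
  assumes "dfn i P" "dfn i Q" shows "dfn i (\<lambda>\<rho>. P \<rho> \<longleftrightarrow> Q \<rho>)"
  by (rule dfn_equiv[OF dfn_conj[OF dfn_imp[OF assms] dfn_imp[OF assms(2,1)]]]) blast

lemma dfn_Ball_cls:
  assumes "dfn i (\<lambda>\<rho>. Q (\<rho> 0) (\<lambda>n. \<rho> (Suc n)))"
  shows "dfn i (\<lambda>\<rho>. \<forall>x\<in>cls i. Q x \<rho>)"
  by (rule dfn_equiv[OF dfn_neg[OF dfn_Bex_cls[OF dfn_neg[OF assms]]]]) simp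

lemma dfn_ex [dfn_intros]:
  "dfn False (\<lambda>\<rho>. Q (\<rho> 0) (\<lambda>n. \<rho> (Suc n))) \<Longrightarrow> dfn False (\<lambda>\<rho>. \<exists>x. Q x \<rho>)"
  using dfn_Bex_cls[of False Q] by simp

lemma dfn_all [dfn_intros]:
  "dfn False (\<lambda>\<rho>. Q (\<rho> 0) (\<lambda>n. \<rho> (Suc n))) \<Longrightarrow> dfn False (\<lambda>\<rho>. \<forall>x. Q x \<rho>)"
  using dfn_Ball_cls[of False Q] by simp

text \<open>The definition of internality mentions \<open>st\<close>, but over internal assignments
  the statement is constantly true and hence harmless in the st-free language.\<close>

lemma dfn_internal [dfn_intros]: "trm i t \<Longrightarrow> dfn i (\<lambda>\<rho>. t \<rho> \<in> internal)"
proof (cases i)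
  case True
  then show "trm i t \<Longrightarrow> dfn i (\<lambda>\<rho>. t \<rho> \<in> internal)"
    using trm_closed[of i t] by (intro dfn_equiv[OF dfn_closed[of i True]]) auto
next
  case False
  have "dfn False (\<lambda>\<rho>. \<rho> 0 \<in> internal)"
    unfolding internal_def mem_Collect_eq by (intro dfn_intros)
  then show "trm i t \<Longrightarrow> dfn i (\<lambda>\<rho>. t \<rho> \<in> internal)"
    using False dfn1[of False "\<lambda>x. x \<in> internal"] by simp
qed

text \<open>Since \<open>cls i\<close> is transitive, a bounded quantifier means the same inside the
  class and in the universe. This absoluteness lets one set of rules serve both languages, and it is
  why later definitions bound their quantifiers.\<close>

lemma dfn_bex [dfn_intros]:
  assumes "trm i t" "dfn i (\<lambda>\<rho>. Q (\<rho> 0) (\<lambda>n. \<rho> (Suc n)))"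
  shows "dfn i (\<lambda>\<rho>. \<exists>x. x \<epsilon> t \<rho> \<and> Q x \<rho>)"
proof -
  have "dfn i (\<lambda>\<rho>. \<exists>x\<in>cls i. x \<epsilon> t \<rho> \<and> Q x \<rho>)"
    by (intro dfn_Bex_cls dfn_conj dfn_mem trm_var assms) (rule trm_shift, fact)
  then show ?thesis
    by (rule dfn_equiv) (use cls_transitive trm_closed[OF assms(1)] in blast)
qed

lemma dfn_ball [dfn_intros]:
  assumes "trm i t" "dfn i (\<lambda>\<rho>. Q (\<rho> 0) (\<lambda>n. \<rho> (Suc n)))"
  shows "dfn i (\<lambda>\<rho>. \<forall>x. x \<epsilon> t \<rho> \<longrightarrow> Q x \<rho>)"
  by (rule dfn_equiv[OF dfn_neg[OF dfn_bex[OF assms(1) dfn_neg[OF assms(2)]]]]) blast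

lemma dfn_subset [dfn_intros]: "trm i s \<Longrightarrow> trm i t \<Longrightarrow> dfn i (\<lambda>\<rho>. subset (s \<rho>) (t \<rho>))"
  by (rule dfn2[where R = subset]) (unfold subset_def, intro dfn_intros)

lemma dfn_nonempty [dfn_intros]: "trm i t \<Longrightarrow> dfn i (\<lambda>\<rho>. nonempty (t \<rho>))"
proof (rule dfn1[where R = nonempty])
  have "dfn i (\<lambda>\<rho>. \<exists>z. z \<epsilon> \<rho> 0 \<and> True)" by (intro dfn_intros)
  then show "dfn i (\<lambda>\<rho>. nonempty (\<rho> 0))" unfolding nonempty_def by simp
qed

lemma dfn_transitive [dfn_intros]: "trm i t \<Longrightarrow> dfn i (\<lambda>\<rho>. transitive (t \<rho>))"
  by (rule dfn1[where R = transitive]) (unfold transitive_def, intro dfn_intros)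

subsection \<open>Transfer of the axioms of ZFC\<close>

text \<open>Instances of an axiom scheme over the internal sets have internal parameters, beyond the
  reach of \<open>transfer\<close>. Quantifying the parameters away first, with
  \<open>closure\<close>, brings them within reach.\<close>

lemma valid_transfer:
  assumes "st_free \<phi>" "\<And>\<sigma>. range \<sigma> \<subseteq> standard \<Longrightarrow> sat standard \<phi> \<sigma>" "range \<rho> \<subseteq> internal"
  shows "sat internal \<phi> \<rho>"
proof -
  obtain s where "s \<in> standard" using standard_nonempty by blast
  then have s: "range (\<lambda>n::nat. s) \<subseteq> standard" by auto
  \<comment> \<open>Pairing in the standard universe puts a standard \<open>x\<close> into a
    standard set, which is what being internal means.\<close>
  have "standard \<subseteq> internal"
  proof
    fix x assume "x \<in> standard"
    moreover have "pairing_ax standard" using ZFC_standard unfolding ZFC_in_def by (elim conjE)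
    ultimately obtain p where "p \<in> standard" "\<forall>z\<in>standard. z \<epsilon> p \<longleftrightarrow> z = x \<or> z = x"
      unfolding pairing_ax_def by blast
    then show "x \<in> internal"
      using \<open>x \<in> standard\<close> by (auto simp: internal_def standard_def)
  qed
  then have s': "range (\<lambda>n::nat. s) \<subseteq> internal" using s by blast
  have "sat standard (closure (var_bound \<phi>) \<phi>) (\<lambda>_. s)"
    using sat_closure_valid[OF standard_nonempty s] assms(2) by simp
  then have "sat internal (closure (var_bound \<phi>) \<phi>) (\<lambda>_. s)"
    using transfer[OF _ s] assms(1) by simp
  then show ?thesis
    using sat_closure_valid[OF internal_nonempty s'] assms(3) by simp
qed

lemma internal_axiom:
  assumes "st_free \<phi>" "\<And>\<sigma>. sat standard \<phi> \<sigma>"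
  shows "\<exists>\<rho>. sat internal \<phi> \<rho>"
proof -
  obtain x where "x \<in> internal" using ex_internal by blast
  then have "range (\<lambda>n::nat. x) \<subseteq> internal" by auto
  then show ?thesis using valid_transfer[OF assms] by blast
qed

lemma internal_pairing: "pairing_ax internal"
  using internal_axiom[of "All 0 (All 1 (Exi 2 (All 3 (Iff (Mem 3 2) (Dis (Equ 3 0) (Equ 3 1))))))"]
    ZFC_standard
  by (simp add: pairing_ax_def ZFC_in_def)

lemma internal_union: "union_ax internal"
  using internal_axiom[of "All 0 (Exi 1 (All 2 (Iff (Mem 2 1) (Exi 3 (Conj (Mem 3 0) (Mem 2 3))))))"]
    ZFC_standard
  by (simp add: union_ax_def ZFC_in_def)

lemma internal_powerset: "powerset_ax internal"
  using internal_axiom[of "All 0 (Exi 1 (All 2 (Iff (Mem 2 1) (All 3 (Imp (Mem 3 2) (Mem 3 0))))))"]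
    ZFC_standard
  by (simp add: powerset_ax_def ZFC_in_def)

lemma internal_infinity: "infinity_ax internal"
  using internal_axiom[of "Exi 0 (Conj (Exi 1 (Conj (Mem 1 0) (All 2 (Neg (Mem 2 1)))))
      (All 1 (Imp (Mem 1 0) (Exi 2 (Conj (Mem 2 0)
        (All 3 (Iff (Mem 3 2) (Dis (Mem 3 1) (Equ 3 1)))))))))"]
    ZFC_standard
  by (simp add: infinity_ax_def inductive_in_def ZFC_in_def)

text \<open>The uniqueness quantifier has to be resolved into relativised quantifiers before the
  axiom matches a formula.\<close>

lemma choice_ax_alt: "choice_ax M \<longleftrightarrow> (\<forall>x\<in>M.
     (\<forall>y\<in>M. y \<epsilon> x \<longrightarrow> (\<exists>z\<in>M. z \<epsilon> y)) \<and>
     (\<forall>y\<in>M. \<forall>y'\<in>M. y \<epsilon> x \<and> y' \<epsilon> x \<and> (\<exists>z\<in>M. z \<epsilon> y \<and> z \<epsilon> y') \<longrightarrow> y = y') \<longrightarrow>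
     (\<exists>c\<in>M. \<forall>y\<in>M. y \<epsilon> x \<longrightarrow>
       (\<exists>z\<in>M. (z \<epsilon> y \<and> z \<epsilon> c) \<and> (\<forall>z'\<in>M. z' \<epsilon> y \<and> z' \<epsilon> c \<longrightarrow> z' = z))))"
proof -
  have "(\<exists>!z. z \<in> M \<and> z \<epsilon> y \<and> z \<epsilon> c) \<longleftrightarrow>
    (\<exists>z\<in>M. (z \<epsilon> y \<and> z \<epsilon> c) \<and> (\<forall>z'\<in>M. z' \<epsilon> y \<and> z' \<epsilon> c \<longrightarrow> z' = z))" for y c
    by auto
  then show ?thesis unfolding choice_ax_def by simp
qed

lemma internal_choice: "choice_ax internal"
  using internal_axiom[of "All 0 (Imp (Conj (All 1 (Imp (Mem 1 0) (Exi 2 (Mem 2 1))))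
      (All 1 (All 2 (Imp (Conj (Mem 1 0) (Conj (Mem 2 0) (Exi 3 (Conj (Mem 3 1) (Mem 3 2)))))
        (Equ 1 2)))))
      (Exi 3 (All 1 (Imp (Mem 1 0) (Exi 2 (Conj (Conj (Mem 2 1) (Mem 2 3))
        (All 4 (Imp (Conj (Mem 4 1) (Mem 4 3)) (Equ 4 2)))))))))"]
    ZFC_standard
  by (simp add: choice_ax_alt ZFC_in_def)

lemma internal_separation: "separation_ax internal {\<phi>. st_free \<phi>}"
  unfolding separation_ax_def
proof (intro ballI allI impI)
  fix \<phi> and \<rho> :: "nat \<Rightarrow> 'u" and x
  assume \<phi>: "\<phi> \<in> {\<phi>. st_free \<phi>}" and \<rho>: "range \<rho> \<subseteq> internal" and x: "x \<in> internal"
  \<comment> \<open>\<open>N\<close> and \<open>Suc N\<close> do not occur in \<open>\<phi>\<close>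
    and differ from 0; they name the given set and the subset to be found.\<close>
  define N where "N = Suc (var_bound \<phi>)"
  define \<psi> where "\<psi> = Exi (Suc N) (All 0 (Iff (Mem 0 (Suc N)) (Conj (Mem 0 N) \<phi>)))"
  have "sat M \<phi> (\<sigma>(Suc N := y, 0 := z)) = sat M \<phi> (\<sigma>(0 := z))"
    "sat M \<phi> (\<sigma>(N := y, 0 := z)) = sat M \<phi> (\<sigma>(0 := z))" for M \<sigma> y z
    by (rule sat_agree, simp add: N_def)+
  note agree = this
  have sat_psi: "sat M \<psi> \<sigma> \<longleftrightarrow>
    (\<exists>y\<in>M. \<forall>z\<in>M. z \<epsilon> y \<longleftrightarrow> z \<epsilon> \<sigma> N \<and> sat M \<phi> (\<sigma>(0 := z)))" for M \<sigma>
    unfolding \<psi>_def by (simp add: agree N_def[symmetric]) (simp add: N_def)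
  have "sat standard \<psi> \<sigma>" if "range \<sigma> \<subseteq> standard" for \<sigma>
  proof -
    have "\<sigma> N \<in> standard" using that by auto
    then show ?thesis
      unfolding sat_psi using ZFC_standard \<phi> that unfolding ZFC_in_def separation_ax_def by blast
  qed
  moreover have "st_free \<psi>" using \<phi> by (simp add: \<psi>_def)
  moreover have "range (\<rho>(N := x)) \<subseteq> internal" using \<rho> x by auto
  ultimately have "sat internal \<psi> (\<rho>(N := x))" by (intro valid_transfer)
  then show "\<exists>y\<in>internal. \<forall>z\<in>internal. z \<epsilon> y \<longleftrightarrow> z \<epsilon> x \<and> sat internal \<phi> (\<rho>(0 := z))"
    unfolding sat_psi agree by simp
qed

lemma separation_cls:
  assumes "dfn i (\<lambda>\<rho>. P (\<rho> 0))" "x \<in> cls i"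
  shows "\<exists>y\<in>cls i. \<forall>z. z \<epsilon> y \<longleftrightarrow> z \<epsilon> x \<and> P z"
proof -
  obtain \<phi> \<pi> where \<phi>: "i \<longrightarrow> st_free \<phi>" "range \<pi> \<subseteq> cls i"
    "\<And>\<rho>. range \<rho> \<subseteq> cls i \<Longrightarrow> P (\<rho> 0) = sat (cls i) \<phi> (merge \<rho> \<pi>)"
    using dfn_formula[OF assms(1) cls_nonempty] by metis
  have ax: "separation_ax (cls i) {\<phi>. i \<longrightarrow> st_free \<phi>}"
    using internal_separation separation by (cases i) simp_all
  have "range (merge (\<lambda>_. x) \<pi>) \<subseteq> cls i"
    using \<phi>(2) assms(2) by (intro range_merge) auto
  then obtain y where y: "y \<in> cls i"
    "\<forall>z\<in>cls i. z \<epsilon> y \<longleftrightarrow> z \<epsilon> x \<and> sat (cls i) \<phi> ((merge (\<lambda>_. x) \<pi>)(0 := z))"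
    using ax \<phi>(1) assms(2) unfolding separation_ax_def by blast
  have "(merge (\<lambda>_. x) \<pi>)(0 := z) = merge ((\<lambda>_. x)(0 := z)) \<pi>" for z
    by (auto simp: fun_eq_iff merge_def elim: evenE)
  then have "sat (cls i) \<phi> ((merge (\<lambda>_. x) \<pi>)(0 := z)) = P z" if "z \<in> cls i" for z
    using \<phi>(3)[of "(\<lambda>_. x)(0 := z)"] that assms(2) by (auto simp: image_subset_iff)
  then have "z \<epsilon> y \<longleftrightarrow> z \<epsilon> x \<and> P z" for z
    using y cls_transitive[OF y(1), of z] cls_transitive[OF assms(2), of z] by blast
  then show ?thesis using y(1) by blast
qed

lemma dfn_collection:
  assumes "dfn False (\<lambda>\<rho>. Q (\<rho> 0) (\<rho> (Suc 0)))"
  shows "\<exists>y. \<forall>u. u \<epsilon> x \<longrightarrow> (\<exists>v. Q u v) \<longrightarrow> (\<exists>v. v \<epsilon> y \<and> Q u v)"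
proof -
  obtain \<phi> \<pi> where
    "\<And>\<rho>. range \<rho> \<subseteq> cls False \<Longrightarrow> Q (\<rho> 0) (\<rho> (Suc 0)) = sat (cls False) \<phi> (merge \<rho> \<pi>)"
    by (rule dfn_formula[OF assms cls_nonempty]) (erule that)
  then have \<phi>: "\<And>\<rho>. Q (\<rho> 0) (\<rho> (Suc 0)) = sat UNIV \<phi> (merge \<rho> \<pi>)" by simp
  \<comment> \<open>The axiom speaks of variables 0 and 1, whereas \<open>merge\<close> keeps the
    first two variables at positions 0 and 2. Hence positions 1 and 2 are exchanged.\<close>
  define f :: "nat \<Rightarrow> nat" where "f n = (if n = 1 then 2 else if n = 2 then 1 else n)" for n
  have f: "inj f" by (rule injI) (unfold f_def, presburger)
  define \<rho> where "\<rho> = (\<lambda>n. merge (\<lambda>_. x) \<pi> (f n))"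
  define \<sigma> where "\<sigma> u v n = (if n = 0 then u else if n = 1 then v else x)" for u v :: 'u and n :: nat
  have "((\<rho>(0 := u, 1 := v)) \<circ> f) n = merge (\<sigma> u v) \<pi> n" for u v n
  proof -
    consider "n = 0" | "n = 1" | "n = 2" | "n > 2" by linarith
    then show ?thesis
    proof cases
      case 4
      moreover from 4 have "n div 2 \<noteq> 0" by simp
      moreover have "n div 2 \<noteq> 1" if "even n" using that 4 by auto
      ultimately show ?thesis by (auto simp: f_def \<rho>_def \<sigma>_def merge_def)
    qed (simp_all add: f_def \<rho>_def \<sigma>_def merge_def)
  qed
  then have "sat UNIV (ren f \<phi>) (\<rho>(0 := u, 1 := v)) = sat UNIV \<phi> (merge (\<sigma> u v) \<pi>)" for u v
    unfolding sat_ren[OF f] by (intro arg_cong[where f = "sat UNIV \<phi>"]) (simp add: fun_eq_iff)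
  then have *: "sat UNIV (ren f \<phi>) (\<rho>(0 := u, 1 := v)) = Q u v" for u v
    using \<phi>[of "\<sigma> u v"] by (simp add: \<sigma>_def)
  have "\<exists>y. \<forall>u. u \<epsilon> x \<longrightarrow> (\<exists>v. sat UNIV (ren f \<phi>) (\<rho>(0 := u, 1 := v))) \<longrightarrow>
       (\<exists>v. v \<epsilon> y \<and> sat UNIV (ren f \<phi>) (\<rho>(0 := u, 1 := v)))"
    using collection unfolding collection_ax_def by simp
  then show ?thesis unfolding * .
qed

subsection \<open>Elementary set operations\<close>

definition upair :: "'u \<Rightarrow> 'u \<Rightarrow> 'u" where
  "upair x y = (THE p. \<forall>z. z \<epsilon> p \<longleftrightarrow> z = x \<or> z = y)"

definition opair :: "'u \<Rightarrow> 'u \<Rightarrow> 'u" where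
  "opair x y = upair (upair x x) (upair x y)"

definition bigU :: "'u \<Rightarrow> 'u" where
  "bigU x = (THE u. \<forall>z. z \<epsilon> u \<longleftrightarrow> (\<exists>y. y \<epsilon> x \<and> z \<epsilon> y))"

definition ins :: "'u \<Rightarrow> 'u \<Rightarrow> 'u" where
  "ins a x = bigU (upair (upair a a) x)"

text \<open>A definite description makes separation an operation that can occur inside terms. It has
  the intended value once \<open>P\<close> is known to be definable.\<close>

definition sep :: "'u \<Rightarrow> ('u \<Rightarrow> bool) \<Rightarrow> 'u" where
  "sep x P = (THE y. \<forall>z. z \<epsilon> y \<longleftrightarrow> z \<epsilon> x \<and> P z)"

lemma the_set:
  assumes "\<forall>z. z \<epsilon> y \<longleftrightarrow> P z"
  shows "(THE y. \<forall>z. z \<epsilon> y \<longleftrightarrow> P z) = y"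
  using assms by (intro the_equality set_ext) auto

lemma mem_the_set:
  assumes "\<exists>y. \<forall>z. z \<epsilon> y \<longleftrightarrow> P z"
  shows "z \<epsilon> (THE y. \<forall>z. z \<epsilon> y \<longleftrightarrow> P z) \<longleftrightarrow> P z"
proof -
  obtain y where y: "\<forall>z. z \<epsilon> y \<longleftrightarrow> P z" using assms by (elim exE)
  show ?thesis unfolding the_set[OF y] using y by simp
qed

lemma mem_upair [simp]: "z \<epsilon> upair x y \<longleftrightarrow> z = x \<or> z = y"
  unfolding upair_def
  by (rule mem_the_set) (use pairing[unfolded pairing_ax_def, rule_format, of x y] in simp)

lemma upair_cls: "x \<in> cls i \<Longrightarrow> y \<in> cls i \<Longrightarrow> upair x y \<in> cls i"
proof -
  assume xy: "x \<in> cls i" "y \<in> cls i"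
  have "pairing_ax (cls i)" using pairing internal_pairing by (cases i) auto
  then obtain p where p: "p \<in> cls i" "\<forall>z\<in>cls i. z \<epsilon> p \<longleftrightarrow> z = x \<or> z = y"
    using xy unfolding pairing_ax_def by blast
  then have "p = upair x y"
    using xy cls_transitive[OF p(1)] by (intro set_ext) auto
  then show ?thesis using p by simp
qed

lemma trm_upair [dfn_intros]: "trm i s \<Longrightarrow> trm i t \<Longrightarrow> trm i (\<lambda>\<rho>. upair (s \<rho>) (t \<rho>))"
proof (rule trm2[where f = upair], rule trm2I[where G =
    "\<lambda>p x y. x \<epsilon> p \<and> y \<epsilon> p \<and> (\<forall>z. z \<epsilon> p \<longrightarrow> z = x \<or> z = y)"])
  fix x y z
  show "z = upair x y \<longleftrightarrow> x \<epsilon> z \<and> y \<epsilon> z \<and> (\<forall>w. w \<epsilon> z \<longrightarrow> w = x \<or> w = y)"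
    by (auto intro!: set_ext)
next
  show "dfn i (\<lambda>\<rho>. \<rho> (Suc 0) \<epsilon> \<rho> 0 \<and> \<rho> (Suc (Suc 0)) \<epsilon> \<rho> 0 \<and>
     (\<forall>z. z \<epsilon> \<rho> 0 \<longrightarrow> z = \<rho> (Suc 0) \<or> z = \<rho> (Suc (Suc 0))))"
    by (intro dfn_intros)
qed (auto intro: upair_cls)

lemma upair_eq_iff: "upair a b = upair c d \<longleftrightarrow> a = c \<and> b = d \<or> a = d \<and> b = c"
proof
  assume "upair a b = upair c d"
  then have "z = a \<or> z = b \<longleftrightarrow> z = c \<or> z = d" for z
    using mem_upair[of z a b] by simp
  then show "a = c \<and> b = d \<or> a = d \<and> b = c" by metis
next
  assume "a = c \<and> b = d \<or> a = d \<and> b = c"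
  then show "upair a b = upair c d" by (auto intro: set_ext)
qed

lemma opair_inject [simp]: "opair a b = opair c d \<longleftrightarrow> a = c \<and> b = d"
  unfolding opair_def upair_eq_iff by auto

lemma opair_cls: "x \<in> cls i \<Longrightarrow> y \<in> cls i \<Longrightarrow> opair x y \<in> cls i"
  unfolding opair_def by (intro upair_cls)

lemma trm_opair [dfn_intros]: "trm i s \<Longrightarrow> trm i t \<Longrightarrow> trm i (\<lambda>\<rho>. opair (s \<rho>) (t \<rho>))"
  unfolding opair_def by (intro dfn_intros)

lemma is_upair_iff: "is_upair p x y \<longleftrightarrow> p = upair x y"
  unfolding is_upair_def by (auto intro: set_ext)

lemma is_opair_iff [simp]: "is_opair p x y \<longleftrightarrow> p = opair x y"
  unfolding is_opair_def is_upair_iff opair_def by (auto intro: set_ext)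

lemma related_iff [simp]: "related R x y \<longleftrightarrow> opair x y \<epsilon> R"
  unfolding related_def by simp

lemma mem_bigU [simp]: "z \<epsilon> bigU x \<longleftrightarrow> (\<exists>y. y \<epsilon> x \<and> z \<epsilon> y)"
  unfolding bigU_def
  by (rule mem_the_set) (use union[unfolded union_ax_def, rule_format, of x] in simp)

lemma bigU_cls: "x \<in> cls i \<Longrightarrow> bigU x \<in> cls i"
proof -
  assume x: "x \<in> cls i"
  have "union_ax (cls i)" using union internal_union by (cases i) auto
  then obtain p where p: "p \<in> cls i" "\<forall>z\<in>cls i. z \<epsilon> p \<longleftrightarrow> (\<exists>y\<in>cls i. y \<epsilon> x \<and> z \<epsilon> y)"
    using x unfolding union_ax_def by blast
  have "p = bigU x"
  proof (rule set_ext)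
    fix z
    show "z \<epsilon> p \<longleftrightarrow> z \<epsilon> bigU x"
      using p(2) cls_transitive[OF p(1), of z] cls_transitive[OF x] cls_transitive[of _ i z] by auto
  qed
  then show ?thesis using p by simp
qed

lemma trm_bigU [dfn_intros]: "trm i s \<Longrightarrow> trm i (\<lambda>\<rho>. bigU (s \<rho>))"
proof (rule trm1[where f = bigU], rule trm1I[where G =
    "\<lambda>u x. (\<forall>z. z \<epsilon> u \<longrightarrow> (\<exists>y. y \<epsilon> x \<and> z \<epsilon> y)) \<and> (\<forall>y. y \<epsilon> x \<longrightarrow> (\<forall>z. z \<epsilon> y \<longrightarrow> z \<epsilon> u))"])
  show "u = bigU x \<longleftrightarrow>
    (\<forall>z. z \<epsilon> u \<longrightarrow> (\<exists>y. y \<epsilon> x \<and> z \<epsilon> y)) \<and> (\<forall>y. y \<epsilon> x \<longrightarrow> (\<forall>z. z \<epsilon> y \<longrightarrow> z \<epsilon> u))" for u x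
    by (auto intro!: set_ext)
  show "dfn i (\<lambda>\<rho>. (\<forall>z. z \<epsilon> \<rho> 0 \<longrightarrow> (\<exists>y. y \<epsilon> \<rho> (Suc 0) \<and> z \<epsilon> y)) \<and>
      (\<forall>y. y \<epsilon> \<rho> (Suc 0) \<longrightarrow> (\<forall>z. z \<epsilon> y \<longrightarrow> z \<epsilon> \<rho> 0)))"
    by (intro dfn_intros)
qed (auto intro: bigU_cls)

lemma mem_ins [simp]: "z \<epsilon> ins a x \<longleftrightarrow> z = a \<or> z \<epsilon> x"
  unfolding ins_def by auto

lemma ins_cls: "a \<in> cls i \<Longrightarrow> x \<in> cls i \<Longrightarrow> ins a x \<in> cls i"
  unfolding ins_def by (intro bigU_cls upair_cls)

lemma trm_ins [dfn_intros]: "trm i s \<Longrightarrow> trm i t \<Longrightarrow> trm i (\<lambda>\<rho>. ins (s \<rho>) (t \<rho>))"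
  unfolding ins_def by (intro dfn_intros)

text \<open>Freezing the remaining variables as parameters leaves the one-place predicate that
  separation expects.\<close>

lemma dfn_fix:
  assumes "dfn i (\<lambda>\<rho>. P (\<rho> 0) (\<lambda>n. \<rho> (Suc n)))" "range \<rho> \<subseteq> cls i"
  shows "dfn i (\<lambda>\<sigma>. P (\<sigma> 0) \<rho>)"
proof -
  define s where "s = case_nat (\<lambda>\<sigma>. \<sigma> 0) (\<lambda>n (\<sigma> :: nat \<Rightarrow> 'u). \<rho> n)"
  have "basic i (s n)" for n
    using assms(2) by (cases n) (auto simp: s_def intro!: basic_const)
  then have "dfn i (\<lambda>\<sigma>. P (s 0 \<sigma>) (\<lambda>n. s (Suc n) \<sigma>))"
    by (rule dfn_subst[OF assms(1), where s = s])
  then show ?thesis by (simp add: s_def)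
qed

lemma sep_ex:
  assumes "dfn i (\<lambda>\<rho>. P (\<rho> 0))" "x \<in> cls i"
  shows "sep x P \<in> cls i \<and> (\<forall>z. z \<epsilon> sep x P \<longleftrightarrow> z \<epsilon> x \<and> P z)"
proof -
  obtain y where "y \<in> cls i" "\<forall>z. z \<epsilon> y \<longleftrightarrow> z \<epsilon> x \<and> P z"
    using separation_cls[OF assms] by blast
  moreover from this have "sep x P = y" unfolding sep_def by (intro the_set)
  ultimately show ?thesis by simp
qed

lemma mem_sep: "dfn False (\<lambda>\<rho>. P (\<rho> 0)) \<Longrightarrow> z \<epsilon> sep x P \<longleftrightarrow> z \<epsilon> x \<and> P z"
  using sep_ex[of False P x] by simp

lemma mem_sep_internal:
  "dfn True (\<lambda>\<rho>. P (\<rho> 0)) \<Longrightarrow> x \<in> internal \<Longrightarrow> z \<epsilon> sep x P \<longleftrightarrow> z \<epsilon> x \<and> P z"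
  using sep_ex[of True P x] by simp

lemma sep_internal:
  "dfn True (\<lambda>\<rho>. P (\<rho> 0)) \<Longrightarrow> x \<in> internal \<Longrightarrow> sep x P \<in> internal"
  using sep_ex[of True P x] by simp

lemma trm_sep [dfn_intros]:
  assumes t: "trm i t" and P: "dfn i (\<lambda>\<rho>. P (\<rho> 0) (\<lambda>n. \<rho> (Suc n)))"
  shows "trm i (\<lambda>\<rho>. sep (t \<rho>) (\<lambda>z. P z \<rho>))"
proof -
  have sep: "sep (t \<rho>) (\<lambda>z. P z \<rho>) \<in> cls i"
    "z \<epsilon> sep (t \<rho>) (\<lambda>z. P z \<rho>) \<longleftrightarrow> z \<epsilon> t \<rho> \<and> P z \<rho>" if "range \<rho> \<subseteq> cls i" for \<rho> z
    using sep_ex[OF dfn_fix[OF P that] trm_closed[OF t that]] by auto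
  have "dfn i (\<lambda>\<rho>. P (\<rho> 0) (\<lambda>n. \<rho> (Suc (Suc n))))"
    using dfn_shift[OF P, of "case_nat 0 (\<lambda>n. Suc (Suc n))"] by simp
  then have *: "dfn i (\<lambda>\<rho>. \<forall>z\<in>cls i. z \<epsilon> \<rho> 0 \<longleftrightarrow> z \<epsilon> t (\<lambda>n. \<rho> (Suc n)) \<and> P z (\<lambda>n. \<rho> (Suc n)))"
    by (intro dfn_Ball_cls dfn_iff dfn_mem dfn_conj trm_var) (rule trm_shift[OF t])
  show ?thesis
    unfolding trm_def
  proof (intro conjI allI impI sep)
    show "dfn i (\<lambda>\<rho>. \<rho> 0 = sep (t (\<lambda>n. \<rho> (Suc n))) (\<lambda>z. P z (\<lambda>n. \<rho> (Suc n))))"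
    proof (rule dfn_equiv[OF *])
      fix \<rho> :: "nat \<Rightarrow> 'u" assume \<rho>: "range \<rho> \<subseteq> cls i"
      then have \<rho>': "range (\<lambda>n. \<rho> (Suc n)) \<subseteq> cls i" and 0: "\<rho> 0 \<in> cls i" by auto
      show "\<rho> 0 = sep (t (\<lambda>n. \<rho> (Suc n))) (\<lambda>z. P z (\<lambda>n. \<rho> (Suc n))) \<longleftrightarrow>
        (\<forall>z\<in>cls i. z \<epsilon> \<rho> 0 \<longleftrightarrow> z \<epsilon> t (\<lambda>n. \<rho> (Suc n)) \<and> P z (\<lambda>n. \<rho> (Suc n)))" (is "_ = ?S \<longleftrightarrow> ?R")
      proof
        show "\<rho> 0 = ?S \<Longrightarrow> ?R" using sep(2)[OF \<rho>'] by simp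
        assume ?R
        then show "\<rho> 0 = ?S"
          using sep(2)[OF \<rho>'] cls_transitive[OF 0] cls_transitive[OF sep(1)[OF \<rho>']]
          by (intro set_ext) blast
      qed
    qed
  qed
qed

definition emp :: 'u where
  "emp = sep (SOME x. x \<in> internal) (\<lambda>_. False)"

lemma emp_internal: "emp \<in> internal" and mem_emp [simp]: "\<not> z \<epsilon> emp"
proof -
  have "(SOME x. x \<in> internal) \<in> internal" using ex_internal by (rule someI_ex)
  then show "emp \<in> internal" "\<not> z \<epsilon> emp"
    using sep_ex[of True "\<lambda>_. False"] unfolding emp_def by (auto intro: dfn_closed)
qed

definition img :: "'u \<Rightarrow> ('u \<Rightarrow> 'u) \<Rightarrow> 'u" where
  "img x f = (THE y. \<forall>z. z \<epsilon> y \<longleftrightarrow> (\<exists>u. u \<epsilon> x \<and> z = f u))"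

text \<open>Replacement, as collection followed by separation. It belongs to the full language and
  says nothing about internality of the image.\<close>

lemma mem_img:
  assumes "trm False (\<lambda>\<rho>. f (\<rho> 0))"
  shows "z \<epsilon> img x f \<longleftrightarrow> (\<exists>u. u \<epsilon> x \<and> z = f u)"
proof -
  have tf: "trm False s \<Longrightarrow> trm False (\<lambda>\<rho>. f (s \<rho>))" for s
    by (rule trm1[OF assms])
  have "dfn False (\<lambda>\<rho>. \<rho> (Suc 0) = f (\<rho> 0))"
    by (intro dfn_intros tf)
  then obtain y where y: "\<forall>u. u \<epsilon> x \<longrightarrow> (\<exists>v. v = f u) \<longrightarrow> (\<exists>v. v \<epsilon> y \<and> v = f u)"
    using dfn_collection[of "\<lambda>u v. v = f u" x] by blast
  have "dfn False (\<lambda>\<rho>. \<exists>u. u \<epsilon> x \<and> \<rho> 0 = f u)"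
    by (intro dfn_intros tf)
  then have "\<forall>z. z \<epsilon> sep y (\<lambda>z. \<exists>u. u \<epsilon> x \<and> z = f u) \<longleftrightarrow> (\<exists>u. u \<epsilon> x \<and> z = f u)"
    using y by (auto simp: mem_sep)
  then show ?thesis unfolding img_def by (intro mem_the_set exI)
qed

lemma trm_img [dfn_intros]:
  assumes t: "trm False t" and f: "trm False (\<lambda>\<rho>. f (\<rho> 0) (\<lambda>n. \<rho> (Suc n)))"
  shows "trm False (\<lambda>\<rho>. img (t \<rho>) (\<lambda>z. f z \<rho>))"
proof -
  have f': "trm False (\<lambda>\<sigma>. f (\<sigma> 0) \<rho>)" for \<rho>
  proof -
    have "dfn False (\<lambda>\<rho>. \<rho> (Suc 0) = f (\<rho> 0) (\<lambda>n. \<rho> (Suc (Suc n))))"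
      using dfn_shift[of False "\<lambda>\<rho>. \<rho> 0 = f (\<rho> (Suc 0)) (\<lambda>n. \<rho> (Suc (Suc n)))"
          "case_nat (Suc 0) (case_nat 0 (\<lambda>n. Suc (Suc n)))"] f unfolding trm_def by simp
    then have "dfn False (\<lambda>\<rho>. \<rho> 0 = f (\<rho> (Suc 0)) (\<lambda>n. \<rho> (Suc (Suc n))))"
      using f unfolding trm_def by simp
    then have "dfn False (\<lambda>\<sigma>. \<sigma> 0 = f (\<sigma> (Suc 0)) \<rho>)"
      using dfn_subst[of False "\<lambda>\<rho>. \<rho> 0 = f (\<rho> (Suc 0)) (\<lambda>n. \<rho> (Suc (Suc n)))"
          "case_nat (\<lambda>\<sigma>. \<sigma> 0) (case_nat (\<lambda>\<sigma>. \<sigma> (Suc 0)) (\<lambda>n \<sigma>. \<rho> n))"]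
      by (simp split: nat.split)
    then show ?thesis unfolding trm_def by simp
  qed
  have "trm False (\<lambda>\<rho>. f (\<rho> 0) (\<lambda>n. \<rho> (Suc (Suc (Suc n)))))"
    using trm_shift[OF f, of "case_nat 0 (\<lambda>n. Suc (Suc (Suc n)))"] by simp
  then have "dfn False (\<lambda>\<rho>. \<forall>z. z \<epsilon> \<rho> 0 \<longleftrightarrow> (\<exists>u. u \<epsilon> t (\<lambda>n. \<rho> (Suc n)) \<and> z = f u (\<lambda>n. \<rho> (Suc n))))"
    by (intro dfn_all dfn_iff dfn_mem dfn_bex dfn_eq trm_var trm_shift[OF t])
  moreover have "y = img (t \<rho>) (\<lambda>z. f z \<rho>) \<longleftrightarrow> (\<forall>z. z \<epsilon> y \<longleftrightarrow> (\<exists>u. u \<epsilon> t \<rho> \<and> z = f u \<rho>))" for y \<rho>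
    using mem_img[OF f'[of \<rho>]] by (auto intro!: set_ext)
  ultimately show ?thesis unfolding trm_def by simp
qed

definition prod :: "'u \<Rightarrow> 'u \<Rightarrow> 'u" where
  "prod X Y = bigU (img X (\<lambda>x. img Y (\<lambda>y. opair x y)))"

lemma mem_prod: "p \<epsilon> prod X Y \<longleftrightarrow> (\<exists>x y. x \<epsilon> X \<and> y \<epsilon> Y \<and> p = opair x y)"
proof -
  have 1: "trm False (\<lambda>\<rho>. opair x (\<rho> 0))" for x by (intro dfn_intros)
  have "trm False (\<lambda>\<rho>. img Y (\<lambda>y. opair (\<rho> 0) y))" by (intro dfn_intros)
  note 2 = mem_img[OF this]
  show ?thesis unfolding prod_def by (auto simp: 2 mem_img[OF 1])
qed

lemma opair_mem_prod [simp]: "opair x y \<epsilon> prod X Y \<longleftrightarrow> x \<epsilon> X \<and> y \<epsilon> Y"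
  by (auto simp: mem_prod)

subsection \<open>Internal sets\<close>

text \<open>The power set as the internal universe sees it. External subsets of \<open>x\<close> are
  left out; HST does not promise a set of them all.\<close>

definition ipow :: "'u \<Rightarrow> 'u" where
  "ipow x = (THE p. \<forall>y. y \<epsilon> p \<longleftrightarrow> y \<in> internal \<and> subset y x)"

lemma ipow_ex:
  assumes "x \<in> internal"
  shows "ipow x \<in> internal \<and> (\<forall>y. y \<epsilon> ipow x \<longleftrightarrow> y \<in> internal \<and> subset y x)"
proof -
  obtain p where p: "p \<in> internal" "\<forall>y\<in>internal. y \<epsilon> p \<longleftrightarrow> (\<forall>z\<in>internal. z \<epsilon> y \<longrightarrow> z \<epsilon> x)"
    using internal_powerset assms unfolding powerset_ax_def by blast
  then have "\<forall>y. y \<epsilon> p \<longleftrightarrow> y \<in> internal \<and> subset y x"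
    using internal_transitive unfolding subset_def by blast
  moreover from this have "ipow x = p" unfolding ipow_def by (intro the_set)
  ultimately show ?thesis using p by simp
qed

lemma ipow_internal: "x \<in> internal \<Longrightarrow> ipow x \<in> internal"
  and mem_ipow: "x \<in> internal \<Longrightarrow> y \<epsilon> ipow x \<longleftrightarrow> y \<in> internal \<and> subset y x"
  using ipow_ex by auto

text \<open>\<open>prod\<close> is built by replacement, so its internality needs a second
  construction: Kuratowski pairs lie in the double internal power set of the union, from which
  st-free separation cuts out the product.\<close>

lemma prod_internal:
  assumes "X \<in> internal" "Y \<in> internal"
  shows "prod X Y \<in> internal"
proof -
  define U where "U = ipow (ipow (bigU (upair X Y)))"
  have U0: "bigU (upair X Y) \<in> internal"
    using bigU_cls[of _ True] upair_cls[of _ True] assms by simp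
  then have U: "U \<in> internal" "ipow (bigU (upair X Y)) \<in> internal"
    unfolding U_def by (simp_all add: ipow_internal)
  have D: "dfn True (\<lambda>\<rho>. \<exists>x. x \<epsilon> X \<and> (\<exists>y. y \<epsilon> Y \<and> \<rho> 0 = opair x y))"
    by (intro dfn_intros) (simp_all add: assms)
  have "opair x y \<epsilon> U" if "x \<epsilon> X" "y \<epsilon> Y" for x y
  proof -
    have "x \<in> internal" "y \<in> internal" using that assms internal_transitive by auto
    then have "upair x x \<in> internal" "upair x y \<in> internal" "opair x y \<in> internal"
      using upair_cls[of _ True] opair_cls[of _ True] by simp_all
    then show ?thesis
      using that U U0 unfolding U_def by (auto simp: mem_ipow subset_def opair_def)
  qed
  then have "sep U (\<lambda>p. \<exists>x. x \<epsilon> X \<and> (\<exists>y. y \<epsilon> Y \<and> p = opair x y)) = prod X Y"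
    by (intro set_ext) (auto simp: mem_sep_internal[OF D U(1)] mem_prod)
  then show ?thesis using sep_internal[OF D U(1)] by simp
qed

subsection \<open>Well-founded sets\<close>

definition wft :: "'u \<Rightarrow> bool" where
  "wft t \<longleftrightarrow> transitive t \<and>
     (\<forall>y. subset y t \<and> nonempty y \<longrightarrow> (\<exists>m. m \<epsilon> y \<and> \<not> (\<exists>z. z \<epsilon> y \<and> z \<epsilon> m)))"

lemma wellfounded_iff: "x \<in> wellfounded \<longleftrightarrow> (\<exists>t. wft t \<and> x \<epsilon> t)"
  unfolding wellfounded_def wft_def by auto

lemma dfn_wft [dfn_intros]: "trm False t \<Longrightarrow> dfn False (\<lambda>\<rho>. wft (t \<rho>))"
  by (rule dfn1[where R = wft]) (unfold wft_def, intro dfn_intros)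

lemma dfn_wellfounded [dfn_intros]: "trm False t \<Longrightarrow> dfn False (\<lambda>\<rho>. t \<rho> \<in> wellfounded)"
  by (rule dfn1[where R = "\<lambda>x. x \<in> wellfounded"]) (unfold wellfounded_iff, intro dfn_intros)

lemma wellfounded_transitive: "x \<in> wellfounded \<Longrightarrow> y \<epsilon> x \<Longrightarrow> y \<in> wellfounded"
  unfolding wellfounded_iff wft_def transitive_def subset_def by blast

lemma wft_minimal:
  assumes "wft t" "dfn False (\<lambda>\<rho>. P (\<rho> 0))" "x \<epsilon> t" "P x"
  shows "\<exists>m. m \<epsilon> t \<and> P m \<and> (\<forall>z. z \<epsilon> m \<longrightarrow> \<not> P z)"
proof -
  have "subset (sep t P) t" "nonempty (sep t P)"
    using assms(3,4) by (auto simp: subset_def nonempty_def mem_sep[OF assms(2)])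
  then obtain m where m: "m \<epsilon> sep t P" "\<not> (\<exists>z. z \<epsilon> sep t P \<and> z \<epsilon> m)"
    using assms(1) unfolding wft_def by blast
  then have "m \<epsilon> t" "P m" by (auto simp: mem_sep[OF assms(2)])
  moreover from this have "z \<epsilon> t" if "z \<epsilon> m" for z
    using assms(1) that unfolding wft_def transitive_def subset_def by blast
  ultimately show ?thesis using m(2) by (auto simp: mem_sep[OF assms(2)])
qed

lemma wellfounded_induct:
  assumes "x \<in> wellfounded" and "dfn False (\<lambda>\<rho>. P (\<rho> 0))"
    and step: "\<And>u. u \<in> wellfounded \<Longrightarrow> (\<And>w. w \<epsilon> u \<Longrightarrow> P w) \<Longrightarrow> P u"
  shows "P x"
proof (rule ccontr)
  assume "\<not> P x"
  obtain t where t: "wft t" "x \<epsilon> t" using assms(1) unfolding wellfounded_iff by blast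
  obtain m where "m \<epsilon> t" "\<not> P m" "\<forall>z. z \<epsilon> m \<longrightarrow> \<not> \<not> P z"
    using wft_minimal[OF t(1) dfn_neg[OF assms(2)] t(2) \<open>\<not> P x\<close>] by blast
  then show False using step[of m] t(1) unfolding wellfounded_iff by blast
qed

lemma wft_irrefl: "wft t \<Longrightarrow> x \<epsilon> t \<Longrightarrow> \<not> x \<epsilon> x"
proof
  assume "wft t" "x \<epsilon> t" "x \<epsilon> x"
  have "dfn False (\<lambda>\<rho>. \<rho> 0 = x)" by (intro dfn_intros)
  from wft_minimal[OF \<open>wft t\<close> this \<open>x \<epsilon> t\<close>] \<open>x \<epsilon> x\<close> show False by auto
qed

lemma wellfounded_irrefl: "x \<in> wellfounded \<Longrightarrow> \<not> x \<epsilon> x"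
  unfolding wellfounded_iff using wft_irrefl by blast

text \<open>Collection gives a set of witnesses for the elements; the union of those that satisfy
  \<open>wft\<close>, together with \<open>x\<close> itself, is a witness for \<open>x\<close>. A
  minimal element of the part of \<open>y\<close> inside one transitive witness is minimal in
  \<open>y\<close>. This is the way in which sets are shown to be well-founded throughout.\<close>

lemma wellfounded_set:
  assumes "\<And>u. u \<epsilon> x \<Longrightarrow> u \<in> wellfounded"
  shows "x \<in> wellfounded"
proof -
  have "dfn False (\<lambda>\<rho>. wft (\<rho> (Suc 0)) \<and> \<rho> 0 \<epsilon> \<rho> (Suc 0))" by (intro dfn_intros)
  from dfn_collection[of "\<lambda>u t. wft t \<and> u \<epsilon> t" x, OF this] obtain Q where
    Q: "\<forall>u. u \<epsilon> x \<longrightarrow> (\<exists>t. t \<epsilon> Q \<and> wft t \<and> u \<epsilon> t)"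
    using assms unfolding wellfounded_iff by blast
  have wft: "dfn False (\<lambda>\<rho>. wft (\<rho> 0))" by (intro dfn_intros)
  define T where "T = ins x (bigU (sep Q wft))"
  have T: "z \<epsilon> T \<longleftrightarrow> z = x \<or> (\<exists>t. t \<epsilon> Q \<and> wft t \<and> z \<epsilon> t)" for z
    unfolding T_def by (auto simp: mem_sep[OF wft])
  have "transitive T"
    unfolding transitive_def subset_def
  proof (intro allI impI)
    fix y z assume y: "y \<epsilon> T" and z: "z \<epsilon> y"
    show "z \<epsilon> T"
    proof (cases "y = x")
      case True
      then show ?thesis using Q z unfolding T by blast
    next
      case False
      then obtain t where t: "t \<epsilon> Q" "wft t" "y \<epsilon> t" using y unfolding T by blast
      then have "z \<epsilon> t" using z unfolding wft_def transitive_def subset_def by blast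
      then show ?thesis using t unfolding T by blast
    qed
  qed
  moreover have "\<exists>m. m \<epsilon> y \<and> \<not> (\<exists>z. z \<epsilon> y \<and> z \<epsilon> m)" if y: "subset y T" "nonempty y" for y
  proof (cases "\<exists>u t. u \<epsilon> y \<and> t \<epsilon> Q \<and> wft t \<and> u \<epsilon> t")
    case True
    then obtain u t where "u \<epsilon> y" "wft t" "u \<epsilon> t" by blast
    moreover have "dfn False (\<lambda>\<rho>. \<rho> 0 \<epsilon> y)" by (intro dfn_intros)
    ultimately show ?thesis using wft_minimal[of t "\<lambda>u. u \<epsilon> y" u] by blast
  next
    case False
    then have x: "u = x" if "u \<epsilon> y" for u using y(1) that unfolding subset_def T by blast
    then have "x \<epsilon> y" using y(2) unfolding nonempty_def by blast
    \<comment> \<open>If \<open>x\<close> were an element of itself, it would lie in one of the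
      collected witnesses, where membership is irreflexive.\<close>
    moreover have "\<not> x \<epsilon> x" using Q wft_irrefl by blast
    ultimately show ?thesis using x by metis
  qed
  ultimately have "wft T" unfolding wft_def by blast
  then show ?thesis unfolding wellfounded_iff using T by blast
qed

lemma wellfounded_upair: "x \<in> wellfounded \<Longrightarrow> y \<in> wellfounded \<Longrightarrow> upair x y \<in> wellfounded"
  by (rule wellfounded_set) auto

lemma wellfounded_opair: "x \<in> wellfounded \<Longrightarrow> y \<in> wellfounded \<Longrightarrow> opair x y \<in> wellfounded"
  unfolding opair_def by (intro wellfounded_upair)

lemma wellfounded_bigU: "x \<in> wellfounded \<Longrightarrow> bigU x \<in> wellfounded"
  by (rule wellfounded_set) (auto dest: wellfounded_transitive)

lemma wellfounded_ins: "a \<in> wellfounded \<Longrightarrow> x \<in> wellfounded \<Longrightarrow> ins a x \<in> wellfounded"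
  by (rule wellfounded_set) (auto dest: wellfounded_transitive)

lemma wellfounded_subset: "x \<in> wellfounded \<Longrightarrow> subset y x \<Longrightarrow> y \<in> wellfounded"
  by (rule wellfounded_set) (auto simp: subset_def dest: wellfounded_transitive)

lemma wellfounded_prod: "x \<in> wellfounded \<Longrightarrow> y \<in> wellfounded \<Longrightarrow> prod x y \<in> wellfounded"
  by (rule wellfounded_set)
    (auto simp: mem_prod intro!: wellfounded_opair dest: wellfounded_transitive)

lemma wellfounded_emp: "emp \<in> wellfounded"
  by (rule wellfounded_set) simp

text \<open>A bisimulation between the membership relations of the well-founded and of the standard
  sets; the union of all of them is the isomorphism of the two classes.\<close>

definition bis :: "'u \<Rightarrow> bool" where
  "bis g \<longleftrightarrow> (\<forall>u s. opair u s \<epsilon> g \<longrightarrow> st s \<and>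
     (\<forall>w. w \<epsilon> u \<longrightarrow> (\<exists>r. r \<epsilon> s \<and> st r \<and> opair w r \<epsilon> g)) \<and>
     (\<forall>r. r \<epsilon> s \<longrightarrow> st r \<longrightarrow> (\<exists>w. w \<epsilon> u \<and> opair w r \<epsilon> g)))"

definition star :: "'u \<Rightarrow> 'u \<Rightarrow> bool" where
  "star u s \<longleftrightarrow> (\<exists>g. bis g \<and> opair u s \<epsilon> g)"

lemma dfn_bis [dfn_intros]: "trm False t \<Longrightarrow> dfn False (\<lambda>\<rho>. bis (t \<rho>))"
  by (rule dfn1[where R = bis]) (unfold bis_def, intro dfn_intros)

lemma dfn_star [dfn_intros]: "trm False s \<Longrightarrow> trm False t \<Longrightarrow> dfn False (\<lambda>\<rho>. star (s \<rho>) (t \<rho>))"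
  by (rule dfn2[where R = star]) (unfold star_def, intro dfn_intros)

lemma star_standard: "star u s \<Longrightarrow> st s"
  unfolding star_def bis_def by blast

text \<open>Membership induction. Bisimulations for the elements of \<open>u\<close> are collected
  and united to \<open>G\<close>; standardization turns the set of partners of these elements into a
  standard set \<open>Y\<close>, and the pair of \<open>u\<close> and \<open>Y\<close> can be added
  to \<open>G\<close>.\<close>

lemma star_total:
  assumes "u \<in> wellfounded"
  shows "\<exists>s. star u s"
proof (rule wellfounded_induct[where P = "\<lambda>u. \<exists>s. star u s", OF assms])
  show "dfn False (\<lambda>\<rho>. \<exists>s. star (\<rho> 0) s)" by (intro dfn_intros)
next
  fix u assume IH: "\<And>w. w \<epsilon> u \<Longrightarrow> \<exists>s. star w s"
  have "dfn False (\<lambda>\<rho>. bis (\<rho> (Suc 0)) \<and> (\<exists>s. opair (\<rho> 0) s \<epsilon> \<rho> (Suc 0)))" by (intro dfn_intros)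
  from dfn_collection[of "\<lambda>w g. bis g \<and> (\<exists>s. opair w s \<epsilon> g)" u, OF this] obtain Q where
    Q: "\<forall>w. w \<epsilon> u \<longrightarrow> (\<exists>g. g \<epsilon> Q \<and> bis g \<and> (\<exists>s. opair w s \<epsilon> g))"
    using IH unfolding star_def by blast
  have dbis: "dfn False (\<lambda>\<rho>. bis (\<rho> 0))" by (intro dfn_intros)
  define G where "G = bigU (sep Q bis)"
  have G: "p \<epsilon> G \<longleftrightarrow> (\<exists>g. g \<epsilon> Q \<and> bis g \<and> p \<epsilon> g)" for p
    unfolding G_def by (auto simp: mem_sep[OF dbis])
  have bisG: "bis G"
    unfolding bis_def
  proof (intro allI impI)
    fix w s assume "opair w s \<epsilon> G"
    then obtain g where g: "g \<epsilon> Q" "bis g" "opair w s \<epsilon> g" unfolding G by blast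
    then show "st s \<and> (\<forall>w'. w' \<epsilon> w \<longrightarrow> (\<exists>r. r \<epsilon> s \<and> st r \<and> opair w' r \<epsilon> G)) \<and>
      (\<forall>r. r \<epsilon> s \<longrightarrow> st r \<longrightarrow> (\<exists>w'. w' \<epsilon> w \<and> opair w' r \<epsilon> G))"
      unfolding G using g(2)[unfolded bis_def, rule_format, OF g(3)] by blast
  qed
  have dX: "dfn False (\<lambda>\<rho>. \<exists>w. w \<epsilon> u \<and> opair w (\<rho> 0) \<epsilon> G)" by (intro dfn_intros)
  define X where "X = sep (bigU (bigU G)) (\<lambda>s. \<exists>w. w \<epsilon> u \<and> opair w s \<epsilon> G)"
  have X: "s \<epsilon> X \<longleftrightarrow> (\<exists>w. w \<epsilon> u \<and> opair w s \<epsilon> G)" for s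
  proof -
    have "s \<epsilon> bigU (bigU G)" if "opair w s \<epsilon> G" for w
    proof -
      have "upair w s \<epsilon> opair w s" by (simp add: opair_def)
      then show ?thesis using that mem_bigU mem_upair by blast
    qed
    then show ?thesis unfolding X_def mem_sep[OF dX] by blast
  qed
  obtain Y where Y: "st Y" "\<And>s. st s \<Longrightarrow> s \<epsilon> Y \<longleftrightarrow> s \<epsilon> X"
    using standardization[of X] unfolding standard_def by auto
  have "bis (ins (opair u Y) G)"
    unfolding bis_def
  proof (intro allI impI)
    fix w s assume "opair w s \<epsilon> ins (opair u Y) G"
    then consider "w = u" "s = Y" | "opair w s \<epsilon> G" by auto
    then show "st s \<and> (\<forall>w'. w' \<epsilon> w \<longrightarrow> (\<exists>r. r \<epsilon> s \<and> st r \<and> opair w' r \<epsilon> ins (opair u Y) G)) \<and>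
      (\<forall>r. r \<epsilon> s \<longrightarrow> st r \<longrightarrow> (\<exists>w'. w' \<epsilon> w \<and> opair w' r \<epsilon> ins (opair u Y) G))"
    proof cases
      case 1
      have "\<exists>r. r \<epsilon> Y \<and> st r \<and> opair w' r \<epsilon> G" if w': "w' \<epsilon> u" for w'
      proof -
        obtain r where "opair w' r \<epsilon> G" using Q w' unfolding G by blast
        moreover from this have "st r" using bisG unfolding bis_def by blast
        ultimately show ?thesis using Y(2)[of r] X w' by blast
      qed
      moreover have "\<exists>w. w \<epsilon> u \<and> opair w r \<epsilon> G" if "r \<epsilon> Y" "st r" for r
        using that Y(2) X by simp
      ultimately show ?thesis unfolding 1 mem_ins using Y(1) by blast
    next
      case 2
      then show ?thesis using bisG[unfolded bis_def, rule_format, OF 2] unfolding mem_ins by blast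
    qed
  qed
  moreover have "opair u Y \<epsilon> ins (opair u Y) G" by simp
  ultimately show "\<exists>s. star u s" unfolding star_def by blast
qed

lemma star_step:
  assumes "star u s"
  shows "w \<epsilon> u \<Longrightarrow> \<exists>r. r \<epsilon> s \<and> st r \<and> star w r"
    and "r \<epsilon> s \<Longrightarrow> st r \<Longrightarrow> \<exists>w. w \<epsilon> u \<and> star w r"
proof -
  obtain g where g: "bis g" "opair u s \<epsilon> g" using assms unfolding star_def by blast
  note * = g(1)[unfolded bis_def, rule_format, OF g(2)]
  show "w \<epsilon> u \<Longrightarrow> \<exists>r. r \<epsilon> s \<and> st r \<and> star w r"
    using * g(1) unfolding star_def by blast
  show "r \<epsilon> s \<Longrightarrow> st r \<Longrightarrow> \<exists>w. w \<epsilon> u \<and> star w r"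
    using * g(1) unfolding star_def by blast
qed

lemma star_inj:
  assumes "u \<in> wellfounded"
  shows "\<forall>v s. star u s \<longrightarrow> star v s \<longrightarrow> u = v"
proof (rule wellfounded_induct[where P = "\<lambda>u. \<forall>v s. star u s \<longrightarrow> star v s \<longrightarrow> u = v", OF assms])
  show "dfn False (\<lambda>\<rho>. \<forall>v s. star (\<rho> 0) s \<longrightarrow> star v s \<longrightarrow> \<rho> 0 = v)" by (intro dfn_intros)
next
  fix u assume IH: "\<And>w. w \<epsilon> u \<Longrightarrow> \<forall>v s. star w s \<longrightarrow> star v s \<longrightarrow> w = v"
  show "\<forall>v s. star u s \<longrightarrow> star v s \<longrightarrow> u = v"
  proof (intro allI impI set_ext)
    fix v s z assume us: "star u s" and vs: "star v s"
    show "z \<epsilon> u \<longleftrightarrow> z \<epsilon> v"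
    proof
      assume z: "z \<epsilon> u"
      then obtain r where r: "r \<epsilon> s" "st r" "star z r" using star_step(1)[OF us] by blast
      then obtain w where "w \<epsilon> v" "star w r" using star_step(2)[OF vs] by blast
      then show "z \<epsilon> v" using IH[OF z] r(3) by blast
    next
      assume z: "z \<epsilon> v"
      then obtain r where r: "r \<epsilon> s" "st r" "star z r" using star_step(1)[OF vs] by blast
      then obtain w where "w \<epsilon> u" "star w r" using star_step(2)[OF us] by blast
      then show "z \<epsilon> u" using IH[of w] r(3) by blast
    qed
  qed
qed

text \<open>The power set is borrowed from the standard universe: \<open>\<Sigma>\<close>
  standardizes the images of the elements of \<open>v\<close>, its standard power set is
  \<open>\<Pi>\<close>, and replacement carries \<open>\<Pi>\<close> back. Every subset of
  \<open>v\<close> is reached because its image can be standardized too.\<close>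

lemma powerset_wellfounded:
  assumes v: "v \<in> wellfounded"
  shows "\<exists>p. \<forall>y. y \<epsilon> p \<longleftrightarrow> subset y v"
proof -
  have "dfn False (\<lambda>\<rho>. star (\<rho> 0) (\<rho> (Suc 0)))" by (intro dfn_intros)
  from dfn_collection[of star, OF this, of v] obtain W where
    W: "\<And>u. u \<epsilon> v \<Longrightarrow> \<exists>s. s \<epsilon> W \<and> star u s"
    using star_total wellfounded_transitive[OF v] by blast
  obtain \<Sigma> where \<Sigma>: "\<Sigma> \<in> standard" "\<And>s. s \<in> standard \<Longrightarrow> s \<epsilon> \<Sigma> \<longleftrightarrow> s \<epsilon> W"
    using standardization[of W] by blast
  have "powerset_ax standard" using ZFC_standard unfolding ZFC_in_def by (elim conjE)
  from this[unfolded powerset_ax_def, rule_format, OF \<Sigma>(1)] obtain \<Pi> where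
    \<Pi>: "\<forall>y\<in>standard. y \<epsilon> \<Pi> \<longleftrightarrow> (\<forall>z\<in>standard. z \<epsilon> y \<longrightarrow> z \<epsilon> \<Sigma>)" by (elim bexE)
  \<comment> \<open>Decodes a subset of \<open>\<Sigma>\<close> into the subset of \<open>v\<close>
    whose images are its standard elements; injectivity of \<open>star\<close> makes this inverse to
    encoding.\<close>
  define f where "f z = sep v (\<lambda>u. \<exists>s. s \<epsilon> z \<and> st s \<and> star u s)" for z
  have df: "dfn False (\<lambda>\<rho>. \<exists>s. s \<epsilon> z \<and> st s \<and> star (\<rho> 0) s)" for z by (intro dfn_intros)
  have f: "u \<epsilon> f z \<longleftrightarrow> u \<epsilon> v \<and> (\<exists>s. s \<epsilon> z \<and> st s \<and> star u s)" for u z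
    unfolding f_def by (rule mem_sep[OF df])
  have tf: "trm False (\<lambda>\<rho>. f (\<rho> 0))" unfolding f_def by (intro dfn_intros)
  define R where "R = img \<Pi> f"
  have "y \<epsilon> R" if y: "subset y v" for y
  proof -
    have dy: "dfn False (\<lambda>\<rho>. \<exists>u. u \<epsilon> y \<and> star u (\<rho> 0))" by (intro dfn_intros)
    obtain Y where Y: "Y \<in> standard"
      "\<And>s. s \<in> standard \<Longrightarrow> s \<epsilon> Y \<longleftrightarrow> s \<epsilon> sep W (\<lambda>s. \<exists>u. u \<epsilon> y \<and> star u s)"
      using standardization[of "sep W (\<lambda>s. \<exists>u. u \<epsilon> y \<and> star u s)"] by blast
    have Y': "s \<epsilon> Y \<longleftrightarrow> s \<epsilon> W \<and> (\<exists>u. u \<epsilon> y \<and> star u s)" if "st s" for s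
      using Y(2)[of s] that by (simp add: standard_def mem_sep[OF dy])
    have "Y \<epsilon> \<Pi>" using \<Pi>[rule_format, OF Y(1)] \<Sigma>(2) Y' by (simp add: standard_def)
    moreover have "f Y = y"
    proof (rule set_ext)
      fix u
      show "u \<epsilon> f Y \<longleftrightarrow> u \<epsilon> y"
      proof
        assume "u \<epsilon> f Y"
        then obtain s where s: "u \<epsilon> v" "s \<epsilon> Y" "st s" "star u s" unfolding f by blast
        then obtain u' where "u' \<epsilon> y" "star u' s" using Y' by blast
        then show "u \<epsilon> y"
          using s star_inj[OF wellfounded_transitive[OF v s(1)]] by blast
      next
        assume u: "u \<epsilon> y"
        then have "u \<epsilon> v" using y unfolding subset_def by blast
        moreover from this obtain s where "s \<epsilon> W" "star u s" using W by blast
        ultimately show "u \<epsilon> f Y" unfolding f using Y' u star_standard by blast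
      qed
    qed
    ultimately show ?thesis unfolding R_def mem_img[OF tf] by blast
  qed
  moreover have "dfn False (\<lambda>\<rho>. subset (\<rho> 0) v)" by (intro dfn_intros)
  note ds = mem_sep[of "\<lambda>y. subset y v", OF this]
  ultimately show ?thesis using ds[of _ R] by (intro exI[of _ "sep R (\<lambda>y. subset y v)"]) auto
qed

definition pow :: "'u \<Rightarrow> 'u" where
  "pow v = (THE p. \<forall>y. y \<epsilon> p \<longleftrightarrow> subset y v)"

lemma mem_pow: "v \<in> wellfounded \<Longrightarrow> y \<epsilon> pow v \<longleftrightarrow> subset y v"
  unfolding pow_def by (rule mem_the_set[OF powerset_wellfounded])

lemma wellfounded_pow: "v \<in> wellfounded \<Longrightarrow> pow v \<in> wellfounded"
  by (rule wellfounded_set) (auto simp: mem_pow intro: wellfounded_subset)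

subsection \<open>Sets of standard size\<close>

text \<open>The default \<open>emp\<close> keeps application total, so that it is a definable term
  for arbitrary arguments.\<close>

definition app :: "'u \<Rightarrow> 'u \<Rightarrow> 'u" where
  "app f x = (if \<exists>!y. opair x y \<epsilon> f then THE y. opair x y \<epsilon> f else emp)"

lemma trm_app [dfn_intros]: "trm False s \<Longrightarrow> trm False t \<Longrightarrow> trm False (\<lambda>\<rho>. app (s \<rho>) (t \<rho>))"
proof (rule trm2[where f = app], rule trm2I[where G = "\<lambda>y f x.
    (opair x y \<epsilon> f \<and> (\<forall>z. opair x z \<epsilon> f \<longrightarrow> z = y)) \<or>
    (\<not> (\<exists>y. opair x y \<epsilon> f \<and> (\<forall>z. opair x z \<epsilon> f \<longrightarrow> z = y)) \<and> y = emp)"])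
  show "y = app f x \<longleftrightarrow> (opair x y \<epsilon> f \<and> (\<forall>z. opair x z \<epsilon> f \<longrightarrow> z = y)) \<or>
    (\<not> (\<exists>y. opair x y \<epsilon> f \<and> (\<forall>z. opair x z \<epsilon> f \<longrightarrow> z = y)) \<and> y = emp)" for f x y
  proof (cases "\<exists>!y. opair x y \<epsilon> f")
    case True
    then obtain y' where y': "opair x y' \<epsilon> f" "\<And>z. opair x z \<epsilon> f \<Longrightarrow> z = y'" by blast
    have "(THE y. opair x y \<epsilon> f) = y'" by (rule the_equality) (rule y'(1), rule y'(2))
    then have "app f x = y'" unfolding app_def using True by (simp only: if_True)
    then show ?thesis using y' by blast
  next
    case False
    then have "app f x = emp" unfolding app_def by (simp only: if_False)
    moreover have "(opair x y \<epsilon> f \<and> (\<forall>z. opair x z \<epsilon> f \<longrightarrow> z = y)) = False" for y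
      using False by blast
    ultimately show ?thesis by (simp only: simp_thms)
  qed
next
  show "dfn False (\<lambda>\<rho>. (opair (\<rho> (Suc (Suc 0))) (\<rho> 0) \<epsilon> \<rho> (Suc 0) \<and>
      (\<forall>z. opair (\<rho> (Suc (Suc 0))) z \<epsilon> \<rho> (Suc 0) \<longrightarrow> z = \<rho> 0)) \<or>
    (\<not> (\<exists>y. opair (\<rho> (Suc (Suc 0))) y \<epsilon> \<rho> (Suc 0) \<and>
      (\<forall>z. opair (\<rho> (Suc (Suc 0))) z \<epsilon> \<rho> (Suc 0) \<longrightarrow> z = y)) \<and> \<rho> 0 = emp))"
    by (intro dfn_intros)
qed auto

lemma app_eq: "function_on f X \<Longrightarrow> x \<epsilon> X \<Longrightarrow> opair x y \<epsilon> f \<longleftrightarrow> y = app f x"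
proof -
  assume "function_on f X" "x \<epsilon> X"
  then have ex1: "\<exists>!y. opair x y \<epsilon> f" unfolding function_on_def related_iff by blast
  then obtain y' where y': "opair x y' \<epsilon> f" "\<And>z. opair x z \<epsilon> f \<Longrightarrow> z = y'" by blast
  have "(THE y. opair x y \<epsilon> f) = y'" by (rule the_equality) (rule y'(1), rule y'(2))
  then have "app f x = y'" unfolding app_def using ex1 by (simp only: if_True)
  then show "opair x y \<epsilon> f \<longleftrightarrow> y = app f x" using y' by blast
qed

lemma function_on_img:
  assumes "trm False (\<lambda>\<rho>. f (\<rho> 0))"
  shows "function_on (img X (\<lambda>x. opair x (f x))) X"
    and "opair x y \<epsilon> img X (\<lambda>x. opair x (f x)) \<longleftrightarrow> x \<epsilon> X \<and> y = f x"
proof -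
  have "trm False (\<lambda>\<rho>. opair (\<rho> 0) (f (\<rho> 0)))" by (intro dfn_intros assms)
  note * = mem_img[OF this, of _ X]
  show "opair x y \<epsilon> img X (\<lambda>x. opair x (f x)) \<longleftrightarrow> x \<epsilon> X \<and> y = f x"
    by (auto simp: *)
  show "function_on (img X (\<lambda>x. opair x (f x))) X"
    unfolding function_on_def by (auto simp: *)
qed

lemma bijection_img:
  assumes f: "trm False (\<lambda>\<rho>. f (\<rho> 0))"
    and inj: "\<And>x y. x \<epsilon> X \<Longrightarrow> y \<epsilon> X \<Longrightarrow> f x = f y \<Longrightarrow> x = y"
  shows "bijection (img X (\<lambda>x. opair (f x) x)) (img X f) X"
proof -
  have "trm False (\<lambda>\<rho>. opair (f (\<rho> 0)) (\<rho> 0))" by (intro dfn_intros f)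
  note * = mem_img[OF this, of _ X] mem_img[OF f, of _ X]
  show ?thesis
    unfolding bijection_def relation_between_def by (auto simp: * dest: inj)
qed

text \<open>Each value is represented by its fibre in \<open>v\<close> rather than by a chosen
  preimage. Fibres are subsets of \<open>v\<close>, hence well-founded, and different values have
  different fibres.\<close>

lemma standard_size_img:
  assumes v: "v \<in> wellfounded" and f: "trm False (\<lambda>\<rho>. f (\<rho> 0))"
  shows "standard_size (img v f)"
proof -
  have tf: "trm False t \<Longrightarrow> trm False (\<lambda>\<rho>. f (t \<rho>))" for t by (rule trm1[OF f])
  define fib where "fib y = sep v (\<lambda>u. f u = y)" for y
  have "dfn False (\<lambda>\<rho>. f (\<rho> 0) = y)" for y by (intro dfn_intros tf)
  then have fib: "u \<epsilon> fib y \<longleftrightarrow> u \<epsilon> v \<and> f u = y" for u y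
    unfolding fib_def by (rule mem_sep)
  have tfib: "trm False (\<lambda>\<rho>. fib (\<rho> 0))" unfolding fib_def by (intro dfn_intros tf)
  have "bijection (img (img v f) (\<lambda>x. opair (fib x) x)) (img (img v f) fib) (img v f)"
  proof (rule bijection_img[OF tfib])
    fix x y assume "x \<epsilon> img v f" "fib x = fib y"
    then show "x = y" using fib by (metis mem_img[OF f])
  qed
  moreover have "img (img v f) fib \<in> wellfounded"
  proof (rule wellfounded_set)
    fix u assume "u \<epsilon> img (img v f) fib"
    then obtain y where "u = fib y" unfolding mem_img[OF tfib] by blast
    then show "u \<in> wellfounded"
      using fib by (intro wellfounded_subset[OF v]) (auto simp: subset_def)
  qed
  ultimately show ?thesis unfolding standard_size_def by blast
qed

lemma standard_size_wellfounded: "v \<in> wellfounded \<Longrightarrow> standard_size v"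
proof -
  assume "v \<in> wellfounded"
  moreover have t: "trm False (\<lambda>\<rho>. \<rho> 0)" by (rule trm_var)
  moreover have "img v (\<lambda>x. x) = v" by (rule set_ext) (simp add: mem_img[OF t])
  ultimately show ?thesis using standard_size_img[of v "\<lambda>x. x"] by simp
qed

lemma choice_wellfounded:
  assumes "v \<in> wellfounded" and F: "trm False (\<lambda>\<rho>. F (\<rho> 0))"
    and ne: "\<And>x. x \<epsilon> v \<Longrightarrow> nonempty (F x)"
  shows "\<exists>c. \<forall>x. x \<epsilon> v \<longrightarrow> app c x \<epsilon> F x"
proof -
  have "\<exists>f. function_on f v \<and> (\<forall>x y Y. related f x y \<and>
      related (img v (\<lambda>x. opair x (F x))) x Y \<longrightarrow> y \<epsilon> Y)"
    using ne by (intro standard_size_choice standard_size_wellfounded assms function_on_img(1) F)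
      (auto simp: function_on_img(2)[OF F])
  then obtain f where "function_on f v" "\<And>x y. opair x y \<epsilon> f \<Longrightarrow> x \<epsilon> v \<Longrightarrow> y \<epsilon> F x"
    by (auto simp: function_on_img(2)[OF F])
  then show ?thesis using app_eq[of f v] by blast
qed

lemma trm_if [dfn_intros]:
  assumes P: "dfn False P" and s: "trm False s" and t: "trm False t"
  shows "trm False (\<lambda>\<rho>. if P \<rho> then s \<rho> else t \<rho>)"
proof -
  have "dfn False (\<lambda>\<rho>. (P (\<lambda>n. \<rho> (Suc n)) \<and> \<rho> 0 = s (\<lambda>n. \<rho> (Suc n))) \<or>
      (\<not> P (\<lambda>n. \<rho> (Suc n)) \<and> \<rho> 0 = t (\<lambda>n. \<rho> (Suc n))))"
    by (intro dfn_disj dfn_conj dfn_neg dfn_shift[OF P] dfn_eq trm_var trm_shift[OF s] trm_shift[OF t])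
  then show ?thesis unfolding trm_def by (auto elim!: dfn_equiv)
qed

definition pfst :: "'u \<Rightarrow> 'u" where
  "pfst p = (if \<exists>x y. p = opair x y then THE x. \<exists>y. p = opair x y else emp)"

definition psnd :: "'u \<Rightarrow> 'u" where
  "psnd p = (if \<exists>x y. p = opair x y then THE y. \<exists>x. p = opair x y else emp)"

lemma pfst_opair [simp]: "pfst (opair x y) = x" and psnd_opair [simp]: "psnd (opair x y) = y"
  unfolding pfst_def psnd_def by auto

lemma trm_pfst [dfn_intros]: "trm False t \<Longrightarrow> trm False (\<lambda>\<rho>. pfst (t \<rho>))"
proof (rule trm1[where f = pfst], rule trm1I[where G =
    "\<lambda>x p. (\<exists>y. p = opair x y) \<or> (\<not> (\<exists>x y. p = opair x y) \<and> x = emp)"])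
  show "x = pfst p \<longleftrightarrow> (\<exists>y. p = opair x y) \<or> (\<not> (\<exists>x y. p = opair x y) \<and> x = emp)" for x p
  proof (cases "\<exists>x y. p = opair x y")
    case False
    then show ?thesis unfolding pfst_def by auto
  qed auto
  show "dfn False (\<lambda>\<rho>. (\<exists>y. \<rho> (Suc 0) = opair (\<rho> 0) y) \<or>
      (\<not> (\<exists>x y. \<rho> (Suc 0) = opair x y) \<and> \<rho> 0 = emp))"
    by (intro dfn_intros)
qed simp

lemma trm_psnd [dfn_intros]: "trm False t \<Longrightarrow> trm False (\<lambda>\<rho>. psnd (t \<rho>))"
proof (rule trm1[where f = psnd], rule trm1I[where G =
    "\<lambda>y p. (\<exists>x. p = opair x y) \<or> (\<not> (\<exists>x y. p = opair x y) \<and> y = emp)"])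
  show "y = psnd p \<longleftrightarrow> (\<exists>x. p = opair x y) \<or> (\<not> (\<exists>x y. p = opair x y) \<and> y = emp)" for y p
  proof (cases "\<exists>x y. p = opair x y")
    case False
    then show ?thesis unfolding psnd_def by auto
  qed auto
  show "dfn False (\<lambda>\<rho>. (\<exists>x. \<rho> (Suc 0) = opair x (\<rho> 0)) \<or>
      (\<not> (\<exists>x y. \<rho> (Suc 0) = opair x y) \<and> \<rho> 0 = emp))"
    by (intro dfn_intros)
qed simp

subsection \<open>Finite subsets and saturation\<close>

text \<open>Finiteness in the sense of Kuratowski and Tarski: the least family containing the empty
  set and closed under insertion. The quantifier over \<open>A\<close> ranges over all sets,
  external ones included.\<close>

definition Fin :: "'u \<Rightarrow> 'u" where
  "Fin I = sep (pow I) (\<lambda>\<beta>. \<forall>A. emp \<epsilon> A \<and> (\<forall>\<gamma>. \<gamma> \<epsilon> A \<longrightarrow> (\<forall>b. b \<epsilon> I \<longrightarrow> ins b \<gamma> \<epsilon> A)) \<longrightarrow> \<beta> \<epsilon> A)"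

lemma mem_Fin:
  assumes "I \<in> wellfounded"
  shows "\<beta> \<epsilon> Fin I \<longleftrightarrow> subset \<beta> I \<and>
    (\<forall>A. emp \<epsilon> A \<and> (\<forall>\<gamma>. \<gamma> \<epsilon> A \<longrightarrow> (\<forall>b. b \<epsilon> I \<longrightarrow> ins b \<gamma> \<epsilon> A)) \<longrightarrow> \<beta> \<epsilon> A)"
proof -
  have "dfn False (\<lambda>\<rho>. \<forall>A. emp \<epsilon> A \<and> (\<forall>\<gamma>. \<gamma> \<epsilon> A \<longrightarrow> (\<forall>b. b \<epsilon> I \<longrightarrow> ins b \<gamma> \<epsilon> A)) \<longrightarrow> \<rho> 0 \<epsilon> A)"
    by (intro dfn_intros)
  then show ?thesis unfolding Fin_def by (simp add: mem_sep mem_pow[OF assms])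
qed

lemma wellfounded_Fin: "I \<in> wellfounded \<Longrightarrow> Fin I \<in> wellfounded"
  by (rule wellfounded_subset[OF wellfounded_pow]) (auto simp: subset_def[of "Fin I"] mem_Fin mem_pow)

lemma Fin_emp: "I \<in> wellfounded \<Longrightarrow> emp \<epsilon> Fin I"
  by (simp add: mem_Fin subset_def)

lemma Fin_ins: "I \<in> wellfounded \<Longrightarrow> \<beta> \<epsilon> Fin I \<Longrightarrow> b \<epsilon> I \<Longrightarrow> ins b \<beta> \<epsilon> Fin I"
  unfolding mem_Fin subset_def mem_ins by blast

lemma Fin_subset: "I \<in> wellfounded \<Longrightarrow> \<beta> \<epsilon> Fin I \<Longrightarrow> x \<epsilon> \<beta> \<Longrightarrow> x \<epsilon> I"
  by (simp add: mem_Fin subset_def)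

text \<open>The induction covers every property of the full language, internality among them. That
  distinguishes these sets from those that are finite merely in the internal sense.\<close>

lemma Fin_induct:
  assumes I: "I \<in> wellfounded" and \<beta>: "\<beta> \<epsilon> Fin I" and P: "dfn False (\<lambda>\<rho>. P (\<rho> 0))"
    and emp: "P emp"
    and ins: "\<And>b \<gamma>. \<gamma> \<epsilon> Fin I \<Longrightarrow> b \<epsilon> I \<Longrightarrow> P \<gamma> \<Longrightarrow> P (ins b \<gamma>)"
  shows "P \<beta>"
proof -
  note sep = mem_sep[OF P, of _ "Fin I"]
  have "\<beta> \<epsilon> sep (Fin I) P"
    using \<beta>[unfolded mem_Fin[OF I], THEN conjunct2, rule_format, of "sep (Fin I) P"]
    by (simp add: sep emp ins Fin_emp[OF I] Fin_ins[OF I])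
  then show ?thesis by (simp add: sep)
qed

definition cup :: "'u \<Rightarrow> 'u \<Rightarrow> 'u" where
  "cup x y = bigU (upair x y)"

lemma mem_cup [simp]: "z \<epsilon> cup x y \<longleftrightarrow> z \<epsilon> x \<or> z \<epsilon> y"
  unfolding cup_def by auto

lemma trm_cup [dfn_intros]: "trm i s \<Longrightarrow> trm i t \<Longrightarrow> trm i (\<lambda>\<rho>. cup (s \<rho>) (t \<rho>))"
  unfolding cup_def by (intro dfn_intros)

lemma wellfounded_cup: "x \<in> wellfounded \<Longrightarrow> y \<in> wellfounded \<Longrightarrow> cup x y \<in> wellfounded"
  unfolding cup_def by (intro wellfounded_bigU wellfounded_upair)

lemma Fin_cup:
  assumes I: "I \<in> wellfounded" and "\<beta> \<epsilon> Fin I" "\<gamma> \<epsilon> Fin I"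
  shows "cup \<beta> \<gamma> \<epsilon> Fin I"
proof (rule Fin_induct[where P = "\<lambda>\<beta>. cup \<beta> \<gamma> \<epsilon> Fin I", OF I assms(2)])
  show "dfn False (\<lambda>\<rho>. cup (\<rho> 0) \<gamma> \<epsilon> Fin I)" by (intro dfn_intros)
  have "cup emp \<gamma> = \<gamma>" by (rule set_ext) simp
  then show "cup emp \<gamma> \<epsilon> Fin I" using assms(3) by simp
  fix b \<delta> assume "b \<epsilon> I" "cup \<delta> \<gamma> \<epsilon> Fin I"
  moreover have "cup (ins b \<delta>) \<gamma> = ins b (cup \<delta> \<gamma>)" by (rule set_ext) auto
  ultimately show "cup (ins b \<delta>) \<gamma> \<epsilon> Fin I" using Fin_ins[OF I] by simp
qed

section \<open>Saturation for families indexed by well-founded sets\<close>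

definition cap :: "'u \<Rightarrow> ('u \<Rightarrow> 'u) \<Rightarrow> 'u \<Rightarrow> 'u" where
  "cap Z X \<beta> = sep Z (\<lambda>z. \<forall>i. i \<epsilon> \<beta> \<longrightarrow> z \<epsilon> X i)"

lemma mem_cap:
  assumes "trm False (\<lambda>\<rho>. X (\<rho> 0))"
  shows "z \<epsilon> cap Z X \<beta> \<longleftrightarrow> z \<epsilon> Z \<and> (\<forall>i. i \<epsilon> \<beta> \<longrightarrow> z \<epsilon> X i)"
proof -
  have "dfn False (\<lambda>\<rho>. \<forall>i. i \<epsilon> \<beta> \<longrightarrow> \<rho> 0 \<epsilon> X i)" by (intro dfn_intros trm1[OF assms])
  then show ?thesis unfolding cap_def by (rule mem_sep)
qed

text \<open>Intersecting internal sets one at a time stays internal, and induction over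
  \<open>Fin\<close> carries this to all finite \<open>\<beta>\<close>. Infinite intersections can
  leave the internal sets, which is why all approximations below use finite
  \<open>\<beta>\<close>.\<close>

lemma cap_internal:
  assumes I: "I \<in> wellfounded" and X: "trm False (\<lambda>\<rho>. X (\<rho> 0))"
    and int: "\<And>i. i \<epsilon> I \<Longrightarrow> X i \<in> internal" and Z: "Z \<in> internal" and \<beta>: "\<beta> \<epsilon> Fin I"
  shows "cap Z X \<beta> \<in> internal"
proof (rule Fin_induct[where P = "\<lambda>\<beta>. cap Z X \<beta> \<in> internal", OF I \<beta>])
  show "dfn False (\<lambda>\<rho>. cap Z X (\<rho> 0) \<in> internal)"
    unfolding cap_def by (intro dfn_intros trm1[OF X])
  have "cap Z X emp = Z" by (rule set_ext) (simp add: mem_cap[OF X])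
  then show "cap Z X emp \<in> internal" using Z by simp
  fix b \<gamma> assume b: "b \<epsilon> I" and \<gamma>: "cap Z X \<gamma> \<in> internal"
  have D: "dfn True (\<lambda>\<rho>. \<rho> 0 \<epsilon> X b)" using int[OF b] by (intro dfn_intros) simp
  have "cap Z X (ins b \<gamma>) = sep (cap Z X \<gamma>) (\<lambda>z. z \<epsilon> X b)"
    by (rule set_ext) (auto simp: mem_sep_internal[OF D \<gamma>] mem_cap[OF X])
  then show "cap Z X (ins b \<gamma>) \<in> internal" using sep_internal[OF D \<gamma>] by simp
qed

text \<open>The axiom asks for a family closed under binary intersection. The finite intersections
  form one, and as an image of a well-founded set it has standard size.\<close>

lemma saturation_Fin:
  assumes I: "I \<in> wellfounded" and X: "trm False (\<lambda>\<rho>. X (\<rho> 0))"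
    and int: "\<And>i. i \<epsilon> I \<Longrightarrow> X i \<in> internal" and Z: "Z \<in> internal"
    and fip: "\<And>\<beta>. \<beta> \<epsilon> Fin I \<Longrightarrow> \<exists>z. z \<epsilon> Z \<and> (\<forall>i. i \<epsilon> \<beta> \<longrightarrow> z \<epsilon> X i)"
  shows "\<exists>z. z \<epsilon> Z \<and> (\<forall>i. i \<epsilon> I \<longrightarrow> z \<epsilon> X i)"
proof -
  have tcap: "trm False (\<lambda>\<rho>. cap Z X (\<rho> 0))"
    unfolding cap_def by (intro dfn_intros trm1[OF X])
  note XX = mem_img[OF tcap, of _ "Fin I"]
  have "\<exists>z. \<forall>Y. Y \<epsilon> img (Fin I) (cap Z X) \<longrightarrow> z \<epsilon> Y"
  proof (rule saturation)
    show "standard_size (img (Fin I) (cap Z X))"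
      by (rule standard_size_img[OF wellfounded_Fin[OF I] tcap])
    show "Y \<in> internal \<and> nonempty Y" if "Y \<epsilon> img (Fin I) (cap Z X)" for Y
      using that fip cap_internal[OF I X int Z] unfolding XX nonempty_def
      by (auto simp: mem_cap[OF X])
    fix Y Y' assume "Y \<epsilon> img (Fin I) (cap Z X)" "Y' \<epsilon> img (Fin I) (cap Z X)"
    then obtain \<beta> \<gamma> where "\<beta> \<epsilon> Fin I" "\<gamma> \<epsilon> Fin I" "Y = cap Z X \<beta>" "Y' = cap Z X \<gamma>"
      unfolding XX by blast
    then show "\<exists>V. V \<epsilon> img (Fin I) (cap Z X) \<and> (\<forall>z. z \<epsilon> V \<longleftrightarrow> z \<epsilon> Y \<and> z \<epsilon> Y')"
      using Fin_cup[OF I, of \<beta> \<gamma>] unfolding XX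
      by (intro exI[of _ "cap Z X (cup \<beta> \<gamma>)"]) (auto simp: mem_cap[OF X])
  qed
  then obtain z where z: "\<And>\<beta>. \<beta> \<epsilon> Fin I \<Longrightarrow> z \<epsilon> cap Z X \<beta>" unfolding XX by blast
  have "z \<epsilon> Z" using z[OF Fin_emp[OF I]] by (simp add: mem_cap[OF X])
  moreover have "z \<epsilon> X i" if "i \<epsilon> I" for i
    using z[OF Fin_ins[OF I Fin_emp[OF I] that]] by (simp add: mem_cap[OF X])
  ultimately show ?thesis by blast
qed

text \<open>Directedness yields the finite intersection property by induction on the finite index
  set. The member \<open>X i0\<close> serves as the ambient internal set.\<close>

lemma saturation_directed:
  assumes I: "I \<in> wellfounded" and X: "trm False (\<lambda>\<rho>. X (\<rho> 0))"
    and int: "\<And>i. i \<epsilon> I \<Longrightarrow> X i \<in> internal"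
    and ne: "\<And>i. i \<epsilon> I \<Longrightarrow> \<exists>z. z \<epsilon> X i" and "i0 \<epsilon> I"
    and dir: "\<And>i j. i \<epsilon> I \<Longrightarrow> j \<epsilon> I \<Longrightarrow> \<exists>k. k \<epsilon> I \<and> (\<forall>z. z \<epsilon> X k \<longrightarrow> z \<epsilon> X i \<and> z \<epsilon> X j)"
  shows "\<exists>z. \<forall>i. i \<epsilon> I \<longrightarrow> z \<epsilon> X i"
proof -
  let ?P = "\<lambda>\<beta>. \<exists>k. k \<epsilon> I \<and> (\<forall>z. z \<epsilon> X k \<longrightarrow> z \<epsilon> X i0 \<and> (\<forall>i. i \<epsilon> \<beta> \<longrightarrow> z \<epsilon> X i))"
  have "?P \<beta>" if \<beta>: "\<beta> \<epsilon> Fin I" for \<beta>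
  proof (rule Fin_induct[where P = ?P, OF I \<beta>])
    show "dfn False (\<lambda>\<rho>. ?P (\<rho> 0))" by (intro dfn_intros trm1[OF X])
    show "?P emp" using \<open>i0 \<epsilon> I\<close> by auto
    fix b \<gamma> assume b: "b \<epsilon> I" and "?P \<gamma>"
    then obtain k where k: "k \<epsilon> I" "\<And>z. z \<epsilon> X k \<Longrightarrow> z \<epsilon> X i0 \<and> (\<forall>i. i \<epsilon> \<gamma> \<longrightarrow> z \<epsilon> X i)"
      by blast
    from dir[OF k(1) b] obtain l where
      l: "l \<epsilon> I" "\<And>z. z \<epsilon> X l \<Longrightarrow> z \<epsilon> X k \<and> z \<epsilon> X b" by blast
    have "z \<epsilon> X i0 \<and> (\<forall>i. i \<epsilon> ins b \<gamma> \<longrightarrow> z \<epsilon> X i)" if "z \<epsilon> X l" for z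
      using k(2)[of z] l(2)[OF that] unfolding mem_ins by blast
    with l(1) show "?P (ins b \<gamma>)" by blast
  qed
  then have "\<exists>z. z \<epsilon> X i0 \<and> (\<forall>i. i \<epsilon> I \<longrightarrow> z \<epsilon> X i)"
    using ne by (intro saturation_Fin[OF I X int int[OF \<open>i0 \<epsilon> I\<close>]]) blast+
  then show ?thesis by blast
qed

text \<open>The form used in all later applications: two sorts of finitely many conditions are
  imposed at once, and unions of the condition sets make the family directed.\<close>

lemma saturation_Fin_Fin:
  assumes I: "I \<in> wellfounded" and J: "J \<in> wellfounded"
    and X: "trm False (\<lambda>\<rho>. X (\<rho> 0) (\<rho> (Suc 0)))"
    and int: "\<And>\<beta> \<gamma>. \<beta> \<epsilon> Fin I \<Longrightarrow> \<gamma> \<epsilon> Fin J \<Longrightarrow> X \<beta> \<gamma> \<in> internal"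
    and ne: "\<And>\<beta> \<gamma>. \<beta> \<epsilon> Fin I \<Longrightarrow> \<gamma> \<epsilon> Fin J \<Longrightarrow> \<exists>z. z \<epsilon> X \<beta> \<gamma>"
    and mono: "\<And>\<beta> \<gamma> \<beta>' \<gamma>' z. z \<epsilon> X (cup \<beta> \<beta>') (cup \<gamma> \<gamma>') \<Longrightarrow> z \<epsilon> X \<beta> \<gamma> \<and> z \<epsilon> X \<beta>' \<gamma>'"
  shows "\<exists>z. \<forall>\<beta> \<gamma>. \<beta> \<epsilon> Fin I \<longrightarrow> \<gamma> \<epsilon> Fin J \<longrightarrow> z \<epsilon> X \<beta> \<gamma>"
proof -
  have IJ: "prod (Fin I) (Fin J) \<in> wellfounded"
    by (intro wellfounded_prod wellfounded_Fin I J)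
  have "\<exists>z. \<forall>i. i \<epsilon> prod (Fin I) (Fin J) \<longrightarrow> z \<epsilon> X (pfst i) (psnd i)"
  proof (rule saturation_directed[OF IJ])
    show "trm False (\<lambda>\<rho>. X (pfst (\<rho> 0)) (psnd (\<rho> 0)))" by (intro trm2[OF X] dfn_intros)
    show "opair emp emp \<epsilon> prod (Fin I) (Fin J)" by (simp add: Fin_emp I J)
    fix i assume "i \<epsilon> prod (Fin I) (Fin J)"
    then obtain \<beta> \<gamma> where i: "\<beta> \<epsilon> Fin I" "\<gamma> \<epsilon> Fin J" "i = opair \<beta> \<gamma>" unfolding mem_prod by blast
    show "X (pfst i) (psnd i) \<in> internal" using int i by simp
    show "\<exists>z. z \<epsilon> X (pfst i) (psnd i)" using ne i by simp
    fix j assume "j \<epsilon> prod (Fin I) (Fin J)"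
    then obtain \<beta>' \<gamma>' where j: "\<beta>' \<epsilon> Fin I" "\<gamma>' \<epsilon> Fin J" "j = opair \<beta>' \<gamma>'"
      unfolding mem_prod by blast
    have k: "opair (cup \<beta> \<beta>') (cup \<gamma> \<gamma>') \<epsilon> prod (Fin I) (Fin J)"
      using Fin_cup[OF I i(1) j(1)] Fin_cup[OF J i(2) j(2)] by simp
    show "\<exists>k. k \<epsilon> prod (Fin I) (Fin J) \<and>
      (\<forall>z. z \<epsilon> X (pfst k) (psnd k) \<longrightarrow> z \<epsilon> X (pfst i) (psnd i) \<and> z \<epsilon> X (pfst j) (psnd j))"
      unfolding i(3) j(3)
    proof (rule exI, rule conjI[OF k], intro allI impI)
      fix z assume "z \<epsilon> X (pfst (opair (cup \<beta> \<beta>') (cup \<gamma> \<gamma>'))) (psnd (opair (cup \<beta> \<beta>') (cup \<gamma> \<gamma>')))"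
      then show "z \<epsilon> X (pfst (opair \<beta> \<gamma>)) (psnd (opair \<beta> \<gamma>)) \<and>
          z \<epsilon> X (pfst (opair \<beta>' \<gamma>')) (psnd (opair \<beta>' \<gamma>'))"
        unfolding pfst_opair psnd_opair by (rule mono)
    qed
  qed
  then obtain z where z: "\<And>i. i \<epsilon> prod (Fin I) (Fin J) \<Longrightarrow> z \<epsilon> X (pfst i) (psnd i)" by blast
  have "z \<epsilon> X \<beta> \<gamma>" if "\<beta> \<epsilon> Fin I" "\<gamma> \<epsilon> Fin J" for \<beta> \<gamma>
    using z[of "opair \<beta> \<gamma>"] that by simp
  then show ?thesis by blast
qed

subsection \<open>Sets determined by families of internal sets\<close>

definition fam :: "'u \<Rightarrow> 'u \<Rightarrow> ('u \<Rightarrow> 'u \<Rightarrow> 'u) \<Rightarrow> 'u" where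
  "fam A B Y = img (prod A B) (\<lambda>p. opair p (Y (pfst p) (psnd p)))"

lemma internal_family_fam:
  assumes A: "A \<in> wellfounded" and B: "B \<in> wellfounded"
    and Y: "trm False (\<lambda>\<rho>. Y (\<rho> 0) (\<rho> (Suc 0)))"
    and int: "\<And>a b. a \<epsilon> A \<Longrightarrow> b \<epsilon> B \<Longrightarrow> Y a b \<in> internal"
  shows "internal_family (fam A B Y) A B"
    and "(\<exists>V. index_value (fam A B Y) a b V \<and> x \<epsilon> V) \<longleftrightarrow> a \<epsilon> A \<and> b \<epsilon> B \<and> x \<epsilon> Y a b"
proof -
  have "trm False (\<lambda>\<rho>. Y (pfst (\<rho> 0)) (psnd (\<rho> 0)))" by (intro trm2[OF Y] dfn_intros)
  note fam = function_on_img[OF this, where X = "prod A B", folded fam_def]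
  have iv: "index_value (fam A B Y) a b V \<longleftrightarrow> a \<epsilon> A \<and> b \<epsilon> B \<and> V = Y a b" for a b V
    unfolding index_value_def by (auto simp: fam(2))
  show "(\<exists>V. index_value (fam A B Y) a b V \<and> x \<epsilon> V) \<longleftrightarrow> a \<epsilon> A \<and> b \<epsilon> B \<and> x \<epsilon> Y a b"
    by (auto simp: iv)
  have "is_prod (prod A B) A B" unfolding is_prod_def by (simp add: mem_prod)
  then show "internal_family (fam A B Y) A B"
    unfolding internal_family_def using A B fam(1) int by (auto simp: iv)
qed

lemma sigma2ssI:
  assumes "A \<in> wellfounded" "B \<in> wellfounded" "trm False (\<lambda>\<rho>. Y (\<rho> 0) (\<rho> (Suc 0)))"
    "\<And>a b. a \<epsilon> A \<Longrightarrow> b \<epsilon> B \<Longrightarrow> Y a b \<in> internal"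
    and "\<And>x. x \<epsilon> T \<longleftrightarrow> (\<exists>a. a \<epsilon> A \<and> (\<forall>b. b \<epsilon> B \<longrightarrow> x \<epsilon> Y a b))"
  shows "sigma2ss T"
  unfolding sigma2ss_def using internal_family_fam[of A B Y, OF assms(1-4)] assms(5)
  by (intro exI[of _ A] exI[of _ B] exI[of _ "fam A B Y"]) (simp cong: conj_cong)

lemma pi2ssI:
  assumes "A \<in> wellfounded" "B \<in> wellfounded" "trm False (\<lambda>\<rho>. Y (\<rho> 0) (\<rho> (Suc 0)))"
    "\<And>a b. a \<epsilon> A \<Longrightarrow> b \<epsilon> B \<Longrightarrow> Y a b \<in> internal"
    and "\<And>x. x \<epsilon> T \<longleftrightarrow> (\<forall>a. a \<epsilon> A \<longrightarrow> (\<exists>b. b \<epsilon> B \<and> x \<epsilon> Y a b))"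
  shows "pi2ss T"
  unfolding pi2ss_def using internal_family_fam[of A B Y, OF assms(1-4)] assms(5)
  by (intro exI[of _ A] exI[of _ B] exI[of _ "fam A B Y"]) (simp cong: conj_cong)

lemma sigma2ss_family:
  assumes "sigma2ss X"
  obtains A B Y where "A \<in> wellfounded" "B \<in> wellfounded"
    "trm False (\<lambda>\<rho>. Y (\<rho> 0) (\<rho> (Suc 0)))"
    "\<And>a b. a \<epsilon> A \<Longrightarrow> b \<epsilon> B \<Longrightarrow> Y a b \<in> internal"
    "\<And>x. x \<epsilon> X \<longleftrightarrow> (\<exists>a. a \<epsilon> A \<and> (\<forall>b. b \<epsilon> B \<longrightarrow> x \<epsilon> Y a b))"
proof -
  from assms obtain A B F where F: "internal_family F A B"
    and X: "\<And>x. x \<epsilon> X \<longleftrightarrow>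
      (\<exists>a. a \<epsilon> A \<and> (\<forall>b. b \<epsilon> B \<longrightarrow> (\<exists>Z. index_value F a b Z \<and> x \<epsilon> Z)))"
    unfolding sigma2ss_def by blast
  from F obtain D where D: "is_prod D A B" "function_on F D" unfolding internal_family_def by blast
  have iv: "index_value F a b Z \<longleftrightarrow> Z = app F (opair a b)" if "a \<epsilon> A" "b \<epsilon> B" for a b Z
  proof -
    have "opair a b \<epsilon> D" using D(1) that unfolding is_prod_def by auto
    then show ?thesis using app_eq[OF D(2)] unfolding index_value_def by simp
  qed
  show ?thesis
  proof (rule that)
    show "A \<in> wellfounded" "B \<in> wellfounded" using F unfolding internal_family_def by auto
    show "trm False (\<lambda>\<rho>. app F (opair (\<rho> 0) (\<rho> (Suc 0))))" by (intro dfn_intros)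
    show "app F (opair a b) \<in> internal" if "a \<epsilon> A" "b \<epsilon> B" for a b
      using F iv[OF that] unfolding internal_family_def by blast
    show "x \<epsilon> X \<longleftrightarrow> (\<exists>a. a \<epsilon> A \<and> (\<forall>b. b \<epsilon> B \<longrightarrow> x \<epsilon> app F (opair a b)))" for x
      by (simp add: X iv cong: conj_cong)
  qed
qed

lemma join_families:
  assumes I: "I \<in> wellfounded" and X: "trm False (\<lambda>\<rho>. X (\<rho> 0))"
    and int: "\<And>i. i \<epsilon> I \<Longrightarrow> X i \<in> internal"
    and J: "J \<in> wellfounded" and Y: "trm False (\<lambda>\<rho>. Y (\<rho> 0))"
    and int': "\<And>i. i \<epsilon> J \<Longrightarrow> Y i \<in> internal"
  obtains K V where "K \<in> wellfounded" "trm False (\<lambda>\<rho>. V (\<rho> 0))"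
    "\<And>k. k \<epsilon> K \<Longrightarrow> V k \<in> internal"
    "\<And>i. i \<epsilon> I \<Longrightarrow> \<exists>k. k \<epsilon> K \<and> V k = X i" "\<And>i. i \<epsilon> J \<Longrightarrow> \<exists>k. k \<epsilon> K \<and> V k = Y i"
proof -
  \<comment> \<open>\<open>emp\<close> and its singleton tag the two halves of a disjoint union of
    index sets.\<close>
  define o1 where "o1 = upair emp emp"
  have o1: "emp \<noteq> o1" "o1 \<in> wellfounded"
    unfolding o1_def using wellfounded_upair[OF wellfounded_emp wellfounded_emp]
    by (metis mem_emp mem_upair, simp)
  define K where "K = cup (prod (upair emp emp) I) (prod (upair o1 o1) J)"
  define V where "V p = (if pfst p = emp then X (psnd p) else Y (psnd p))" for p
  have V: "V (opair emp i) = X i" "V (opair o1 i) = Y i" for i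
    using o1(1) by (simp_all add: V_def)
  show ?thesis
  proof (rule that)
    show "K \<in> wellfounded"
      unfolding K_def
      by (intro wellfounded_cup wellfounded_prod wellfounded_upair wellfounded_emp o1(2) I J)
    show "trm False (\<lambda>\<rho>. V (\<rho> 0))"
      unfolding V_def by (intro dfn_intros trm1[OF X] trm1[OF Y])
    show "V k \<in> internal" if "k \<epsilon> K" for k
      using that V int int' unfolding K_def by (auto simp: mem_prod)
    show "\<exists>k. k \<epsilon> K \<and> V k = X i" if "i \<epsilon> I" for i
      using that V by (intro exI[of _ "opair emp i"]) (simp add: K_def)
    show "\<exists>k. k \<epsilon> K \<and> V k = Y i" if "i \<epsilon> J" for i
      using that V by (intro exI[of _ "opair o1 i"]) (simp add: K_def)
  qed
qed

text \<open>The type of a point is the set of indices of the \<open>X i\<close> that contain it, an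
  element of the well-founded \<open>pow I\<close>. A point is in \<open>T\<close> iff it agrees
  everywhere with some type realized in \<open>T\<close> (set \<open>W\<close>), and also iff it is
  in \<open>Z\<close> and disagrees somewhere with each other subset of \<open>I\<close> (set
  \<open>W'\<close>). The empty member \<open>X d\<close> makes both index sets large enough for the
  representations to enforce membership in \<open>Z\<close>.\<close>

lemma delta2ss_determined_aux:
  assumes Z: "Z \<in> internal" and T: "subset T Z"
    and I: "I \<in> wellfounded" and X: "trm False (\<lambda>\<rho>. X (\<rho> 0))"
    and int: "\<And>i. i \<epsilon> I \<Longrightarrow> X i \<in> internal"
    and det: "\<And>x y. x \<epsilon> T \<Longrightarrow> y \<epsilon> Z \<Longrightarrow> (\<And>i. i \<epsilon> I \<Longrightarrow> x \<epsilon> X i \<longleftrightarrow> y \<epsilon> X i) \<Longrightarrow> y \<epsilon> T"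
    and d: "d \<epsilon> I" "\<And>x. \<not> x \<epsilon> X d"
  shows "delta2ss T"
proof -
  define ty where "ty x = sep I (\<lambda>i. x \<epsilon> X i)" for x
  have "dfn False (\<lambda>\<rho>. x \<epsilon> X (\<rho> 0))" for x by (intro dfn_intros trm1[OF X])
  then have ty: "i \<epsilon> ty x \<longleftrightarrow> i \<epsilon> I \<and> x \<epsilon> X i" for i x
    unfolding ty_def by (rule mem_sep)
  define W where "W = sep (pow I) (\<lambda>w. \<exists>x. x \<epsilon> T \<and> w = ty x)"
  have "dfn False (\<lambda>\<rho>. \<exists>x. x \<epsilon> T \<and> \<rho> 0 = ty x)"
    unfolding ty_def by (intro dfn_intros trm1[OF X])
  from mem_sep[OF this, of _ "pow I"]
  have W: "w \<epsilon> W \<longleftrightarrow> (\<exists>x. x \<epsilon> T \<and> w = ty x)" for w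
    unfolding W_def by (auto simp: mem_pow[OF I] subset_def ty)
  define W' where "W' = sep (pow I) (\<lambda>w. \<not> w \<epsilon> W)"
  have "dfn False (\<lambda>\<rho>. \<not> \<rho> 0 \<epsilon> W)" by (intro dfn_intros)
  from mem_sep[OF this, of _ "pow I"]
  have W': "w \<epsilon> W' \<longleftrightarrow> subset w I \<and> \<not> w \<epsilon> W" for w
    unfolding W'_def by (simp add: mem_pow[OF I])
  have wf: "W \<in> wellfounded" "W' \<in> wellfounded"
    by (rule wellfounded_subset[OF wellfounded_pow[OF I]],
        auto simp: subset_def W W' mem_pow[OF I] ty)+
  \<comment> \<open>\<open>Y True w i\<close> collects the points of \<open>Z\<close> that agree
    with \<open>w\<close> at \<open>i\<close>, \<open>Y False w i\<close> those that
    disagree.\<close>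
  define Y where "Y b w i = sep Z (\<lambda>x. (x \<epsilon> X i \<longleftrightarrow> i \<epsilon> w) = b)" for b :: bool and w i
  have tY: "trm False (\<lambda>\<rho>. Y b (\<rho> 0) (\<rho> (Suc 0)))" for b
    unfolding Y_def by (intro dfn_intros trm1[OF X])
  have dY: "dfn False (\<lambda>\<rho>. (\<rho> 0 \<epsilon> X i \<longleftrightarrow> i \<epsilon> w) = b)" for b i w
    by (intro dfn_intros)
  have Y: "x \<epsilon> Y b w i \<longleftrightarrow> x \<epsilon> Z \<and> (x \<epsilon> X i \<longleftrightarrow> i \<epsilon> w) = b" for x b w i
    unfolding Y_def by (rule mem_sep[OF dY])
  have intY: "Y b w i \<in> internal" if "i \<epsilon> I" for b w i
    unfolding Y_def using int[OF that] by (intro sep_internal Z dfn_intros) simp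
  have same: "y \<epsilon> T" if "x \<epsilon> T" "y \<epsilon> Z" "ty y = ty x" for x y
    using that ty by (intro det[of x y]) (metis)+
  have TZ: "x \<epsilon> Z" if "x \<epsilon> T" for x using that T unfolding subset_def by blast
  have "sigma2ss T"
  proof (rule sigma2ssI[where Y = "Y True", OF wf(1) I tY])
    show "Y True w i \<in> internal" if "i \<epsilon> I" for w i by (rule intY[OF that])
    fix x
    show "x \<epsilon> T \<longleftrightarrow> (\<exists>w. w \<epsilon> W \<and> (\<forall>i. i \<epsilon> I \<longrightarrow> x \<epsilon> Y True w i))"
    proof
      assume x: "x \<epsilon> T"
      then show "\<exists>w. w \<epsilon> W \<and> (\<forall>i. i \<epsilon> I \<longrightarrow> x \<epsilon> Y True w i)"
        using TZ by (intro exI[of _ "ty x"]) (auto simp: Y W ty)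
    next
      assume "\<exists>w. w \<epsilon> W \<and> (\<forall>i. i \<epsilon> I \<longrightarrow> x \<epsilon> Y True w i)"
      then obtain w where "w \<epsilon> W" and *: "\<forall>i. i \<epsilon> I \<longrightarrow> x \<epsilon> Y True w i" by (elim exE conjE)
      then obtain y where y: "y \<epsilon> T" "w = ty y" unfolding W by blast
      have w: "x \<epsilon> Z \<and> (x \<epsilon> X i \<longleftrightarrow> i \<epsilon> w)" if "i \<epsilon> I" for i
        using *[rule_format, OF that] by (simp add: Y)
      show "x \<epsilon> T"
      proof (rule det[OF y(1)])
        show "x \<epsilon> Z" using w[OF d(1)] by simp
        show "y \<epsilon> X i \<longleftrightarrow> x \<epsilon> X i" if "i \<epsilon> I" for i
          using w[OF that] that by (simp add: y(2) ty)
      qed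
    qed
  qed
  moreover have "pi2ss T"
  proof (rule pi2ssI[where Y = "Y False", OF wf(2) I tY])
    show "Y False w i \<in> internal" if "i \<epsilon> I" for w i by (rule intY[OF that])
    fix x
    show "x \<epsilon> T \<longleftrightarrow> (\<forall>w. w \<epsilon> W' \<longrightarrow> (\<exists>i. i \<epsilon> I \<and> x \<epsilon> Y False w i))"
    proof (intro iffI allI impI)
      fix w assume x: "x \<epsilon> T" and w: "w \<epsilon> W'"
      then have "ty x \<noteq> w" unfolding W' W by blast
      then obtain i where "\<not> (i \<epsilon> ty x \<longleftrightarrow> i \<epsilon> w)" using set_ext[of "ty x" w] by blast
      then have "i \<epsilon> I" "(x \<epsilon> X i \<longleftrightarrow> i \<epsilon> w) = False"
        using w unfolding ty W' subset_def by blast+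
      then show "\<exists>i. i \<epsilon> I \<and> x \<epsilon> Y False w i" using TZ[OF x] by (auto simp: Y)
    next
      assume "\<forall>w. w \<epsilon> W' \<longrightarrow> (\<exists>i. i \<epsilon> I \<and> x \<epsilon> Y False w i)"
      then have *: "\<exists>i. i \<epsilon> I \<and> x \<epsilon> Z \<and> (x \<epsilon> X i \<longleftrightarrow> i \<epsilon> w) = False" if "w \<epsilon> W'" for w
        using that unfolding Y by blast
      \<comment> \<open>No point has a type containing \<open>d\<close>, so the singleton of
        \<open>d\<close> is in \<open>W'\<close>. The condition for this one index already forces
        \<open>x\<close> into \<open>Z\<close>.\<close>
      have "upair d d \<epsilon> W'"
        unfolding W' W using d by (auto simp: subset_def) (metis mem_upair ty)
      then have xZ: "x \<epsilon> Z" using * by blast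
      show "x \<epsilon> T"
      proof (rule ccontr)
        assume "\<not> x \<epsilon> T"
        then have "\<not> ty x \<epsilon> W" using same xZ unfolding W by blast
        then have "ty x \<epsilon> W'" unfolding W' by (simp add: subset_def ty)
        then show False using * ty by blast
      qed
    qed
  qed
  moreover have "x \<in> internal" if "x \<epsilon> T" for x
    using internal_transitive[OF Z TZ[OF that]] .
  ultimately show ?thesis unfolding delta2ss_def by blast
qed

text \<open>Two families are joined, and then a family with the single value \<open>emp\<close> is
  added to supply the index \<open>d\<close> of the previous lemma.\<close>

lemma delta2ss_determined:
  assumes Z: "Z \<in> internal" and T: "subset T Z"
    and I: "I \<in> wellfounded" and X: "trm False (\<lambda>\<rho>. X (\<rho> 0))"
    and int: "\<And>i. i \<epsilon> I \<Longrightarrow> X i \<in> internal"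
    and J: "J \<in> wellfounded" and Y: "trm False (\<lambda>\<rho>. Y (\<rho> 0))"
    and int': "\<And>i. i \<epsilon> J \<Longrightarrow> Y i \<in> internal"
    and det: "\<And>x y. x \<epsilon> T \<Longrightarrow> y \<epsilon> Z \<Longrightarrow> (\<And>i. i \<epsilon> I \<Longrightarrow> x \<epsilon> X i \<longleftrightarrow> y \<epsilon> X i) \<Longrightarrow>
      (\<And>i. i \<epsilon> J \<Longrightarrow> x \<epsilon> Y i \<longleftrightarrow> y \<epsilon> Y i) \<Longrightarrow> y \<epsilon> T"
  shows "delta2ss T"
proof -
  obtain K V where K: "K \<in> wellfounded" "trm False (\<lambda>\<rho>. V (\<rho> 0))" "\<And>k. k \<epsilon> K \<Longrightarrow> V k \<in> internal"
    "\<And>i. i \<epsilon> I \<Longrightarrow> \<exists>k. k \<epsilon> K \<and> V k = X i" "\<And>i. i \<epsilon> J \<Longrightarrow> \<exists>k. k \<epsilon> K \<and> V k = Y i"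
    by (rule join_families[OF I X _ J Y]) (erule int, erule int', rule that)
  have dummy: "upair emp emp \<in> wellfounded" "trm False (\<lambda>\<rho>. emp)"
    by (intro wellfounded_upair wellfounded_emp dfn_intros)+
  obtain K' V' where
    K': "K' \<in> wellfounded" "trm False (\<lambda>\<rho>. V' (\<rho> 0))" "\<And>k. k \<epsilon> K' \<Longrightarrow> V' k \<in> internal"
    "\<And>i. i \<epsilon> K \<Longrightarrow> \<exists>k. k \<epsilon> K' \<and> V' k = V i"
    "\<And>i. i \<epsilon> upair emp emp \<Longrightarrow> \<exists>k. k \<epsilon> K' \<and> V' k = emp"
    by (rule join_families[OF K(1,2) _ dummy]) (erule K(3), rule emp_internal, rule that)
  have "\<exists>k. k \<epsilon> K' \<and> V' k = emp" by (rule K'(5)) simp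
  then obtain d where d: "d \<epsilon> K'" "V' d = emp" by (elim exE conjE)
  show ?thesis
  proof (rule delta2ss_determined_aux[OF Z T K'(1,2) _ _ d(1)])
    fix x y assume xy: "x \<epsilon> T" "y \<epsilon> Z" and *: "\<And>i. i \<epsilon> K' \<Longrightarrow> x \<epsilon> V' i \<longleftrightarrow> y \<epsilon> V' i"
    have V: "x \<epsilon> V k \<longleftrightarrow> y \<epsilon> V k" if k: "k \<epsilon> K" for k
    proof -
      obtain k' where "k' \<epsilon> K'" "V' k' = V k" using K'(4)[OF k] by (elim exE conjE)
      then show ?thesis using *[of k'] by simp
    qed
    show "y \<epsilon> T"
    proof (rule det[OF xy])
      fix i assume i: "i \<epsilon> I"
      obtain k where "k \<epsilon> K" "V k = X i" using K(4)[OF i] by (elim exE conjE)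
      then show "x \<epsilon> X i \<longleftrightarrow> y \<epsilon> X i" using V[of k] by simp
    next
      fix i assume i: "i \<epsilon> J"
      obtain k where "k \<epsilon> K" "V k = Y i" using K(5)[OF i] by (elim exE conjE)
      then show "x \<epsilon> Y i \<longleftrightarrow> y \<epsilon> Y i" using V[of k] by simp
    qed
  next
    show "V' k \<in> internal" if "k \<epsilon> K'" for k by (rule K'(3)[OF that])
    show "\<not> x \<epsilon> V' d" for x by (simp add: d(2))
  qed
qed

subsection \<open>An infinite well-founded set of internal elements\<close>

text \<open>The supply of colours. \<open>D\<close> consists of the well-founded transitive members
  of an internal inductive set: being well-founded, it may index families, and its finite subsets
  are internal because its elements are. It is not finite, since a finite subset has an element
  belonging to no other, whose successor is then missing.\<close>

lemma infinite_set:
  obtains \<Omega> D where "\<Omega> \<in> internal" "subset D \<Omega>" "D \<in> wellfounded"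
    "\<And>K. K \<epsilon> Fin D \<Longrightarrow> \<exists>p. p \<epsilon> D \<and> \<not> p \<epsilon> K"
proof -
  from internal_infinity[unfolded infinity_ax_def] obtain \<Omega> where
    \<Omega>: "\<Omega> \<in> internal" "inductive_in internal \<Omega>" by (elim bexE)
  from \<Omega>(2)[unfolded inductive_in_def, THEN conjunct1] obtain e where
    e: "e \<in> internal" "e \<epsilon> \<Omega>" "\<forall>z\<in>internal. \<not> z \<epsilon> e" by (elim bexE conjE)
  have "\<not> z \<epsilon> e" for z using e(3) internal_transitive[OF e(1), of z] by blast
  then have "e = emp" by (intro set_ext) simp
  then have emp\<Omega>: "emp \<epsilon> \<Omega>" using e by simp
  have succ: "ins x x \<epsilon> \<Omega>" if "x \<epsilon> \<Omega>" for x
  proof -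
    have x: "x \<in> internal" using internal_transitive[OF \<Omega>(1) that] .
    from \<Omega>(2)[unfolded inductive_in_def, THEN conjunct2, rule_format, OF x that] obtain y where
      y: "y \<in> internal" "y \<epsilon> \<Omega>" "\<forall>z\<in>internal. z \<epsilon> y \<longleftrightarrow> z \<epsilon> x \<or> z = x" by (elim bexE conjE)
    have "z \<epsilon> y \<longleftrightarrow> z \<epsilon> ins x x" for z
      using y(3) internal_transitive[OF y(1), of z] internal_transitive[OF x, of z] x
      unfolding mem_ins by blast
    then have "y = ins x x" by (rule set_ext)
    then show ?thesis using y(2) by simp
  qed
  have "dfn False (\<lambda>\<rho>. \<rho> 0 \<in> wellfounded \<and> transitive (\<rho> 0))" by (intro dfn_intros)
  note sep = mem_sep[OF this, of _ \<Omega>]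
  define D where "D = sep \<Omega> (\<lambda>n. n \<in> wellfounded \<and> transitive n)"
  have D: "n \<epsilon> D \<longleftrightarrow> n \<epsilon> \<Omega> \<and> n \<in> wellfounded \<and> transitive n" for n
    unfolding D_def by (rule sep)
  have wfD: "D \<in> wellfounded" by (rule wellfounded_set) (simp add: D)
  have empD: "emp \<epsilon> D" by (simp add: D emp\<Omega> wellfounded_emp transitive_def)
  have succD: "ins n n \<epsilon> D" if "n \<epsilon> D" for n
    using that succ[of n] wellfounded_ins[of n n] by (auto simp: D transitive_def subset_def)
  \<comment> \<open>A maximal element with respect to membership. When \<open>b\<close> is inserted,
    the old \<open>m\<close> survives unless it belongs to \<open>b\<close>; then \<open>b\<close>
    takes over, as members of \<open>D\<close> are transitive.\<close>
  let ?P = "\<lambda>K. nonempty K \<longrightarrow> (\<exists>m. m \<epsilon> K \<and> (\<forall>k. k \<epsilon> K \<longrightarrow> \<not> m \<epsilon> k))"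
  have "?P K" if K: "K \<epsilon> Fin D" for K
  proof (rule Fin_induct[where P = ?P, OF wfD K])
    show "dfn False (\<lambda>\<rho>. ?P (\<rho> 0))" by (intro dfn_intros)
    show "?P emp" by (simp add: nonempty_def)
    fix b K assume KD: "K \<epsilon> Fin D" and b: "b \<epsilon> D" and IH: "?P K"
    have "\<not> b \<epsilon> b" using b wellfounded_irrefl by (simp add: D)
    show "?P (ins b K)"
    proof (cases "nonempty K")
      case False
      then show ?thesis using \<open>\<not> b \<epsilon> b\<close> by (auto simp: nonempty_def)
    next
      case True
      then obtain m where m: "m \<epsilon> K" "\<And>k. k \<epsilon> K \<Longrightarrow> \<not> m \<epsilon> k" using IH by blast
      show ?thesis
      proof (cases "m \<epsilon> b")
        case False
        then show ?thesis using m by auto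
      next
        case True
        have "\<not> b \<epsilon> k" if "k \<epsilon> K" for k
        proof
          assume "b \<epsilon> k"
          moreover have "transitive k" using Fin_subset[OF wfD KD that] by (simp add: D)
          ultimately have "m \<epsilon> k" using True unfolding transitive_def subset_def by blast
          then show False using m(2)[OF that] by simp
        qed
        then show ?thesis using \<open>\<not> b \<epsilon> b\<close> by (intro impI exI[of _ b]) auto
      qed
    qed
  qed
  note max = this
  have "\<exists>p. p \<epsilon> D \<and> \<not> p \<epsilon> K" if K: "K \<epsilon> Fin D" for K
  proof (cases "nonempty K")
    case True
    then obtain m where m: "m \<epsilon> K" "\<And>k. k \<epsilon> K \<Longrightarrow> \<not> m \<epsilon> k"
      using max[OF K] by blast
    then have "ins m m \<epsilon> D" using succD Fin_subset[OF wfD K m(1)] by blast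
    moreover have "\<not> ins m m \<epsilon> K" using m(2)[of "ins m m"] by auto
    ultimately show ?thesis by blast
  next
    case False
    then show ?thesis using empD unfolding nonempty_def by blast
  qed
  moreover have "subset D \<Omega>" by (simp add: subset_def D)
  ultimately show ?thesis using that \<Omega>(1) wfD by blast
qed

subsection \<open>Zorn's lemma for internal sets\<close>

definition chain :: "'u \<Rightarrow> bool" where
  "chain L \<longleftrightarrow> (\<forall>C. C \<epsilon> L \<longrightarrow> (\<forall>D. D \<epsilon> L \<longrightarrow> subset C D \<or> subset D C))"

lemma dfn_chain [dfn_intros]: "trm i t \<Longrightarrow> dfn i (\<lambda>\<rho>. chain (t \<rho>))"
  by (rule dfn1[where R = chain]) (unfold chain_def, intro dfn_intros)

text \<open>The axiom of choice wants disjoint sets. Pairing each candidate with \<open>C\<close>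
  itself makes the candidate sets \<open>B C\<close> disjoint, and a choice set for them is a choice
  relation.\<close>

lemma internal_choice_relation:
  assumes S: "S \<in> internal" and Z: "Z \<in> internal"
    and Q: "dfn True (\<lambda>\<rho>. Q (\<rho> 0) (\<rho> (Suc 0)))"
    and ex: "\<And>C. C \<epsilon> S \<Longrightarrow> \<exists>p. p \<epsilon> Z \<and> Q C p"
  obtains c where "c \<in> internal"
    "\<And>C. C \<epsilon> S \<Longrightarrow> \<exists>!p. p \<epsilon> Z \<and> Q C p \<and> opair C p \<epsilon> c"
proof -
  define B where "B C = sep (prod S Z) (\<lambda>q. \<exists>p. p \<epsilon> Z \<and> q = opair C p \<and> Q C p)" for C
  have SZ: "prod S Z \<in> internal" by (rule prod_internal[OF S Z])
  have "dfn True (\<lambda>\<rho>. \<exists>p. p \<epsilon> Z \<and> \<rho> 0 = opair C p \<and> Q C p)" if "C \<epsilon> S" for C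
    using internal_transitive[OF S that] Z by (intro dfn_intros dfn2[OF Q]) simp_all
  note dB = this
  have B: "opair D p \<epsilon> B C \<longleftrightarrow> D = C \<and> p \<epsilon> Z \<and> Q C p" if "C \<epsilon> S" for C D p
    using that unfolding B_def by (auto simp: mem_sep_internal[OF dB[OF that] SZ])
  have Bpair: "\<exists>p. q = opair C p" if "C \<epsilon> S" "q \<epsilon> B C" for C q
    using that unfolding B_def by (auto simp: mem_sep_internal[OF dB[OF that(1)] SZ])
  have Bint: "B C \<in> internal" if "C \<epsilon> S" for C
    unfolding B_def by (rule sep_internal[OF dB[OF that] SZ])
  have Bsub: "subset (B C) (prod S Z)" if "C \<epsilon> S" for C
    using that unfolding B_def subset_def by (simp add: mem_sep_internal[OF dB[OF that] SZ])
  have "trm True (\<lambda>\<rho>. B (\<rho> 0))"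
    unfolding B_def using SZ Z by (intro dfn_intros dfn2[OF Q]) simp_all
  note tB = trm1[OF this]
  have "dfn True (\<lambda>\<rho>. \<exists>C. C \<epsilon> S \<and> \<rho> 0 = B C)"
    using S by (intro dfn_intros tB) simp_all
  note F = mem_sep_internal[OF this ipow_internal[OF SZ]]
    and Fint = sep_internal[OF this ipow_internal[OF SZ]]
  define F where "F = sep (ipow (prod S Z)) (\<lambda>f. \<exists>C. C \<epsilon> S \<and> f = B C)"
  have F: "f \<epsilon> F \<longleftrightarrow> (\<exists>C. C \<epsilon> S \<and> f = B C)" for f
    unfolding F_def F using Bint Bsub by (auto simp: mem_ipow[OF SZ])
  have Fint: "F \<in> internal" unfolding F_def by (rule Fint)
  have disj: "B C = B D" if "C \<epsilon> S" "D \<epsilon> S" "z \<epsilon> B C" "z \<epsilon> B D" for C D z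
    using Bpair[OF that(1,3)] Bpair[OF that(2,4)] by auto
  have "\<exists>c\<in>internal. \<forall>y\<in>internal. y \<epsilon> F \<longrightarrow> (\<exists>!z. z \<in> internal \<and> z \<epsilon> y \<and> z \<epsilon> c)"
  proof (rule internal_choice[unfolded choice_ax_def, rule_format, OF Fint], intro conjI ballI impI)
    fix y assume "y \<epsilon> F"
    then obtain C where C: "C \<epsilon> S" "y = B C" unfolding F by (elim exE conjE)
    then obtain p where "opair C p \<epsilon> B C" using ex[OF C(1)] B[OF C(1)] by blast
    then show "\<exists>z\<in>internal. z \<epsilon> y" using internal_transitive[OF Bint[OF C(1)]] C(2) by blast
  next
    fix y y' assume *: "y \<epsilon> F \<and> y' \<epsilon> F \<and> (\<exists>z\<in>internal. z \<epsilon> y \<and> z \<epsilon> y')"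
    then obtain C D where "C \<epsilon> S" "y = B C" "D \<epsilon> S" "y' = B D" unfolding F by (elim exE conjE)
    then show "y = y'" using * disj by blast
  qed
  then obtain c where c: "c \<in> internal"
    "\<forall>y\<in>internal. y \<epsilon> F \<longrightarrow> (\<exists>!z. z \<in> internal \<and> z \<epsilon> y \<and> z \<epsilon> c)" by (elim bexE)
  show ?thesis
  proof (rule that[OF c(1)])
    fix C assume C: "C \<epsilon> S"
    have "B C \<epsilon> F" using C unfolding F by blast
    then obtain z where z: "z \<epsilon> B C" "z \<epsilon> c"
      "\<And>z'. z' \<in> internal \<Longrightarrow> z' \<epsilon> B C \<Longrightarrow> z' \<epsilon> c \<Longrightarrow> z' = z"
      using c(2)[rule_format, OF Bint[OF C]] by blast
    obtain p where p: "z = opair C p" using Bpair[OF C z(1)] by blast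
    show "\<exists>!p. p \<epsilon> Z \<and> Q C p \<and> opair C p \<epsilon> c"
    proof (rule ex1I)
      show "p \<epsilon> Z \<and> Q C p \<and> opair C p \<epsilon> c" using z p B[OF C] by blast
      fix p' assume "p' \<epsilon> Z \<and> Q C p' \<and> opair C p' \<epsilon> c"
      then have "opair C p' \<epsilon> B C" "opair C p' \<epsilon> c" using B[OF C] by blast+
      then have "opair C p' = z" using z(3) internal_transitive[OF Bint[OF C]] by blast
      then show "p' = p" using p by simp
    qed
  qed
qed

text \<open>If no member of the family were maximal, an internal choice of proper one-point extensions
  would generate a tower: the least subfamily closed under these extensions and under unions of
  chains. As in the Bourbaki--Witt theorem, the tower is a chain, so its union contradicts the
  choice of its own extension.\<close>

lemma internal_zorn:
  assumes S: "S \<in> internal" and Z: "Z \<in> internal"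
    and chains: "\<And>L. L \<in> internal \<Longrightarrow> subset L S \<Longrightarrow> chain L \<Longrightarrow> bigU L \<epsilon> S"
  shows "\<exists>C. C \<epsilon> S \<and> (\<forall>p. p \<epsilon> Z \<longrightarrow> ins p C \<epsilon> S \<longrightarrow> p \<epsilon> C)"
proof (rule ccontr)
  assume "\<not> ?thesis"
  then have ext: "\<exists>p. p \<epsilon> Z \<and> (\<not> p \<epsilon> C \<and> ins p C \<epsilon> S)" if "C \<epsilon> S" for C using that by blast
  have Q: "dfn True (\<lambda>\<rho>. \<not> \<rho> (Suc 0) \<epsilon> \<rho> 0 \<and> ins (\<rho> (Suc 0)) (\<rho> 0) \<epsilon> S)"
    using S by (intro dfn_intros) simp_all
  obtain c where c: "c \<in> internal"
    "\<And>C. C \<epsilon> S \<Longrightarrow> \<exists>!p. p \<epsilon> Z \<and> (\<not> p \<epsilon> C \<and> ins p C \<epsilon> S) \<and> opair C p \<epsilon> c"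
    by (rule internal_choice_relation[where Q = "\<lambda>C p. \<not> p \<epsilon> C \<and> ins p C \<epsilon> S", OF S Z Q])
      (rule ext, assumption, rule that)
  \<comment> \<open>\<open>N C p\<close> says that \<open>p\<close> is the new point selected for
    \<open>C\<close>. Unlike \<open>pick\<close>, it is visibly st-free, so it replaces
    \<open>pick\<close> wherever definability is at stake; \<open>all_pick\<close>
    translates.\<close>
  define N where "N C p \<longleftrightarrow> (\<not> p \<epsilon> C \<and> ins p C \<epsilon> S) \<and> opair C p \<epsilon> c" for C p
  have dN: "trm True s \<Longrightarrow> trm True t \<Longrightarrow> dfn True (\<lambda>\<rho>. N (s \<rho>) (t \<rho>))" for s t
    unfolding N_def using S c(1) by (intro dfn_intros) simp_all
  define pick where "pick C = (THE p. p \<epsilon> Z \<and> N C p)" for C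
  have pick: "p \<epsilon> Z \<and> N C p \<longleftrightarrow> p = pick C" if "C \<epsilon> S" for C p
  proof -
    have ex1: "\<exists>!p. p \<epsilon> Z \<and> N C p" unfolding N_def by (rule c(2)[OF that])
    show ?thesis
      using theI'[OF ex1, folded pick_def] ex1 by blast
  qed
  define g where "g C = ins (pick C) C" for C
  have all_pick: "(\<forall>p. p \<epsilon> Z \<longrightarrow> N C p \<longrightarrow> P (ins p C)) \<longleftrightarrow> P (g C)" if "C \<epsilon> S" for C P
    unfolding g_def imp_conjL[symmetric] pick[OF that] by simp
  have gS: "g C \<epsilon> S" and pick_new: "\<not> pick C \<epsilon> C" if "C \<epsilon> S" for C
    using pick[OF that, of "pick C"] unfolding N_def g_def by auto
  have sub_g: "subset C (g C)" for C unfolding g_def subset_def by simp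
  \<comment> \<open>Admissibility must itself be internal to define the tower by separation.
    Therefore the extension is described through \<open>N\<close>, and chains are taken from
    \<open>ipow S\<close>.\<close>
  define adm where "adm A \<longleftrightarrow> (\<forall>C. C \<epsilon> A \<longrightarrow> (\<forall>p. p \<epsilon> Z \<longrightarrow> N C p \<longrightarrow> ins p C \<epsilon> A)) \<and>
    (\<forall>L. L \<epsilon> ipow S \<longrightarrow> subset L A \<longrightarrow> chain L \<longrightarrow> bigU L \<epsilon> A)" for A
  have PS: "ipow S \<in> internal" by (rule ipow_internal[OF S])
  have dadm: "trm True t \<Longrightarrow> dfn True (\<lambda>\<rho>. adm (t \<rho>))" for t
    by (rule dfn1[where R = adm]) (unfold adm_def, use S Z PS in \<open>intro dfn_intros dN; simp\<close>)
  have "dfn True (\<lambda>\<rho>. \<forall>A. A \<epsilon> ipow S \<longrightarrow> adm A \<longrightarrow> \<rho> 0 \<epsilon> A)"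
    using PS by (intro dfn_intros dadm) simp
  note memT = mem_sep_internal[OF this S] and intT = sep_internal[OF this S]
  define T where "T = sep S (\<lambda>C. \<forall>A. A \<epsilon> ipow S \<longrightarrow> adm A \<longrightarrow> C \<epsilon> A)"
  have T: "C \<epsilon> T \<longleftrightarrow> C \<epsilon> S \<and> (\<forall>A. A \<epsilon> ipow S \<longrightarrow> adm A \<longrightarrow> C \<epsilon> A)" for C
    unfolding T_def by (rule memT)
  have Tint: "T \<in> internal" unfolding T_def by (rule intT)
  have TS: "C \<epsilon> S" if "C \<epsilon> T" for C using that unfolding T by blast
  have gT: "g C \<epsilon> T" if C: "C \<epsilon> T" for C
    unfolding T
  proof (intro conjI allI impI)
    show "g C \<epsilon> S" by (rule gS[OF TS[OF C]])
    fix A assume A: "A \<epsilon> ipow S" "adm A"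
    then have "C \<epsilon> A" using C unfolding T by blast
    then have "\<forall>p. p \<epsilon> Z \<longrightarrow> N C p \<longrightarrow> ins p C \<epsilon> A" using A(2) unfolding adm_def by blast
    then show "g C \<epsilon> A" unfolding all_pick[OF TS[OF C], of "\<lambda>D. D \<epsilon> A"] .
  qed
  have UT: "bigU L \<epsilon> T" if L: "L \<in> internal" "subset L T" "chain L" for L
    unfolding T
  proof (intro conjI allI impI)
    have LS: "subset L S" using L(2) TS unfolding subset_def by blast
    show "bigU L \<epsilon> S" by (rule chains[OF L(1) LS L(3)])
    fix A assume A: "A \<epsilon> ipow S" "adm A"
    then have "subset L A" using L(2) unfolding T subset_def by blast
    then show "bigU L \<epsilon> A"
      using A(2) L(1,3) LS unfolding adm_def mem_ipow[OF S] by blast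
  qed
  \<comment> \<open>Tower induction works only for st-free properties with internal parameters: the
    subfamily satisfying \<open>P\<close> has to be one of the internal families over which the
    tower is the intersection.\<close>
  have T_induct: "P C" if P: "dfn True (\<lambda>\<rho>. P (\<rho> 0))"
    and step: "\<And>C. C \<epsilon> T \<Longrightarrow> P C \<Longrightarrow> P (g C)"
    and lim: "\<And>L. L \<in> internal \<Longrightarrow> subset L T \<Longrightarrow> chain L \<Longrightarrow> (\<And>C. C \<epsilon> L \<Longrightarrow> P C) \<Longrightarrow> P (bigU L)"
    and C: "C \<epsilon> T" for P C
  proof -
    note A = mem_sep_internal[OF P Tint] and Aint = sep_internal[OF P Tint]
    have "sep T P \<epsilon> ipow S" using Aint TS by (auto simp: mem_ipow[OF S] subset_def A)
    moreover have "adm (sep T P)"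
      unfolding adm_def
    proof (intro conjI allI impI)
      fix D p assume D: "D \<epsilon> sep T P" and p: "p \<epsilon> Z" "N D p"
      have DT: "D \<epsilon> T" using D A by blast
      then have "p = pick D" using pick[OF TS[OF DT], of p] p by simp
      then have "ins p D = g D" unfolding g_def by simp
      then show "ins p D \<epsilon> sep T P" using step gT D A by auto
    next
      fix L assume L: "L \<epsilon> ipow S" "subset L (sep T P)" "chain L"
      have "subset L T" "\<And>C. C \<epsilon> L \<Longrightarrow> P C" using L(2) A unfolding subset_def by blast+
      moreover have "L \<in> internal" using L(1) unfolding mem_ipow[OF S] by blast
      ultimately show "bigU L \<epsilon> sep T P" unfolding A using L(3) UT lim by blast
    qed
    ultimately have "C \<epsilon> sep T P" using C unfolding T by blast
    then show ?thesis unfolding A by blast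
  qed
  \<comment> \<open>The extreme members of the Bourbaki-Witt argument, again phrased with
    \<open>N\<close>: any tower member strictly below \<open>C\<close> has its one-point extension
    still below \<open>C\<close>.\<close>
  define xtr where "xtr C \<longleftrightarrow> (\<forall>D. D \<epsilon> T \<longrightarrow> subset D C \<longrightarrow> D \<noteq> C \<longrightarrow>
    (\<forall>p. p \<epsilon> Z \<longrightarrow> N D p \<longrightarrow> subset (ins p D) C))" for C
  have dxtr: "dfn True (\<lambda>\<rho>. xtr (\<rho> 0))"
    unfolding xtr_def using Tint Z by (intro dfn_intros dN) simp_all
  have xtr: "xtr C \<longleftrightarrow> (\<forall>D. D \<epsilon> T \<longrightarrow> subset D C \<longrightarrow> D \<noteq> C \<longrightarrow> subset (g D) C)" for C
    unfolding xtr_def using all_pick[OF TS, of _ "\<lambda>D. subset D C"] by blast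
  have sub_trans: "subset A B \<Longrightarrow> subset B C \<Longrightarrow> subset A C" for A B C
    unfolding subset_def by blast
  have sub_antisym: "subset A B \<Longrightarrow> subset B A \<Longrightarrow> A = B" for A B
    unfolding subset_def by (rule set_ext) blast
  have sub_refl: "subset A A" for A unfolding subset_def by blast
  have compar: "subset D C \<or> subset (g C) D" if C: "C \<epsilon> T" "xtr C" and D: "D \<epsilon> T" for C D
  proof (rule T_induct[where P = "\<lambda>D. subset D C \<or> subset (g C) D", OF _ _ _ D])
    have "C \<in> internal" "g C \<in> internal"
      using internal_transitive[OF Tint] C(1) gT by blast+
    then show "dfn True (\<lambda>\<rho>. subset (\<rho> 0) C \<or> subset (g C) (\<rho> 0))"
      by (intro dfn_intros) simp_all
    fix D assume D: "D \<epsilon> T" "subset D C \<or> subset (g C) D"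
    show "subset (g D) C \<or> subset (g C) (g D)"
    proof (cases "D = C")
      case True
      then show ?thesis using sub_refl by blast
    next
      case False
      then show ?thesis using D C(2)[unfolded xtr] sub_trans sub_g by blast
    qed
  next
    fix L assume L: "\<And>D. D \<epsilon> L \<Longrightarrow> subset D C \<or> subset (g C) D"
    show "subset (bigU L) C \<or> subset (g C) (bigU L)"
    proof (cases "\<exists>D. D \<epsilon> L \<and> subset (g C) D")
      case True
      then show ?thesis unfolding subset_def by auto
    next
      case False
      then have "subset D C" if "D \<epsilon> L" for D using L[OF that] that by blast
      then show ?thesis unfolding subset_def by auto
    qed
  qed
  have all_xtr: "xtr C" if C: "C \<epsilon> T" for C
  proof (rule T_induct[OF dxtr _ _ C])
    fix C assume C: "C \<epsilon> T" "xtr C"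
    show "xtr (g C)"
      unfolding xtr
    proof (intro allI impI)
      fix D assume D: "D \<epsilon> T" "subset D (g C)" "D \<noteq> g C"
      have "subset D C" using compar[OF C D(1)] D(2,3) sub_antisym by blast
      then show "subset (g D) (g C)"
        using C(2)[unfolded xtr] D(1) sub_refl sub_trans sub_g by (cases "D = C") blast+
    qed
  next
    fix L assume L: "subset L T" "\<And>C. C \<epsilon> L \<Longrightarrow> xtr C"
    show "xtr (bigU L)"
      unfolding xtr
    proof (intro allI impI)
      fix D assume D: "D \<epsilon> T" "subset D (bigU L)" "D \<noteq> bigU L"
      have "\<exists>C. C \<epsilon> L \<and> \<not> subset C D"
      proof (rule ccontr)
        assume "\<not> ?thesis"
        then have "subset (bigU L) D" unfolding subset_def by auto
        then show False using D(2,3) sub_antisym by blast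
      qed
      then obtain C where C: "C \<epsilon> L" "\<not> subset C D" by blast
      have CT: "C \<epsilon> T" using C(1) L(1) unfolding subset_def by blast
      have "subset D C" using compar[OF CT L(2)[OF C(1)] D(1)] C(2) sub_g sub_trans by blast
      moreover have "D \<noteq> C" using C(2) sub_refl by blast
      ultimately have "subset (g D) C" using L(2)[OF C(1)] D(1) unfolding xtr by blast
      then show "subset (g D) (bigU L)" using C(1) unfolding subset_def by auto
    qed
  qed
  have "chain T"
    unfolding chain_def using compar all_xtr sub_trans sub_g by blast
  then have "bigU T \<epsilon> T" by (intro UT Tint sub_refl)
  then have "g (bigU T) \<epsilon> T" "\<not> pick (bigU T) \<epsilon> bigU T" using gT pick_new TS by blast+
  moreover have "pick (bigU T) \<epsilon> g (bigU T)" unfolding g_def by simp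
  ultimately show False unfolding mem_bigU by blast
qed

subsection \<open>Colouring internal graphs\<close>

definition functional :: "'u \<Rightarrow> bool" where
  "functional R \<longleftrightarrow> (\<forall>y k k'. opair y k \<epsilon> R \<longrightarrow> opair y k' \<epsilon> R \<longrightarrow> k = k')"

text \<open>A maximal partial colouring is total: it induces a partial function from the neighbours of
  an uncoloured vertex to the colours, and a colour omitted by this function is still available.\<close>

lemma internal_colouring:
  assumes H: "H \<in> internal" and K: "K \<in> internal" and G: "G \<in> internal"
    and sym: "\<And>x y. opair x y \<epsilon> G \<Longrightarrow> opair y x \<epsilon> G"
    and irrefl: "\<And>x. \<not> opair x x \<epsilon> G"
    and no_surj: "\<And>x R. x \<epsilon> H \<Longrightarrow> R \<in> internal \<Longrightarrow> subset R (prod H K) \<Longrightarrow> functional R \<Longrightarrow>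
      \<exists>k. k \<epsilon> K \<and> (\<forall>y. opair x y \<epsilon> G \<longrightarrow> \<not> opair y k \<epsilon> R)"
  shows "\<exists>C. C \<in> internal \<and> subset C (prod H K) \<and> functional C \<and>
    (\<forall>x. x \<epsilon> H \<longrightarrow> (\<exists>k. opair x k \<epsilon> C)) \<and>
    (\<forall>x y k. opair x y \<epsilon> G \<longrightarrow> opair x k \<epsilon> C \<longrightarrow> \<not> opair y k \<epsilon> C)"
proof -
  \<comment> \<open>Bounding all quantifiers by \<open>H\<close> and \<open>K\<close> makes the
    property st-free; on subsets of \<open>prod H K\<close> it says just that \<open>C\<close> is a
    proper partial colouring.\<close>
  define good where "good C \<longleftrightarrow>
    (\<forall>y. y \<epsilon> H \<longrightarrow> (\<forall>k. k \<epsilon> K \<longrightarrow> (\<forall>k'. k' \<epsilon> K \<longrightarrow>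
      opair y k \<epsilon> C \<longrightarrow> opair y k' \<epsilon> C \<longrightarrow> k = k'))) \<and>
    (\<forall>x. x \<epsilon> H \<longrightarrow> (\<forall>y. y \<epsilon> H \<longrightarrow> (\<forall>k. k \<epsilon> K \<longrightarrow>
      opair x y \<epsilon> G \<longrightarrow> opair x k \<epsilon> C \<longrightarrow> \<not> opair y k \<epsilon> C)))" for C
  have good: "good C \<longleftrightarrow> functional C \<and>
      (\<forall>x y k. opair x y \<epsilon> G \<longrightarrow> opair x k \<epsilon> C \<longrightarrow> \<not> opair y k \<epsilon> C)"
    if "subset C (prod H K)" for C
  proof -
    have "x \<epsilon> H \<and> k \<epsilon> K" if "opair x k \<epsilon> C" for x k
      using \<open>subset C (prod H K)\<close> that opair_mem_prod unfolding subset_def by blast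
    then show ?thesis unfolding good_def functional_def by blast
  qed
  have HK: "prod H K \<in> internal" by (rule prod_internal[OF H K])
  have PHK: "ipow (prod H K) \<in> internal" by (rule ipow_internal[OF HK])
  have "dfn True (\<lambda>\<rho>. good (\<rho> 0))"
    unfolding good_def using H K G by (intro dfn_intros) simp_all
  note memS = mem_sep_internal[OF this PHK] and intS = sep_internal[OF this PHK]
  define S where "S = sep (ipow (prod H K)) good"
  have S: "C \<epsilon> S \<longleftrightarrow> C \<in> internal \<and> subset C (prod H K) \<and> functional C \<and>
      (\<forall>x y k. opair x y \<epsilon> G \<longrightarrow> opair x k \<epsilon> C \<longrightarrow> \<not> opair y k \<epsilon> C)" for C
    unfolding S_def memS mem_ipow[OF HK] using good by blast
  have "\<exists>C. C \<epsilon> S \<and> (\<forall>p. p \<epsilon> prod H K \<longrightarrow> ins p C \<epsilon> S \<longrightarrow> p \<epsilon> C)"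
  proof (rule internal_zorn)
    show "S \<in> internal" unfolding S_def by (rule intS)
    fix L assume L: "L \<in> internal" "subset L S" "chain L"
    have LS: "C \<epsilon> S" if "C \<epsilon> L" for C using L(2) that unfolding subset_def by blast
    have two: "\<exists>E. E \<epsilon> L \<and> p \<epsilon> E \<and> q \<epsilon> E" if pq: "p \<epsilon> bigU L" "q \<epsilon> bigU L" for p q
    proof -
      obtain C D where "C \<epsilon> L" "p \<epsilon> C" "D \<epsilon> L" "q \<epsilon> D" using pq unfolding mem_bigU by blast
      moreover from this have "subset C D \<or> subset D C" using L(3) unfolding chain_def by blast
      ultimately show ?thesis unfolding subset_def by blast
    qed
    show "bigU L \<epsilon> S"
      unfolding S
    proof (intro conjI allI impI)
      show "bigU L \<in> internal" using bigU_cls[of L True] L(1) by simp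
      show "subset (bigU L) (prod H K)"
        using LS unfolding S subset_def mem_bigU by blast
      show "functional (bigU L)"
        unfolding functional_def
      proof (intro allI impI)
        fix y k k' assume "opair y k \<epsilon> bigU L" "opair y k' \<epsilon> bigU L"
        from two[OF this] obtain E where "E \<epsilon> L" "opair y k \<epsilon> E" "opair y k' \<epsilon> E" by blast
        then show "k = k'" using LS[of E] unfolding S functional_def by blast
      qed
      fix x y k assume xy: "opair x y \<epsilon> G" and "opair x k \<epsilon> bigU L"
      show "\<not> opair y k \<epsilon> bigU L"
      proof
        assume "opair y k \<epsilon> bigU L"
        from two[OF \<open>opair x k \<epsilon> bigU L\<close> this] obtain E where
          "E \<epsilon> L" "opair x k \<epsilon> E" "opair y k \<epsilon> E" by blast
        then show False using LS[of E] xy unfolding S by blast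
      qed
    qed
  qed (rule HK)
  then obtain C where C: "C \<epsilon> S" and max: "\<And>p. p \<epsilon> prod H K \<Longrightarrow> ins p C \<epsilon> S \<Longrightarrow> p \<epsilon> C" by blast
  note C' = C[unfolded S]
  have "\<exists>k. opair x k \<epsilon> C" if x: "x \<epsilon> H" for x
  proof (rule ccontr)
    assume no: "\<not> ?thesis"
    \<comment> \<open>The partial colouring \<open>C\<close> itself is the partial function to which
      \<open>no_surj\<close> is applied.\<close>
    obtain k where k: "k \<epsilon> K" "\<And>y. opair x y \<epsilon> G \<Longrightarrow> \<not> opair y k \<epsilon> C"
      using no_surj[OF x] C' by blast
    have "ins (opair x k) C \<epsilon> S"
      unfolding S
    proof (intro conjI allI impI)
      have "opair x k \<in> internal"
        using opair_cls[of x True k] internal_transitive[OF H x] internal_transitive[OF K k(1)] by simp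
      then show "ins (opair x k) C \<in> internal" using ins_cls[of _ True C] C' by simp
      show "subset (ins (opair x k) C) (prod H K)" using C' x k(1) by (simp add: subset_def)
      show "functional (ins (opair x k) C)" using C' no unfolding functional_def mem_ins by auto
      fix y z l assume yz: "opair y z \<epsilon> G" and "opair y l \<epsilon> ins (opair x k) C"
      then consider "y = x" "l = k" | "opair y l \<epsilon> C" by auto
      then show "\<not> opair z l \<epsilon> ins (opair x k) C"
      proof cases
        case 1
        then show ?thesis using yz k(2) irrefl by auto
      next
        case 2
        have "\<not> opair z l \<epsilon> C" using C' yz 2 by blast
        moreover have "\<not> (z = x \<and> l = k)" using 2 k(2)[of y] sym[OF yz] by blast
        ultimately show ?thesis by auto
      qed
    qed
    then have "opair x k \<epsilon> C" using max x k(1) by simp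
    then show False using no by blast
  qed
  then show ?thesis using C' by blast
qed

section \<open>Relations, and finite sets compared by partial functions\<close>

lemma mem_double_union:
  "opair x y \<epsilon> R \<Longrightarrow> x \<epsilon> bigU (bigU R) \<and> y \<epsilon> bigU (bigU R)"
proof -
  assume "opair x y \<epsilon> R"
  moreover have "upair x y \<epsilon> opair x y" by (simp add: opair_def)
  ultimately show ?thesis using mem_bigU mem_upair by blast
qed

lemma relation_betweenD:
  assumes "relation_between R X Y" "opair x y \<epsilon> R"
  shows "x \<epsilon> X \<and> y \<epsilon> Y"
proof -
  obtain x' y' where "x' \<epsilon> X" "y' \<epsilon> Y" "opair x y = opair x' y'"
    using assms unfolding relation_between_def is_opair_iff by blast
  then show ?thesis by simp
qed

text \<open>Components of Kuratowski pairs in \<open>R\<close> belong to its double union, which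
  bounds the quantifiers and makes the notion absolute.\<close>

lemma dfn_functional [dfn_intros]: "trm i t \<Longrightarrow> dfn i (\<lambda>\<rho>. functional (t \<rho>))"
proof (rule dfn1[where R = functional])
  have "functional R \<longleftrightarrow> (\<forall>y. y \<epsilon> bigU (bigU R) \<longrightarrow> (\<forall>k. k \<epsilon> bigU (bigU R) \<longrightarrow>
    (\<forall>k'. k' \<epsilon> bigU (bigU R) \<longrightarrow> opair y k \<epsilon> R \<longrightarrow> opair y k' \<epsilon> R \<longrightarrow> k = k')))" for R
    unfolding functional_def using mem_double_union[of _ _ R] by blast
  then show "dfn i (\<lambda>\<rho>. functional (\<rho> 0))" by (simp only:) (intro dfn_intros)
qed

lemma Fin_internal:
  assumes "D \<in> wellfounded" "\<And>x. x \<epsilon> D \<Longrightarrow> x \<in> internal" "K \<epsilon> Fin D"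
  shows "K \<in> internal"
proof (rule Fin_induct[where P = "\<lambda>K. K \<in> internal", OF assms(1,3)])
  show "dfn False (\<lambda>\<rho>. \<rho> 0 \<in> internal)" by (intro dfn_intros)
  show "emp \<in> internal" by (rule emp_internal)
  show "ins b \<gamma> \<in> internal" if "b \<epsilon> D" "\<gamma> \<in> internal" for b \<gamma>
    using ins_cls[of b True \<gamma>] assms(2)[OF that(1)] that(2) by simp
qed

text \<open>If a partial function maps one additional point to the new colour, redirecting the points
  of the old set that had this colour leaves a partial function on the old set.\<close>

lemma Fin_no_surjection:
  assumes D: "D \<in> wellfounded" and inf: "\<And>K. K \<epsilon> Fin D \<Longrightarrow> \<exists>p. p \<epsilon> D \<and> \<not> p \<epsilon> K"
    and v: "v \<in> wellfounded" and h: "trm False (\<lambda>\<rho>. h (\<rho> 0))" and \<phi>: "\<phi> \<epsilon> Fin v"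
  shows "\<exists>K. K \<epsilon> Fin D \<and>
    (\<forall>R. functional R \<longrightarrow> (\<exists>k. k \<epsilon> K \<and> (\<forall>j. j \<epsilon> \<phi> \<longrightarrow> \<not> opair (h j) k \<epsilon> R)))"
proof -
  let ?P = "\<lambda>\<phi>. \<exists>K. K \<epsilon> Fin D \<and>
    (\<forall>R. functional R \<longrightarrow> (\<exists>k. k \<epsilon> K \<and> (\<forall>j. j \<epsilon> \<phi> \<longrightarrow> \<not> opair (h j) k \<epsilon> R)))"
  show "?P \<phi>"
  proof (rule Fin_induct[where P = ?P, OF v \<phi>])
    show "dfn False (\<lambda>\<rho>. ?P (\<rho> 0))" by (intro dfn_intros trm1[OF h])
    obtain p where "p \<epsilon> D" using inf[OF Fin_emp[OF D]] by blast
    then have "ins p emp \<epsilon> Fin D" by (rule Fin_ins[OF D Fin_emp[OF D]])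
    then show "?P emp" by (intro exI[of _ "ins p emp"]) auto
    fix j0 \<phi> assume "?P \<phi>"
    then obtain K where K: "K \<epsilon> Fin D"
      "\<And>R. functional R \<Longrightarrow> \<exists>k. k \<epsilon> K \<and> (\<forall>j. j \<epsilon> \<phi> \<longrightarrow> \<not> opair (h j) k \<epsilon> R)" by blast
    \<comment> \<open>Each further point costs one further colour, and \<open>D\<close> never runs
      out of them.\<close>
    obtain p where p: "p \<epsilon> D" "\<not> p \<epsilon> K" using inf[OF K(1)] by blast
    have "\<exists>k. k \<epsilon> ins p K \<and> (\<forall>j. j \<epsilon> ins j0 \<phi> \<longrightarrow> \<not> opair (h j) k \<epsilon> R)"
      if R: "functional R" for R
    proof (rule ccontr)
      assume "\<not> ?thesis"
      then have hit: "\<exists>j. (j = j0 \<or> j \<epsilon> \<phi>) \<and> opair (h j) k \<epsilon> R" if "k = p \<or> k \<epsilon> K" for k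
        using that unfolding mem_ins by blast
      have fR: "k = k'" if "opair y k \<epsilon> R" "opair y k' \<epsilon> R" for y k k'
        using R that unfolding functional_def by blast
      define U where "U = bigU (bigU R)"
      have U: "x \<epsilon> U" "y \<epsilon> U" if "opair x y \<epsilon> R" for x y
        using mem_double_union[OF that] unfolding U_def by blast+
      define R' where "R' = sep (prod U U) (\<lambda>q. \<exists>y k. q = opair y k \<and>
        ((opair y k \<epsilon> R \<and> k \<noteq> p) \<or> (opair y p \<epsilon> R \<and> opair (h j0) k \<epsilon> R)))"
      have "dfn False (\<lambda>\<rho>. \<exists>y k. \<rho> 0 = opair y k \<and>
        ((opair y k \<epsilon> R \<and> k \<noteq> p) \<or> (opair y p \<epsilon> R \<and> opair (h j0) k \<epsilon> R)))"
        by (intro dfn_intros)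
      note mem_R' = mem_sep[OF this, of _ "prod U U", folded R'_def]
      have R': "opair y k \<epsilon> R' \<longleftrightarrow> (opair y k \<epsilon> R \<and> k \<noteq> p) \<or> (opair y p \<epsilon> R \<and> opair (h j0) k \<epsilon> R)" for y k
        unfolding mem_R' opair_mem_prod using U by auto
      have "functional R'"
        unfolding functional_def R' using fR by blast
      then obtain k where k: "k \<epsilon> K" "\<And>j. j \<epsilon> \<phi> \<Longrightarrow> \<not> opair (h j) k \<epsilon> R'" using K(2) by blast
      have kp: "k \<noteq> p" using k(1) p(2) by blast
      \<comment> \<open>\<open>R'\<close> misses \<open>k\<close> on the old points, so only
        \<open>h j0\<close> can have colour \<open>k\<close> under \<open>R\<close>. Then
        \<open>p\<close> must be the colour of some old point, and \<open>R'\<close> redirects that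
        point to \<open>k\<close>.\<close>
      obtain j where j: "j = j0 \<or> j \<epsilon> \<phi>" "opair (h j) k \<epsilon> R" using hit k(1) by blast
      then have j0: "opair (h j0) k \<epsilon> R" using k(2)[of j] kp unfolding R' by blast
      obtain j' where j': "j' = j0 \<or> j' \<epsilon> \<phi>" "opair (h j') p \<epsilon> R" using hit[of p] by blast
      then have "j' \<noteq> j0" using fR[OF j0] kp by blast
      then show False using j' j0 k(2)[of j'] unfolding R' by blast
    qed
    then show "?P (ins j0 \<phi>)" using Fin_ins[OF D K(1) p(1)] by blast
  qed
qed

end

subsection \<open>Equivalence relations with classes of standard size\<close>

locale standard_size_classes = HST mem st
  for mem :: "'u \<Rightarrow> 'u \<Rightarrow> bool"  (infix "\<epsilon>" 50)
    and st :: "'u \<Rightarrow> bool" +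
  fixes H E A B :: 'u and X :: "'u \<Rightarrow> 'u \<Rightarrow> 'u"
  assumes H: "H \<in> internal"
    and equivalence: "equivalence_on E H"
    and class_size: "\<And>C. is_class_of C E H \<Longrightarrow> standard_size C"
    and A: "A \<in> wellfounded" and B: "B \<in> wellfounded"
    and X: "trm False (\<lambda>\<rho>. X (\<rho> 0) (\<rho> (Suc 0)))"
    and X_internal: "\<And>a b. a \<epsilon> A \<Longrightarrow> b \<epsilon> B \<Longrightarrow> X a b \<in> internal"
    and E_iff: "\<And>p. p \<epsilon> E \<longleftrightarrow> (\<exists>a. a \<epsilon> A \<and> (\<forall>b. b \<epsilon> B \<longrightarrow> p \<epsilon> X a b))"
begin

lemma E_domain: "opair x y \<epsilon> E \<Longrightarrow> x \<epsilon> H \<and> y \<epsilon> H"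
  using equivalence unfolding equivalence_on_def by (intro relation_betweenD) blast+

lemma E_refl: "x \<epsilon> H \<Longrightarrow> opair x x \<epsilon> E"
  and E_sym: "opair x y \<epsilon> E \<Longrightarrow> opair y x \<epsilon> E"
  and E_trans: "opair x y \<epsilon> E \<Longrightarrow> opair y z \<epsilon> E \<Longrightarrow> opair x z \<epsilon> E"
  using equivalence unfolding equivalence_on_def related_iff by blast+

lemma X_trm: "trm False s \<Longrightarrow> trm False t \<Longrightarrow> trm False (\<lambda>\<rho>. X (s \<rho>) (t \<rho>))"
  by (rule trm2[OF X])

definition eclass :: "'u \<Rightarrow> 'u" where
  "eclass x = sep H (\<lambda>y. opair x y \<epsilon> E)"

lemma mem_eclass: "y \<epsilon> eclass x \<longleftrightarrow> opair x y \<epsilon> E"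
proof -
  have "dfn False (\<lambda>\<rho>. opair x (\<rho> 0) \<epsilon> E)" by (intro dfn_intros)
  then show ?thesis unfolding eclass_def using E_domain by (auto simp: mem_sep)
qed

lemma eclass_trm: "trm False t \<Longrightarrow> trm False (\<lambda>\<rho>. eclass (t \<rho>))"
  by (rule trm1) (unfold eclass_def, intro dfn_intros)

lemma is_class_of_iff: "is_class_of C E H \<longleftrightarrow> (\<exists>x. x \<epsilon> H \<and> C = eclass x)"
  unfolding is_class_of_def related_iff mem_eclass[symmetric] by (auto intro: set_ext)

lemma enumerate_class:
  assumes "x \<epsilon> H"
  obtains v h where "v \<in> wellfounded" "trm False (\<lambda>\<rho>. h (\<rho> 0))"
    "\<And>y. opair x y \<epsilon> E \<Longrightarrow> \<exists>j. j \<epsilon> v \<and> y = h j" "\<And>j. j \<epsilon> v \<Longrightarrow> h j \<epsilon> H"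
proof -
  have "standard_size (eclass x)"
    using class_size assms unfolding is_class_of_iff by blast
  then obtain v f where v: "v \<in> wellfounded" and f: "bijection f v (eclass x)"
    unfolding standard_size_def by blast
  have func: "function_on f v"
    using f unfolding bijection_def function_on_def relation_between_def by blast
  have rel: "relation_between f v (eclass x)" "\<And>y. y \<epsilon> eclass x \<Longrightarrow> \<exists>j. opair j y \<epsilon> f"
    using f unfolding bijection_def related_iff by blast+
  show ?thesis
  proof (rule that[OF v])
    show "trm False (\<lambda>\<rho>. app f (\<rho> 0))" by (intro dfn_intros)
    show "\<exists>j. j \<epsilon> v \<and> y = app f j" if y: "opair x y \<epsilon> E" for y
    proof -
      obtain j where j: "opair j y \<epsilon> f" using rel(2)[of y] y unfolding mem_eclass by blast
      then have "j \<epsilon> v" using relation_betweenD[OF rel(1)] by blast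
      then show ?thesis using app_eq[OF func] j by blast
    qed
    show "app f j \<epsilon> H" if "j \<epsilon> v" for j
    proof -
      have "opair j (app f j) \<epsilon> f" using app_eq[OF func that] by blast
      then have "app f j \<epsilon> eclass x" using relation_betweenD[OF rel(1)] by blast
      then show ?thesis using E_domain unfolding mem_eclass by blast
    qed
  qed
qed

text \<open>For fixed \<open>a\<close>, these internal relations decrease as the finite set
  \<open>\<beta>\<close> grows. Their intersection is the piece of the relation that belongs to
  \<open>a\<close>.\<close>

definition approx :: "'u \<Rightarrow> 'u \<Rightarrow> 'u" where
  "approx a \<beta> = cap (prod H H) (X a) \<beta>"

lemma mem_approx: "opair x y \<epsilon> approx a \<beta> \<longleftrightarrow> x \<epsilon> H \<and> y \<epsilon> H \<and> (\<forall>b. b \<epsilon> \<beta> \<longrightarrow> opair x y \<epsilon> X a b)"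
proof -
  have "trm False (\<lambda>\<rho>. X a (\<rho> 0))" by (intro X_trm dfn_intros)
  from mem_cap[OF this] show ?thesis unfolding approx_def by simp
qed

lemma approx_internal: "a \<epsilon> A \<Longrightarrow> \<beta> \<epsilon> Fin B \<Longrightarrow> approx a \<beta> \<in> internal"
  unfolding approx_def
  by (rule cap_internal[OF B]) (intro X_trm dfn_intros X_internal prod_internal H; assumption)+

lemma approx_trm: "trm False s \<Longrightarrow> trm False t \<Longrightarrow> trm False (\<lambda>\<rho>. approx (s \<rho>) (t \<rho>))"
  by (rule trm2) (unfold approx_def cap_def, intro dfn_intros X_trm)

lemma approx_all: "a \<epsilon> A \<Longrightarrow> (\<And>\<beta>. \<beta> \<epsilon> Fin B \<Longrightarrow> opair x y \<epsilon> approx a \<beta>) \<Longrightarrow> opair x y \<epsilon> E"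
proof -
  assume a: "a \<epsilon> A" and *: "\<And>\<beta>. \<beta> \<epsilon> Fin B \<Longrightarrow> opair x y \<epsilon> approx a \<beta>"
  have "opair x y \<epsilon> X a b" if "b \<epsilon> B" for b
    using *[OF Fin_ins[OF B Fin_emp[OF B] that]] unfolding mem_approx by simp
  then show ?thesis unfolding E_iff using a by blast
qed

text \<open>The disjunction makes the graph symmetric and \<open>x \<noteq> y\<close> makes it
  irreflexive, as colouring requires. Each alternative places the pair \<open>opair x y\<close>
  itself, in this order, in an approximation for \<open>a\<close> or for \<open>a'\<close>.\<close>

definition graph :: "'u \<Rightarrow> 'u \<Rightarrow> 'u \<Rightarrow> 'u" where
  "graph a a' \<beta> = sep (prod H H) (\<lambda>p. \<exists>x. x \<epsilon> H \<and> (\<exists>y. y \<epsilon> H \<and> p = opair x y \<and> x \<noteq> y \<and>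
     ((opair x y \<epsilon> approx a \<beta> \<and> opair y x \<epsilon> approx a' \<beta>) \<or> (opair y x \<epsilon> approx a \<beta> \<and> opair x y \<epsilon> approx a' \<beta>))))"

lemma graph_trm: "trm False t \<Longrightarrow> trm False (\<lambda>\<rho>. graph a a' (t \<rho>))"
  by (rule trm1) (unfold graph_def, intro dfn_intros approx_trm)

lemma mem_graph: "opair x y \<epsilon> graph a a' \<beta> \<longleftrightarrow> x \<noteq> y \<and>
     ((opair x y \<epsilon> approx a \<beta> \<and> opair y x \<epsilon> approx a' \<beta>) \<or> (opair y x \<epsilon> approx a \<beta> \<and> opair x y \<epsilon> approx a' \<beta>))"
proof -
  have "dfn False (\<lambda>\<rho>. \<exists>x. x \<epsilon> H \<and> (\<exists>y. y \<epsilon> H \<and> \<rho> 0 = opair x y \<and> x \<noteq> y \<and>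
     ((opair x y \<epsilon> approx a \<beta> \<and> opair y x \<epsilon> approx a' \<beta>) \<or> (opair y x \<epsilon> approx a \<beta> \<and> opair x y \<epsilon> approx a' \<beta>))))"
    by (intro dfn_intros)
  from mem_sep[OF this, of "opair x y" "prod H H", folded graph_def]
  show ?thesis unfolding opair_mem_prod opair_inject using mem_approx by blast
qed

lemma graph_internal:
  assumes "a \<epsilon> A" "a' \<epsilon> A" "\<beta> \<epsilon> Fin B"
  shows "graph a a' \<beta> \<in> internal"
proof -
  have "approx a \<beta> \<in> internal" "approx a' \<beta> \<in> internal" using assms approx_internal by blast+
  then show ?thesis
    unfolding graph_def using H by (intro sep_internal prod_internal dfn_intros) simp_all
qed

lemma graph_mono:
  assumes "opair x y \<epsilon> graph a a' (cup \<beta> \<gamma>)"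
  shows "opair x y \<epsilon> graph a a' \<beta>" "opair x y \<epsilon> graph a a' \<gamma>"
  using assms unfolding mem_graph mem_approx mem_cup by blast+

text \<open>Which alternative of the graph holds may depend on \<open>\<beta>\<close>. If the pair
  leaves the approximations for \<open>a\<close> at some \<open>\<beta>\<close>, it stays outside at
  every larger set, so the alternative with \<open>a'\<close> holds at
  \<open>cup \<beta> \<gamma>\<close> and hence at \<open>\<gamma>\<close>.\<close>

lemma graph_all:
  assumes a: "a \<epsilon> A" "a' \<epsilon> A" and all: "\<And>\<beta>. \<beta> \<epsilon> Fin B \<Longrightarrow> opair x y \<epsilon> graph a a' \<beta>"
  shows "opair x y \<epsilon> E"
proof (cases "\<forall>\<beta>. \<beta> \<epsilon> Fin B \<longrightarrow> opair x y \<epsilon> approx a \<beta>")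
  case True
  then show ?thesis using approx_all a by blast
next
  case False
  then obtain \<beta> where \<beta>: "\<beta> \<epsilon> Fin B" "\<not> opair x y \<epsilon> approx a \<beta>" by blast
  have "opair x y \<epsilon> approx a' \<gamma>" if \<gamma>: "\<gamma> \<epsilon> Fin B" for \<gamma>
  proof -
    have "opair x y \<epsilon> graph a a' (cup \<beta> \<gamma>)" by (rule all[OF Fin_cup[OF B \<beta>(1) \<gamma>]])
    then show ?thesis using \<beta>(2) unfolding mem_graph mem_approx mem_cup by blast
  qed
  then show ?thesis using approx_all a by blast
qed

text \<open>Saturation is used twice: if no bound existed, some \<^term>\<open>x\<close> would have
  arbitrarily large finite sections in all approximations of the relation at once, and then
  these sections, from which the standard size many members of the class of \<^term>\<open>x\<close> are
  removed one by one, would still have a common element.\<close>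

lemma bounded_degree:
  assumes \<Omega>: "\<Omega> \<in> internal" and D\<Omega>: "subset D \<Omega>" and D: "D \<in> wellfounded"
    and inf: "\<forall>K. K \<epsilon> Fin D \<longrightarrow> (\<exists>p. p \<epsilon> D \<and> \<not> p \<epsilon> K)"
    and a: "a \<epsilon> A" "a' \<epsilon> A"
  shows "\<exists>\<beta> K. \<beta> \<epsilon> Fin B \<and> K \<epsilon> Fin D \<and>
    (\<forall>x R. x \<epsilon> H \<longrightarrow> R \<in> internal \<longrightarrow> subset R (prod H \<Omega>) \<longrightarrow> functional R \<longrightarrow>
      (\<exists>k. k \<epsilon> K \<and> (\<forall>y. opair x y \<epsilon> graph a a' \<beta> \<longrightarrow> \<not> opair y k \<epsilon> R)))"
proof (rule ccontr)
  assume neg: "\<not> ?thesis"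
  have H\<Omega>: "prod H \<Omega> \<in> internal" by (rule prod_internal[OF H \<Omega>])
  have PH\<Omega>: "ipow (prod H \<Omega>) \<in> internal" by (rule ipow_internal[OF H\<Omega>])
  define N where "N \<beta> K = sep H (\<lambda>x. \<exists>R. R \<epsilon> ipow (prod H \<Omega>) \<and> functional R \<and>
    (\<forall>k. k \<epsilon> K \<longrightarrow> (\<exists>y. y \<epsilon> H \<and> opair x y \<epsilon> graph a a' \<beta> \<and> opair y k \<epsilon> R)))" for \<beta> K
  have "dfn False (\<lambda>\<rho>. \<exists>R. R \<epsilon> ipow (prod H \<Omega>) \<and> functional R \<and>
    (\<forall>k. k \<epsilon> K \<longrightarrow> (\<exists>y. y \<epsilon> H \<and> opair (\<rho> 0) y \<epsilon> graph a a' \<beta> \<and> opair y k \<epsilon> R)))" for \<beta> K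
    by (intro dfn_intros)
  note memN = mem_sep[OF this, of _ H, folded N_def]
  have graphH: "y \<epsilon> H" if "opair x y \<epsilon> graph a a' \<beta>" for x y \<beta>
    using that unfolding mem_graph mem_approx by blast
  have N: "x \<epsilon> N \<beta> K \<longleftrightarrow> x \<epsilon> H \<and> (\<exists>R. R \<in> internal \<and> subset R (prod H \<Omega>) \<and> functional R \<and>
    (\<forall>k. k \<epsilon> K \<longrightarrow> (\<exists>y. opair x y \<epsilon> graph a a' \<beta> \<and> opair y k \<epsilon> R)))" for x \<beta> K
    unfolding memN mem_ipow[OF H\<Omega>] using graphH by blast
  have D_internal: "d \<in> internal" if "d \<epsilon> D" for d
    using D\<Omega> that internal_transitive[OF \<Omega>] unfolding subset_def by blast
  have N_trm: "trm False s \<Longrightarrow> trm False t \<Longrightarrow> trm False (\<lambda>\<rho>. N (s \<rho>) (t \<rho>))" for s t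
    by (rule trm2) (unfold N_def, intro dfn_intros graph_trm)
  have N_internal: "N \<beta> K \<in> internal" if "\<beta> \<epsilon> Fin B" "K \<epsilon> Fin D" for \<beta> K
    unfolding N_def
    using PH\<Omega> H graph_internal[OF a that(1)] Fin_internal[OF D D_internal that(2)]
    by (intro sep_internal dfn_intros) simp_all
  have N_nonempty: "\<exists>x. x \<epsilon> N \<beta> K" if "\<beta> \<epsilon> Fin B" "K \<epsilon> Fin D" for \<beta> K
    using neg that unfolding N by blast
  have N_mono: "x \<epsilon> N \<beta> K \<and> x \<epsilon> N \<gamma> M" if x: "x \<epsilon> N (cup \<beta> \<gamma>) (cup K M)" for x \<beta> \<gamma> K M
  proof -
    obtain R where R: "x \<epsilon> H" "R \<in> internal" "subset R (prod H \<Omega>)" "functional R"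
      "\<And>k. k \<epsilon> K \<or> k \<epsilon> M \<Longrightarrow> \<exists>y. opair x y \<epsilon> graph a a' (cup \<beta> \<gamma>) \<and> opair y k \<epsilon> R"
      using x unfolding N mem_cup by blast
    then show ?thesis unfolding N using graph_mono by meson
  qed
  have "\<exists>x. \<forall>\<beta> K. \<beta> \<epsilon> Fin B \<longrightarrow> K \<epsilon> Fin D \<longrightarrow> x \<epsilon> N \<beta> K"
    by (rule saturation_Fin_Fin[where X = N, OF B D])
      (rule N_trm, rule trm_var, rule trm_var, erule (1) N_internal, erule (1) N_nonempty, erule N_mono)
  then obtain x where xN: "\<And>\<beta> K. \<beta> \<epsilon> Fin B \<Longrightarrow> K \<epsilon> Fin D \<Longrightarrow> x \<epsilon> N \<beta> K" by blast
  have xH: "x \<epsilon> H" using xN[OF Fin_emp[OF B] Fin_emp[OF D]] unfolding N by blast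
  obtain v h where v: "v \<in> wellfounded" and h: "trm False (\<lambda>\<rho>. h (\<rho> 0))"
    and cls: "\<And>y. opair x y \<epsilon> E \<Longrightarrow> \<exists>j. j \<epsilon> v \<and> y = h j" and hH: "\<And>j. j \<epsilon> v \<Longrightarrow> h j \<epsilon> H"
    by (rule enumerate_class[OF xH]) (rule that)
  \<comment> \<open>The section of \<open>x\<close> without finitely many listed members of its
    class. The list is indexed by the possibly infinite \<open>v\<close>, but each
    \<open>\<phi>\<close> is finite, so this set is still internal.\<close>
  define W where "W \<beta> \<phi> = sep H (\<lambda>y. opair x y \<epsilon> graph a a' \<beta> \<and> (\<forall>j. j \<epsilon> \<phi> \<longrightarrow> y \<noteq> h j))" for \<beta> \<phi>
  have "dfn False (\<lambda>\<rho>. opair x (\<rho> 0) \<epsilon> graph a a' \<beta> \<and> (\<forall>j. j \<epsilon> \<phi> \<longrightarrow> \<rho> 0 \<noteq> h j))" for \<beta> \<phi>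
    by (intro dfn_intros trm1[OF h])
  note memW = mem_sep[OF this, of _ H, folded W_def]
  have W: "y \<epsilon> W \<beta> \<phi> \<longleftrightarrow> opair x y \<epsilon> graph a a' \<beta> \<and> (\<forall>j. j \<epsilon> \<phi> \<longrightarrow> y \<noteq> h j)" for y \<beta> \<phi>
    unfolding memW using graphH by blast
  have W_trm: "trm False s \<Longrightarrow> trm False t \<Longrightarrow> trm False (\<lambda>\<rho>. W (s \<rho>) (t \<rho>))" for s t
    by (rule trm2) (unfold W_def, intro dfn_intros graph_trm trm1[OF h])
  have xI: "x \<in> internal" by (rule internal_transitive[OF H xH])
  have W_internal: "W \<beta> \<phi> \<in> internal" if \<beta>: "\<beta> \<epsilon> Fin B" and \<phi>: "\<phi> \<epsilon> Fin v" for \<beta> \<phi>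
  proof (rule Fin_induct[where P = "\<lambda>\<phi>. W \<beta> \<phi> \<in> internal", OF v \<phi>])
    show "dfn False (\<lambda>\<rho>. W \<beta> (\<rho> 0) \<in> internal)" by (intro dfn_intros W_trm)
    have D1: "dfn True (\<lambda>\<rho>. opair x (\<rho> 0) \<epsilon> graph a a' \<beta>)"
      using graph_internal[OF a \<beta>] xI by (intro dfn_intros) simp_all
    have "W \<beta> emp = sep H (\<lambda>y. opair x y \<epsilon> graph a a' \<beta>)"
      by (rule set_ext) (use graphH in \<open>auto simp: W mem_sep_internal[OF D1 H]\<close>)
    then show "W \<beta> emp \<in> internal" using sep_internal[OF D1 H] by simp
    fix j \<psi> assume j: "j \<epsilon> v" and \<psi>: "W \<beta> \<psi> \<in> internal"
    have D2: "dfn True (\<lambda>\<rho>. \<rho> 0 \<noteq> h j)"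
      using internal_transitive[OF H hH[OF j]] by (intro dfn_intros) simp_all
    have "W \<beta> (ins j \<psi>) = sep (W \<beta> \<psi>) (\<lambda>y. y \<noteq> h j)"
      by (rule set_ext) (auto simp: W mem_sep_internal[OF D2 \<psi>])
    then show "W \<beta> (ins j \<psi>) \<in> internal" using sep_internal[OF D2 \<psi>] by simp
  qed
  have W_nonempty: "\<exists>y. y \<epsilon> W \<beta> \<phi>" if \<beta>: "\<beta> \<epsilon> Fin B" and \<phi>: "\<phi> \<epsilon> Fin v" for \<beta> \<phi>
  proof -
    \<comment> \<open>\<open>K\<close> is chosen too large to be covered by colours of the removed
      points. As the section of \<open>x\<close> does cover it, some neighbour was not
      removed.\<close>
    obtain K where K: "K \<epsilon> Fin D"
      "\<And>R. functional R \<Longrightarrow> \<exists>k. k \<epsilon> K \<and> (\<forall>j. j \<epsilon> \<phi> \<longrightarrow> \<not> opair (h j) k \<epsilon> R)"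
      using Fin_no_surjection[OF D inf[rule_format] v h \<phi>] by blast
    obtain R where R: "functional R"
      "\<And>k. k \<epsilon> K \<Longrightarrow> \<exists>y. opair x y \<epsilon> graph a a' \<beta> \<and> opair y k \<epsilon> R"
      using xN[OF \<beta> K(1)] unfolding N by blast
    obtain k where k: "k \<epsilon> K" "\<And>j. j \<epsilon> \<phi> \<Longrightarrow> \<not> opair (h j) k \<epsilon> R" using K(2)[OF R(1)] by blast
    obtain y where "opair x y \<epsilon> graph a a' \<beta>" "opair y k \<epsilon> R" using R(2)[OF k(1)] by blast
    then have "y \<epsilon> W \<beta> \<phi>" using k(2) unfolding W by blast
    then show ?thesis by blast
  qed
  have W_mono: "y \<epsilon> W \<beta> \<phi> \<and> y \<epsilon> W \<gamma> \<psi>" if "y \<epsilon> W (cup \<beta> \<gamma>) (cup \<phi> \<psi>)" for y \<beta> \<gamma> \<phi> \<psi>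
    using that graph_mono[of x y a a' \<beta> \<gamma>] unfolding W mem_cup by blast
  have "\<exists>y. \<forall>\<beta> \<phi>. \<beta> \<epsilon> Fin B \<longrightarrow> \<phi> \<epsilon> Fin v \<longrightarrow> y \<epsilon> W \<beta> \<phi>"
    by (rule saturation_Fin_Fin[where X = W, OF B v])
      (rule W_trm, rule trm_var, rule trm_var, erule (1) W_internal, erule (1) W_nonempty, erule W_mono)
  then obtain y where yW: "\<And>\<beta> \<phi>. \<beta> \<epsilon> Fin B \<Longrightarrow> \<phi> \<epsilon> Fin v \<Longrightarrow> y \<epsilon> W \<beta> \<phi>" by blast
  have "opair x y \<epsilon> graph a a' \<beta>" if "\<beta> \<epsilon> Fin B" for \<beta>
    using yW[OF that Fin_emp[OF v]] unfolding W by blast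
  then have "opair x y \<epsilon> E" by (rule graph_all[OF a])
  then obtain j where j: "j \<epsilon> v" "y = h j" using cls by blast
  \<comment> \<open>The common element \<open>y\<close> is in the class, so it is some
    \<open>h j\<close>; yet the condition for the singleton of \<open>j\<close> excludes it.\<close>
  have "y \<epsilon> W emp (ins j emp)"
    by (intro yW Fin_emp[OF B] Fin_ins[OF v Fin_emp[OF v] j(1)])
  then show False using j(2) unfolding W by auto
qed

text \<open>A set \<open>U j\<close> is one colour class of one graph, so \<open>j\<close> consists
  of a pair from \<open>A\<close> and a colour. The finite palettes vary with the pair, but all lie
  in \<open>D\<close>; this gives the uniform well-founded index set \<open>J\<close>.\<close>

lemma separating_family:
  obtains J U where "J \<in> wellfounded" "trm False (\<lambda>\<rho>. U (\<rho> 0))"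
    "\<And>j. j \<epsilon> J \<Longrightarrow> U j \<in> internal"
    "\<And>x y. opair x y \<epsilon> E \<Longrightarrow> x \<noteq> y \<Longrightarrow> \<exists>j. j \<epsilon> J \<and> x \<epsilon> U j \<and> \<not> y \<epsilon> U j"
proof -
  obtain \<Omega> D where \<Omega>: "\<Omega> \<in> internal" and D\<Omega>: "subset D \<Omega>" and D: "D \<in> wellfounded"
    and "\<And>K. K \<epsilon> Fin D \<Longrightarrow> \<exists>p. p \<epsilon> D \<and> \<not> p \<epsilon> K"
    by (rule infinite_set) (rule that)
  then have inf: "\<forall>K. K \<epsilon> Fin D \<longrightarrow> (\<exists>p. p \<epsilon> D \<and> \<not> p \<epsilon> K)" by blast
  have D_internal: "d \<in> internal" if "d \<epsilon> D" for d
    using D\<Omega> that internal_transitive[OF \<Omega>] unfolding subset_def by blast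
  have H\<Omega>: "prod H \<Omega> \<in> internal" by (rule prod_internal[OF H \<Omega>])
  \<comment> \<open>Neither \<open>\<beta>\<close> nor the palette occurs here, since both depend on
    the pair. Demanding colours in \<open>D\<close> and separation of pairs in the full
    intersections keeps the condition uniform.\<close>
  define col where "col a a' C \<longleftrightarrow> C \<in> internal \<and> (\<forall>x. x \<epsilon> H \<longrightarrow> (\<exists>k. k \<epsilon> D \<and> opair x k \<epsilon> C)) \<and>
    (\<forall>x y k. x \<noteq> y \<longrightarrow> x \<epsilon> H \<longrightarrow> y \<epsilon> H \<longrightarrow> (\<forall>b. b \<epsilon> B \<longrightarrow> opair x y \<epsilon> X a b) \<longrightarrow>
      (\<forall>b. b \<epsilon> B \<longrightarrow> opair y x \<epsilon> X a' b) \<longrightarrow> opair x k \<epsilon> C \<longrightarrow> \<not> opair y k \<epsilon> C)" for a a' C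
  have col_ex: "\<exists>C. subset C (prod H \<Omega>) \<and> col a a' C" if a: "a \<epsilon> A" "a' \<epsilon> A" for a a'
  proof -
    from bounded_degree[OF \<Omega> D\<Omega> D inf a] obtain \<beta> K where \<beta>: "\<beta> \<epsilon> Fin B" and K: "K \<epsilon> Fin D"
      and bd: "\<forall>x R. x \<epsilon> H \<longrightarrow> R \<in> internal \<longrightarrow> subset R (prod H \<Omega>) \<longrightarrow> functional R \<longrightarrow>
      (\<exists>k. k \<epsilon> K \<and> (\<forall>y. opair x y \<epsilon> graph a a' \<beta> \<longrightarrow> \<not> opair y k \<epsilon> R))" by (elim exE conjE)
    have KD: "k \<epsilon> D" if "k \<epsilon> K" for k using Fin_subset[OF D K that] .
    have "subset K \<Omega>" using KD D\<Omega> unfolding subset_def by blast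
    then have sub: "subset R (prod H \<Omega>)" if "subset R (prod H K)" for R
      using that unfolding subset_def mem_prod by blast
    have "\<exists>C. C \<in> internal \<and> subset C (prod H K) \<and> functional C \<and>
      (\<forall>x. x \<epsilon> H \<longrightarrow> (\<exists>k. opair x k \<epsilon> C)) \<and>
      (\<forall>x y k. opair x y \<epsilon> graph a a' \<beta> \<longrightarrow> opair x k \<epsilon> C \<longrightarrow> \<not> opair y k \<epsilon> C)"
    proof (rule internal_colouring[OF H _ graph_internal[OF a \<beta>]])
      show "K \<in> internal" by (rule Fin_internal[OF D D_internal K])
      show "opair x y \<epsilon> graph a a' \<beta> \<Longrightarrow> opair y x \<epsilon> graph a a' \<beta>" for x y
        unfolding mem_graph by blast
      show "\<not> opair x x \<epsilon> graph a a' \<beta>" for x unfolding mem_graph by blast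
      show "\<exists>k. k \<epsilon> K \<and> (\<forall>y. opair x y \<epsilon> graph a a' \<beta> \<longrightarrow> \<not> opair y k \<epsilon> R)"
        if "x \<epsilon> H" "R \<in> internal" "subset R (prod H K)" "functional R" for x R
        using bd that sub by blast
    qed
    then obtain C where C: "C \<in> internal" "subset C (prod H K)"
      "\<And>x. x \<epsilon> H \<Longrightarrow> \<exists>k. opair x k \<epsilon> C"
      "\<And>x y k. opair x y \<epsilon> graph a a' \<beta> \<Longrightarrow> opair x k \<epsilon> C \<Longrightarrow> \<not> opair y k \<epsilon> C" by blast
    have "col a a' C"
      unfolding col_def
    proof (intro conjI allI impI)
      show "C \<in> internal" by fact
      show "\<exists>k. k \<epsilon> D \<and> opair x k \<epsilon> C" if "x \<epsilon> H" for x
        using C(2) C(3)[OF that] KD opair_mem_prod unfolding subset_def by blast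
      fix x y k assume "x \<noteq> y" "x \<epsilon> H" "y \<epsilon> H" and X: "\<forall>b. b \<epsilon> B \<longrightarrow> opair x y \<epsilon> X a b"
        "\<forall>b. b \<epsilon> B \<longrightarrow> opair y x \<epsilon> X a' b" and "opair x k \<epsilon> C"
      then have "opair x y \<epsilon> graph a a' \<beta>"
        unfolding mem_graph mem_approx using Fin_subset[OF B \<beta>] by blast
      then show "\<not> opair y k \<epsilon> C" using C(4) \<open>opair x k \<epsilon> C\<close> by blast
    qed
    then show ?thesis using sub C(2) by blast
  qed
  have col_dfn: "trm False s \<Longrightarrow> trm False t \<Longrightarrow> trm False u \<Longrightarrow> dfn False (\<lambda>\<rho>. col (s \<rho>) (t \<rho>) (u \<rho>))" for s t u
    by (rule dfn3) (unfold col_def, intro dfn_intros X_trm)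
  define F where "F p = sep (ipow (prod H \<Omega>)) (\<lambda>C. col (pfst p) (psnd p) C)" for p
  have "dfn False (\<lambda>\<rho>. col (pfst p) (psnd p) (\<rho> 0))" for p by (intro col_dfn dfn_intros)
  note memF = mem_sep[OF this, of _ "ipow (prod H \<Omega>)", folded F_def]
  \<comment> \<open>One colouring per pair must be selected simultaneously; \<open>A\<close> is
    well-founded, so choice over sets of standard size suffices.\<close>
  have "\<exists>c. \<forall>p. p \<epsilon> prod A A \<longrightarrow> app c p \<epsilon> F p"
  proof (rule choice_wellfounded)
    show "prod A A \<in> wellfounded" by (intro wellfounded_prod A)
    show "trm False (\<lambda>\<rho>. F (\<rho> 0))" unfolding F_def by (intro dfn_intros col_dfn)
    fix p assume "p \<epsilon> prod A A"
    then obtain a a' where p: "a \<epsilon> A" "a' \<epsilon> A" "p = opair a a'" unfolding mem_prod by blast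
    obtain C where "subset C (prod H \<Omega>)" "col a a' C" using col_ex[OF p(1,2)] by blast
    moreover from this have "C \<in> internal" unfolding col_def by blast
    ultimately have "C \<epsilon> F p" unfolding memF mem_ipow[OF H\<Omega>] by (simp add: p(3))
    then show "nonempty (F p)" unfolding nonempty_def by blast
  qed
  then obtain c where c: "\<And>p. p \<epsilon> prod A A \<Longrightarrow> app c p \<epsilon> F p" by blast
  have col: "col a a' (app c (opair a a'))" if "a \<epsilon> A" "a' \<epsilon> A" for a a'
    using c[of "opair a a'"] that unfolding memF by simp
  define J where "J = prod (prod A A) D"
  define U where "U j = sep H (\<lambda>x. opair x (psnd j) \<epsilon> app c (pfst j))" for j
  have "dfn False (\<lambda>\<rho>. opair (\<rho> 0) (psnd j) \<epsilon> app c (pfst j))" for j by (intro dfn_intros)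
  note U = mem_sep[OF this, of _ H, folded U_def]
  show ?thesis
  proof (rule that)
    show "J \<in> wellfounded" unfolding J_def by (intro wellfounded_prod A D)
    show "trm False (\<lambda>\<rho>. U (\<rho> 0))" unfolding U_def by (intro dfn_intros)
    show "U j \<in> internal" if "j \<epsilon> J" for j
    proof -
      obtain a a' k where j: "a \<epsilon> A" "a' \<epsilon> A" "k \<epsilon> D" "j = opair (opair a a') k"
        using \<open>j \<epsilon> J\<close> unfolding J_def mem_prod by blast
      have "app c (opair a a') \<in> internal" using col[OF j(1,2)] unfolding col_def by blast
      then show ?thesis
        unfolding U_def j(4) using D_internal[OF j(3)] H
        by (intro sep_internal) (simp_all, intro dfn_intros, simp_all)
    qed
    fix x y assume xy: "opair x y \<epsilon> E" "x \<noteq> y"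
    \<comment> \<open>\<open>a\<close> is a witness for the pair and \<open>a'\<close> for its
      converse. Together they make the two points adjacent in the graph coloured for this pair of
      indices.\<close>
    obtain a where a: "a \<epsilon> A" "\<forall>b. b \<epsilon> B \<longrightarrow> opair x y \<epsilon> X a b" using xy(1) E_iff by blast
    obtain a' where a': "a' \<epsilon> A" "\<forall>b. b \<epsilon> B \<longrightarrow> opair y x \<epsilon> X a' b"
      using E_sym[OF xy(1)] E_iff by blast
    have xH: "x \<epsilon> H" "y \<epsilon> H" using E_domain[OF xy(1)] by blast+
    obtain k where k: "k \<epsilon> D" "opair x k \<epsilon> app c (opair a a')"
      using col[OF a(1) a'(1)] xH unfolding col_def by blast
    have "\<not> opair y k \<epsilon> app c (opair a a')"
      using col[OF a(1) a'(1)] xH xy(2) a(2) a'(2) k(2) unfolding col_def by blast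
    then show "\<exists>j. j \<epsilon> J \<and> x \<epsilon> U j \<and> \<not> y \<epsilon> U j"
      using k xH a(1) a'(1) by (intro exI[of _ "opair (opair a a') k"]) (simp add: J_def U)
  qed
qed

section \<open>Choosing representatives by their codes\<close>

lemma transversal: "\<exists>T. delta2ss T \<and> is_transversal T E H"
proof -
  obtain J U where J: "J \<in> wellfounded" and U: "trm False (\<lambda>\<rho>. U (\<rho> 0))"
    and U_internal: "\<And>j. j \<epsilon> J \<Longrightarrow> U j \<in> internal"
    and separating: "\<And>x y. opair x y \<epsilon> E \<Longrightarrow> x \<noteq> y \<Longrightarrow> \<exists>j. j \<epsilon> J \<and> x \<epsilon> U j \<and> \<not> y \<epsilon> U j"
    by (rule separating_family) (rule that)
  note U_trm = trm1[OF U]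
  \<comment> \<open>The code of a point. Points of different classes may share a code; only within a
    class is it injective.\<close>
  define r where "r x = sep J (\<lambda>j. x \<epsilon> U j)" for x
  have "dfn False (\<lambda>\<rho>. x \<epsilon> U (\<rho> 0))" for x by (intro dfn_intros U_trm)
  note mem_r = mem_sep[OF this, of _ J, folded r_def]
  have r_trm: "trm False t \<Longrightarrow> trm False (\<lambda>\<rho>. r (t \<rho>))" for t
    by (rule trm1) (unfold r_def, intro dfn_intros U_trm)
  have r_inj: "x = y" if "opair x y \<epsilon> E" "r x = r y" for x y
    using separating[OF that(1)] that(2) mem_r by metis
  \<comment> \<open>All codes occurring in the class of \<open>x\<close>. Different classes may have
    the same trace and then select the same code, each realizing it by its own unique point.\<close>
  define Q where "Q x = img (eclass x) r" for x
  have mem_Q: "q \<epsilon> Q x \<longleftrightarrow> (\<exists>y. opair x y \<epsilon> E \<and> q = r y)" for q x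
    unfolding Q_def mem_img[OF r_trm[OF trm_var]] mem_eclass ..
  have Q_trm: "trm False t \<Longrightarrow> trm False (\<lambda>\<rho>. Q (t \<rho>))" for t
    by (rule trm1) (unfold Q_def, intro dfn_intros r_trm eclass_trm)
  have Q_cong: "Q x = Q y" if "opair x y \<epsilon> E" for x y
    using E_trans[OF that] E_trans[OF E_sym[OF that]] by (intro set_ext) (auto simp: mem_Q)
  have PJ: "pow J \<in> wellfounded" by (rule wellfounded_pow[OF J])
  have r_pow: "r x \<epsilon> pow J" for x unfolding mem_pow[OF J] subset_def mem_r by blast
  have Q_pow: "q \<epsilon> pow J" if "q \<epsilon> Q x" for q x using that r_pow unfolding mem_Q by blast
  have "dfn False (\<lambda>\<rho>. nonempty (\<rho> 0))" by (intro dfn_intros)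
  note mem_ne = mem_sep[OF this, of _ "pow (pow J)"]
  \<comment> \<open>Choice runs over sets of codes, all of them elements of the well-founded
    \<open>pow (pow J)\<close>; the family of classes itself need not have standard size.\<close>
  have "\<exists>c. \<forall>q. q \<epsilon> sep (pow (pow J)) nonempty \<longrightarrow> app c q \<epsilon> q"
  proof (rule choice_wellfounded)
    show "sep (pow (pow J)) nonempty \<in> wellfounded"
      by (rule wellfounded_subset[OF wellfounded_pow[OF PJ]]) (simp add: subset_def mem_ne)
    show "trm False (\<lambda>\<rho>. \<rho> 0)" by (rule trm_var)
  qed (simp add: mem_ne)
  then obtain c where c: "\<And>q. q \<epsilon> sep (pow (pow J)) nonempty \<Longrightarrow> app c q \<epsilon> q" by blast
  have cQ: "app c (Q x) \<epsilon> Q x" if "x \<epsilon> H" for x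
  proof (rule c)
    have "r x \<epsilon> Q x" using E_refl[OF that] mem_Q by blast
    then show "Q x \<epsilon> sep (pow (pow J)) nonempty"
      unfolding mem_ne mem_pow[OF PJ] subset_def nonempty_def using Q_pow by blast
  qed
  define T where "T = sep H (\<lambda>x. r x = app c (Q x))"
  have "dfn False (\<lambda>\<rho>. r (\<rho> 0) = app c (Q (\<rho> 0)))" by (intro dfn_intros r_trm Q_trm)
  note mem_T = mem_sep[OF this, of _ H, folded T_def]
  have TH: "subset T H" unfolding subset_def mem_T by blast
  have "is_transversal T E H"
    unfolding is_transversal_def
  proof (intro conjI allI impI TH)
    fix C assume "is_class_of C E H"
    then obtain x where x: "x \<epsilon> H" "C = eclass x" unfolding is_class_of_iff by blast
    obtain y where y: "opair x y \<epsilon> E" "app c (Q x) = r y" using cQ[OF x(1)] unfolding mem_Q by blast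
    show "\<exists>!y. y \<epsilon> T \<and> y \<epsilon> C"
    proof (rule ex1I)
      show "y \<epsilon> T \<and> y \<epsilon> C"
        unfolding mem_T x(2) mem_eclass using y Q_cong[OF y(1)] E_domain[OF y(1)] by simp
      fix z assume "z \<epsilon> T \<and> z \<epsilon> C"
      then have z: "r z = app c (Q z)" "opair x z \<epsilon> E" unfolding mem_T x(2) mem_eclass by blast+
      then have "r z = r y" using y(2) Q_cong[OF z(2)] by simp
      then show "z = y" by (rule r_inj[OF E_trans[OF E_sym[OF z(2)] y(1)]])
    qed
  qed
  moreover have "delta2ss T"
  proof -
    define U' where "U' q j = sep H (\<lambda>y. y \<epsilon> U j \<longleftrightarrow> j \<epsilon> q)" for q j
    have "dfn False (\<lambda>\<rho>. \<rho> 0 \<epsilon> U j \<longleftrightarrow> j \<epsilon> q)" for q j by (intro dfn_intros)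
    note mem_U' = mem_sep[OF this, of _ H, folded U'_def]
    have U'_trm: "trm False s \<Longrightarrow> trm False t \<Longrightarrow> trm False (\<lambda>\<rho>. U' (s \<rho>) (t \<rho>))" for s t
      by (rule trm2) (unfold U'_def, intro dfn_intros U_trm)
    have U'_internal: "U' q j \<in> internal" if "j \<epsilon> J" for q j
      unfolding U'_def using U_internal[OF that] by (intro sep_internal H dfn_intros) simp
    \<comment> \<open>The points whose code agrees with \<open>q\<close> on a finite set of indices,
      an internal approximation to \<open>r y = q\<close>.\<close>
    define M where "M q \<gamma> = cap H (U' q) \<gamma>" for q \<gamma>
    have "trm False (\<lambda>\<rho>. U' q (\<rho> 0))" for q by (intro U'_trm dfn_intros)
    note U'q = this
    have M: "y \<epsilon> M q \<gamma> \<longleftrightarrow> y \<epsilon> H \<and> (\<forall>j. j \<epsilon> \<gamma> \<longrightarrow> (y \<epsilon> U j \<longleftrightarrow> j \<epsilon> q))" for y q \<gamma>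
      unfolding M_def mem_cap[OF U'q] mem_U' by blast
    have M_internal: "M q \<gamma> \<in> internal" if "\<gamma> \<epsilon> Fin J" for q \<gamma>
      unfolding M_def by (rule cap_internal[OF J U'q U'_internal H that])
    have M_trm: "trm False s \<Longrightarrow> trm False t \<Longrightarrow> trm False (\<lambda>\<rho>. M (s \<rho>) (t \<rho>))" for s t
      by (rule trm2) (unfold M_def cap_def, intro dfn_intros U'_trm)
    \<comment> \<open>The points having an approximate partner with approximately the code
      \<open>q\<close>. Quantifying over the partner preserves internality.\<close>
    define V where "V a q \<beta> \<gamma> = sep H (\<lambda>x. \<exists>y. y \<epsilon> H \<and> opair x y \<epsilon> approx a \<beta> \<and> y \<epsilon> M q \<gamma>)" for a q \<beta> \<gamma>
    have "dfn False (\<lambda>\<rho>. \<exists>y. y \<epsilon> H \<and> opair (\<rho> 0) y \<epsilon> approx a \<beta> \<and> y \<epsilon> M q \<gamma>)" for a q \<beta> \<gamma>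
      by (intro dfn_intros)
    note mem_V = mem_sep[OF this, of _ H, folded V_def]
    have V_internal: "V a q \<beta> \<gamma> \<in> internal" if "a \<epsilon> A" "\<beta> \<epsilon> Fin B" "\<gamma> \<epsilon> Fin J" for a q \<beta> \<gamma>
      unfolding V_def using H approx_internal[OF that(1,2)] M_internal[OF that(3)]
      by (intro sep_internal dfn_intros) simp_all
    \<comment> \<open>The trace is thus read off from internal sets: saturation exchanges the
      existence of a partner with the intersection over all approximations, so that approximate
      partners at every level produce an actual one.\<close>
    have Q_iff: "q \<epsilon> Q x \<longleftrightarrow> (\<exists>a. a \<epsilon> A \<and> (\<forall>\<beta> \<gamma>. \<beta> \<epsilon> Fin B \<longrightarrow> \<gamma> \<epsilon> Fin J \<longrightarrow> x \<epsilon> V a q \<beta> \<gamma>))"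
      if x: "x \<epsilon> H" and q: "q \<epsilon> pow J" for x q
    proof
      assume "q \<epsilon> Q x"
      then obtain y where y: "opair x y \<epsilon> E" "q = r y" unfolding mem_Q by blast
      then obtain a where a: "a \<epsilon> A" "\<forall>b. b \<epsilon> B \<longrightarrow> opair x y \<epsilon> X a b" unfolding E_iff by blast
      have yH: "y \<epsilon> H" using E_domain[OF y(1)] by blast
      have "x \<epsilon> V a q \<beta> \<gamma>" if "\<beta> \<epsilon> Fin B" "\<gamma> \<epsilon> Fin J" for \<beta> \<gamma>
      proof -
        have "opair x y \<epsilon> approx a \<beta>"
          unfolding mem_approx using x yH a(2) Fin_subset[OF B that(1)] by blast
        moreover have "y \<epsilon> M q \<gamma>"
          unfolding M y(2) mem_r using yH Fin_subset[OF J that(2)] by blast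
        ultimately show ?thesis unfolding mem_V using x yH by blast
      qed
      then show "\<exists>a. a \<epsilon> A \<and> (\<forall>\<beta> \<gamma>. \<beta> \<epsilon> Fin B \<longrightarrow> \<gamma> \<epsilon> Fin J \<longrightarrow> x \<epsilon> V a q \<beta> \<gamma>)" using a(1) by blast
    next
      assume "\<exists>a. a \<epsilon> A \<and> (\<forall>\<beta> \<gamma>. \<beta> \<epsilon> Fin B \<longrightarrow> \<gamma> \<epsilon> Fin J \<longrightarrow> x \<epsilon> V a q \<beta> \<gamma>)"
      then obtain a where a: "a \<epsilon> A" "\<And>\<beta> \<gamma>. \<beta> \<epsilon> Fin B \<Longrightarrow> \<gamma> \<epsilon> Fin J \<Longrightarrow> x \<epsilon> V a q \<beta> \<gamma>" by blast
      \<comment> \<open>The partners of the fixed point \<open>x\<close> at one level of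
        approximation. A point in all of them is related to \<open>x\<close> through
        \<open>a\<close>, and singletons \<open>\<gamma>\<close> show that its code is exactly
        \<open>q\<close>.\<close>
      define S where "S \<beta> \<gamma> = sep H (\<lambda>y. opair x y \<epsilon> approx a \<beta> \<and> y \<epsilon> M q \<gamma>)" for \<beta> \<gamma>
      have "dfn False (\<lambda>\<rho>. opair x (\<rho> 0) \<epsilon> approx a \<beta> \<and> \<rho> 0 \<epsilon> M q \<gamma>)" for \<beta> \<gamma> by (intro dfn_intros)
      note mem_S = mem_sep[OF this, of _ H, folded S_def]
      have xI: "x \<in> internal" by (rule internal_transitive[OF H x])
      have "\<exists>y. \<forall>\<beta> \<gamma>. \<beta> \<epsilon> Fin B \<longrightarrow> \<gamma> \<epsilon> Fin J \<longrightarrow> y \<epsilon> S \<beta> \<gamma>"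
      proof (rule saturation_Fin_Fin[OF B J])
        show "trm False (\<lambda>\<rho>. S (\<rho> 0) (\<rho> (Suc 0)))"
          unfolding S_def by (intro dfn_intros approx_trm M_trm)
        show "S \<beta> \<gamma> \<in> internal" if "\<beta> \<epsilon> Fin B" "\<gamma> \<epsilon> Fin J" for \<beta> \<gamma>
          unfolding S_def using H xI approx_internal[OF a(1) that(1)] M_internal[OF that(2)]
          by (intro sep_internal dfn_intros) simp_all
        show "\<exists>y. y \<epsilon> S \<beta> \<gamma>" if "\<beta> \<epsilon> Fin B" "\<gamma> \<epsilon> Fin J" for \<beta> \<gamma>
          using a(2)[OF that] unfolding mem_V mem_S by blast
        show "y \<epsilon> S \<beta> \<gamma> \<and> y \<epsilon> S \<beta>' \<gamma>'" if "y \<epsilon> S (cup \<beta> \<beta>') (cup \<gamma> \<gamma>')" for y \<beta> \<gamma> \<beta>' \<gamma>'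
          using that unfolding mem_S mem_approx M mem_cup by blast
      qed
      then obtain y where yS: "\<And>\<beta> \<gamma>. \<beta> \<epsilon> Fin B \<Longrightarrow> \<gamma> \<epsilon> Fin J \<Longrightarrow> y \<epsilon> S \<beta> \<gamma>" by blast
      have "opair x y \<epsilon> approx a \<beta>" if "\<beta> \<epsilon> Fin B" for \<beta>
        using yS[OF that Fin_emp[OF J]] unfolding mem_S by blast
      then have "opair x y \<epsilon> E" by (rule approx_all[OF a(1)])
      moreover have "q = r y"
      proof (rule set_ext)
        fix j
        have "y \<epsilon> U j \<longleftrightarrow> j \<epsilon> q" if "j \<epsilon> J"
          using yS[OF Fin_emp[OF B] Fin_ins[OF J Fin_emp[OF J] that]] unfolding mem_S M mem_ins by blast
        moreover have "j \<epsilon> J" if "j \<epsilon> q" using q that unfolding mem_pow[OF J] subset_def by blast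
        ultimately show "j \<epsilon> q \<longleftrightarrow> j \<epsilon> r y" unfolding mem_r by blast
      qed
      ultimately show "q \<epsilon> Q x" unfolding mem_Q by blast
    qed
    define I where "I = prod (prod A (pow J)) (prod (Fin B) (Fin J))"
    define V' where "V' t = V (pfst (pfst t)) (psnd (pfst t)) (pfst (psnd t)) (psnd (psnd t))" for t
    show ?thesis
    \<comment> \<open>Membership in \<open>T\<close> compares \<open>r x\<close> with the choice
      from \<open>Q x\<close>. The sets \<open>U j\<close> determine the code and the sets
      \<open>V' i\<close> determine the trace.\<close>
    proof (rule delta2ss_determined[OF H TH J U U_internal])
      show "I \<in> wellfounded"
        unfolding I_def by (intro wellfounded_prod wellfounded_Fin A B J PJ)
      show "trm False (\<lambda>\<rho>. V' (\<rho> 0))"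
        unfolding V'_def V_def by (intro dfn_intros approx_trm M_trm)
      show "V' i \<in> internal" if "i \<epsilon> I" for i
        using that V_internal unfolding I_def V'_def by (auto simp: mem_prod)
      fix x y assume x: "x \<epsilon> T" and y: "y \<epsilon> H" and U: "\<And>j. j \<epsilon> J \<Longrightarrow> x \<epsilon> U j \<longleftrightarrow> y \<epsilon> U j"
        and V': "\<And>i. i \<epsilon> I \<Longrightarrow> x \<epsilon> V' i \<longleftrightarrow> y \<epsilon> V' i"
      have xH: "x \<epsilon> H" using x unfolding mem_T by blast
      have r: "r x = r y" by (rule set_ext) (use U mem_r in blast)
      have V: "x \<epsilon> V a q \<beta> \<gamma> \<longleftrightarrow> y \<epsilon> V a q \<beta> \<gamma>"
        if "a \<epsilon> A" "q \<epsilon> pow J" "\<beta> \<epsilon> Fin B" "\<gamma> \<epsilon> Fin J" for a q \<beta> \<gamma>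
        using V'[of "opair (opair a q) (opair \<beta> \<gamma>)"] that by (simp add: I_def V'_def)
      have "q \<epsilon> Q x \<longleftrightarrow> q \<epsilon> Q y" if "q \<epsilon> pow J" for q
        unfolding Q_iff[OF xH that] Q_iff[OF y that] using V that by blast
      then have "Q x = Q y" using Q_pow by (intro set_ext) blast
      then show "y \<epsilon> T" using x y r unfolding mem_T by simp
    qed
  qed
  ultimately show ?thesis by blast
qed

text \<open>The relation sends a point to the representative of its class. It is
  \<open>delta2ss\<close> because a pair belongs to it according to which internal sets of the
  families for \<open>E\<close> and for the transversal contain the pair and its second component,
  respectively.\<close>

lemma smooth:
  assumes T: "delta2ss T" "is_transversal T E H"
  shows "delta2ss_smooth E H"
proof -
  have HH: "prod H H \<in> internal" by (rule prod_internal[OF H H])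
  have TH: "y \<epsilon> H" if "y \<epsilon> T" for y
    using T(2) that unfolding is_transversal_def subset_def by blast
  have ex1: "\<exists>!y. y \<epsilon> T \<and> opair x y \<epsilon> E" if "x \<epsilon> H" for x
    using T(2) that unfolding is_transversal_def is_class_of_iff mem_eclass[symmetric] by blast
  obtain A' B' Y where A': "A' \<in> wellfounded" and B': "B' \<in> wellfounded"
    and Y: "trm False (\<lambda>\<rho>. Y (\<rho> 0) (\<rho> (Suc 0)))"
    and Y_internal: "\<And>a b. a \<epsilon> A' \<Longrightarrow> b \<epsilon> B' \<Longrightarrow> Y a b \<in> internal"
    and T_iff: "\<And>x. x \<epsilon> T \<longleftrightarrow> (\<exists>a. a \<epsilon> A' \<and> (\<forall>b. b \<epsilon> B' \<longrightarrow> x \<epsilon> Y a b))"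
  proof (rule sigma2ss_family)
    show "sigma2ss T" using T(1) unfolding delta2ss_def by blast
  qed (rule that)
  note Y_trm = trm2[OF Y]
  define R where "R = sep (prod H H) (\<lambda>p. p \<epsilon> E \<and> psnd p \<epsilon> T)"
  have "dfn False (\<lambda>\<rho>. \<rho> 0 \<epsilon> E \<and> psnd (\<rho> 0) \<epsilon> T)" by (intro dfn_intros)
  note mem_R = mem_sep[OF this, of _ "prod H H", folded R_def]
  have R: "opair x y \<epsilon> R \<longleftrightarrow> opair x y \<epsilon> E \<and> y \<epsilon> T" for x y
    unfolding mem_R using E_domain by auto
  have "delta2ss R"
  proof (rule delta2ss_determined[OF HH])
    show "subset R (prod H H)" unfolding subset_def mem_R by blast
    show "prod A B \<in> wellfounded" "prod A' B' \<in> wellfounded"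
      by (intro wellfounded_prod A B A' B')+
    show "trm False (\<lambda>\<rho>. X (pfst (\<rho> 0)) (psnd (\<rho> 0)))" by (intro X_trm dfn_intros)
    show "X (pfst i) (psnd i) \<in> internal" if "i \<epsilon> prod A B" for i
      using that X_internal by (auto simp: mem_prod)
    \<comment> \<open>The family for \<open>T\<close> speaks of points; these cylinders turn it into
      a family of sets of pairs that tests the second component.\<close>
    define V where "V i = sep (prod H H) (\<lambda>p. \<exists>x. x \<epsilon> H \<and> (\<exists>y. y \<epsilon> H \<and>
      p = opair x y \<and> y \<epsilon> Y (pfst i) (psnd i)))" for i
    have "dfn False (\<lambda>\<rho>. \<exists>x. x \<epsilon> H \<and> (\<exists>y. y \<epsilon> H \<and>
      \<rho> 0 = opair x y \<and> y \<epsilon> Y (pfst i) (psnd i)))" for i by (intro dfn_intros)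
    note mem_V = mem_sep[OF this, of _ "prod H H", folded V_def]
    show "trm False (\<lambda>\<rho>. V (\<rho> 0))" unfolding V_def by (intro dfn_intros Y_trm)
    show "V i \<in> internal" if "i \<epsilon> prod A' B'" for i
    proof -
      have "Y (pfst i) (psnd i) \<in> internal" using that Y_internal by (auto simp: mem_prod)
      then show ?thesis unfolding V_def using H HH by (intro sep_internal dfn_intros) simp_all
    qed
    fix p q assume p: "p \<epsilon> R" and q: "q \<epsilon> prod H H"
      and X: "\<And>i. i \<epsilon> prod A B \<Longrightarrow> p \<epsilon> X (pfst i) (psnd i) \<longleftrightarrow> q \<epsilon> X (pfst i) (psnd i)"
      and V: "\<And>i. i \<epsilon> prod A' B' \<Longrightarrow> p \<epsilon> V i \<longleftrightarrow> q \<epsilon> V i"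
    obtain x y where p': "p = opair x y" "x \<epsilon> H" "y \<epsilon> H" using p unfolding mem_R mem_prod by blast
    obtain x' y' where q': "q = opair x' y'" "x' \<epsilon> H" "y' \<epsilon> H" using q unfolding mem_prod by blast
    have "p \<epsilon> X a b \<longleftrightarrow> q \<epsilon> X a b" if "a \<epsilon> A" "b \<epsilon> B" for a b
      using X[of "opair a b"] that by simp
    then have "q \<epsilon> E" using p unfolding mem_R E_iff by blast
    moreover have Y_eq: "y \<epsilon> Y a b \<longleftrightarrow> y' \<epsilon> Y a b" if "a \<epsilon> A'" "b \<epsilon> B'" for a b
      using V[of "opair a b"] that p' q' by (simp add: mem_V)
    have "y \<epsilon> T" using p unfolding p'(1) R by blast
    then have "y' \<epsilon> T" unfolding T_iff using Y_eq by blast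
    ultimately show "q \<epsilon> R" by (simp add: q'(1) R)
  qed
  have "trm False (\<lambda>\<rho>. opair (\<rho> 0) (\<rho> 0))" by (intro dfn_intros)
  note mem_D = mem_img[OF this, of _ T]
  have "is_equality_on (img T (\<lambda>y. opair y y)) T"
    unfolding is_equality_on_def mem_D is_opair_iff by blast
  moreover have "invariant_preinjection R E H (img T (\<lambda>y. opair y y)) T"
    unfolding invariant_preinjection_def related_iff R
  proof (intro conjI allI impI)
    show "relation_between R H T"
      unfolding relation_between_def is_opair_iff
    proof (intro allI impI)
      fix p assume p: "p \<epsilon> R"
      then obtain x y where "p = opair x y" "x \<epsilon> H" unfolding mem_R mem_prod by blast
      then show "\<exists>x y. x \<epsilon> H \<and> y \<epsilon> T \<and> p = opair x y" using p R by blast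
    qed
    show "\<exists>y. opair x y \<epsilon> E \<and> y \<epsilon> T" if "x \<epsilon> H" for x using ex1[OF that] by blast
    fix x y x' y' assume *: "(opair x y \<epsilon> E \<and> y \<epsilon> T) \<and> opair x' y' \<epsilon> E \<and> y' \<epsilon> T"
    have "opair x x' \<epsilon> E \<longleftrightarrow> y = y'"
    proof
      assume "opair x x' \<epsilon> E"
      then have "opair x y' \<epsilon> E" using * E_trans by blast
      then show "y = y'" using * ex1[of x] E_domain by blast
    next
      assume "y = y'"
      then show "opair x x' \<epsilon> E" using * E_trans E_sym by blast
    qed
    then show "opair x x' \<epsilon> E \<longleftrightarrow> opair y y' \<epsilon> img T (\<lambda>y. opair y y)"
      unfolding mem_D opair_inject using * by blast
  qed
  ultimately show ?thesis
    unfolding delta2ss_smooth_def using T(1) \<open>delta2ss R\<close> by blast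
qed

end

theorem theorem9p1:
  fixes mem :: "'u \<Rightarrow> 'u \<Rightarrow> bool" and st :: "'u \<Rightarrow> bool" and H E :: 'u
  assumes "HST mem st"
    and "H \<in> st_structure.internal mem st"
    and "st_structure.equivalence_on mem E H"
    and "st_structure.delta2ss mem st E"
    and "\<And>C. st_structure.is_class_of mem C E H \<Longrightarrow> st_structure.standard_size mem C"
  shows "(\<exists>T. st_structure.delta2ss mem st T \<and> st_structure.is_transversal mem T E H) \<and>
    st_structure.delta2ss_smooth mem st E H"
proof -
  interpret HST mem st by fact
  have "sigma2ss E" using assms(4) unfolding delta2ss_def by blast
  then obtain A B X where AB: "A \<in> wellfounded" "B \<in> wellfounded"
    "trm False (\<lambda>\<rho>. X (\<rho> 0) (\<rho> (Suc 0)))"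
    "\<And>a b. mem a A \<Longrightarrow> mem b B \<Longrightarrow> X a b \<in> internal"
    "\<And>x. mem x E \<longleftrightarrow> (\<exists>a. mem a A \<and> (\<forall>b. mem b B \<longrightarrow> mem x (X a b)))"
    by (rule sigma2ss_family) (rule that)
  interpret standard_size_classes mem st H E A B X
    by unfold_locales (fact assms(2,3,5) AB)+
  show ?thesis using transversal smooth by blast
qed

end
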